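(* Let $\psi$ be a solution of the Regge–Wheeler equation $\Box_g\psi - V_g^{RW}\psi=0$ or of the Zerilli equations $\Box_g\psi - V_g^{Z}\psi=0$ on the exterior Schwarzschild spacetime (supported on spherical harmonic modes $\ell\ge 2$). Then for all $\tau>\tau_0$, $$E^N(\psi,\Sigma_\tau)\lesssim E^N(\psi,\Sigma_{\tau_0}).$$
   Context: Spacetime. Fix $M>0$. The Schwarzschild exterior is $\mathcal M=\mathbb R\times[2M,\infty)\times S^2$ with metric $g=-(1-\mu)\,dt^2+(1-\mu)^{-1}dr^2+r^2d\sigma_{S^2}$, $\mu=2M/r$. The tortoise coordinate is $r^*=r+2M\log(r-2M)-3M-2M\log M$; $u=t-r^*$, $v=t+r^*$; $\partial_u=\partial_t-\partial_{r^*}$, $\partial_v=\partial_t+\partial_{r^*}$ (these two are $(t,r^* )$-coordinate derivatives). Near the future event horizon $\mathcal H^+=\{r=2M\}$ one uses coordinates $(v,r,\theta,\phi)$, in which $g=-(1-\mu)dv^2+2\,dr\,dv+r^2d\sigma_{S^2}$. $\nabla\!\!\!\!/$ is the induced covariant derivative on the sphere $S^2(t,r)$ of constant $t,r$, with norms taken in the induced metric. All objects are smooth. Equations. $V_g^{RW}=-\frac{8M}{r^3}$. The Zerilli equation is posed for each spherical harmonic mode $\ell$, with $V_g^{Z}=-\frac{8M}{r^3}\,\frac{(2\bar\lambda+3)(2\bar\lambda r+3M)r}{4(\bar\lambda r+3M)^2}$, $2\bar\lambda=(\ell-1)(\ell+2)$; i.e. $\psi=\sum_{\ell}\psi_\ell$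 and each $\psi_\ell$ solves the equation with its own potential. Only solutions supported on modes $\ell\ge2$ are considered. Hypersurfaces. Fix $r_{NH}>2M$, with tortoise value $r_{NH}^*$. $\Sigma^i_\tau=\{v=\tau+r^*_{NH}\}\cap\{r<r_{NH}\}$, $\Sigma^e_\tau=\{t=\tau\}\cap\{r\ge r_{NH}\}$, $\Sigma_\tau=\Sigma^i_\tau\cup\Sigma^e_\tau$. Vector field $N$. $N=\partial_t+\frac{y_1(r)}{1-\mu}\partial_u+y_2(r)\partial_v$ is a globally defined time-like vector field, with $y_1,y_2>0$ supported in $r\le r_{NH}$, $y_1=1,y_2=0$ at the event horizon; thus $N=\partial_t$ for $r\ge r_{NH}$. Energy. $\mathcal T_{\alpha\beta}(\varphi)=D_\alpha\varphi D_\beta\varphi-\frac12 g_{\alpha\beta}(D^\gamma\varphi D_\gamma\varphi+V_g\varphi^2)$, where $D$ is the Levi-Civita connection of $g$, $P^\xi_\alpha(\varphi)=\mathcal T_{\alpha\beta}\xi^\beta$, and $E^N(\varphi,\Sigma_\tau)=\int_{\Sigma_\tau}P^N_\alpha(\varphi)n^\alpha_{\Sigma_\tau}d\mu_{\Sigma_\tau}$ with $n$ the future normal. (On the null piece $\Sigma^i_\tau$ one takes $n=-\partial_r$ in $(v,r)$ coordinates with measure $r^2dr\,d\sigma_{S^2}$.) For $\ell\ge2$, $$E^N(\varphi,\Sigma_\tau)\sim\int_{\Sigma^i_\tau}\Big(|\partial_r\varphi|^2+|\nabla\!\!\!\!/\varphi|^2+\tfrac{|\varphi|^2}{r^2}\Big)r^2dr\,d\sigma_{S^2}+\int_{\Sigma^e_\tau}\Big(|\partial_t\varphi|^2+|\partial_r\varphi|^2+|\nabla\!\!\!\!/\varphi|^2+\tfrac{|\varphi|^2}{r^2}\Big)r^2dr^*d\sigma_{S^2},$$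 the first integral being in $(v,r,\theta,\phi)$ coordinates. $x\lesssim y$ means $x\le cy$ for a universal constant $c$ (independent of $\psi$, $\tau$, $\tau_0$); $x\sim y$ means $x\lesssim y$ and $y\lesssim x$. *)

theory Defs
  imports "HOL-Analysis.Analysis"
begin

section \<open>Smooth functions\<close>

primrec Ck_on :: "nat \<Rightarrow> ('a::euclidean_space \<Rightarrow> real) \<Rightarrow> 'a set \<Rightarrow> bool" where
  "Ck_on 0 f U \<longleftrightarrow> continuous_on U f"
| "Ck_on (Suc k) f U \<longleftrightarrow>
     f differentiable_on U \<and> (\<forall>b\<in>Basis. Ck_on k (\<lambda>x. frechet_derivative f (at x) b) U)"

text \<open>Smoothness on a set that need not be open (a region with its boundary, or a submanifold)
  means smoothness on some open neighbourhood. For the regions below this is smoothness up to and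
  including the boundary; the values of the function off the set play no role.\<close>

definition smooth_near :: "('a::euclidean_space \<Rightarrow> real) \<Rightarrow> 'a set \<Rightarrow> bool" where
  "smooth_near f S \<longleftrightarrow> (\<exists>U. open U \<and> S \<subseteq> U \<and> (\<forall>k. Ck_on k f U))"

section \<open>Metrics in coordinates\<close>

definition coord_deriv :: "'n \<Rightarrow> (real^'n \<Rightarrow> real) \<Rightarrow> real^'n \<Rightarrow> real" where
  "coord_deriv \<alpha> f q = frechet_derivative f (at q) (axis \<alpha> 1)"

text \<open>The Laplace--Beltrami operator (d'Alembertian in Lorentzian signature)
  \<open>|g|\<^sup>-\<^sup>1\<^sup>/\<^sup>2 \<partial>\<^sub>\<alpha> (|g|\<^sup>1\<^sup>/\<^sup>2 g\<^sup>\<alpha>\<^sup>\<beta> \<partial>\<^sub>\<beta> f)\<close> of a metric given by its component matrix in a chart.\<close>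

definition laplace_beltrami :: "(real^'n \<Rightarrow> real^'n^'n) \<Rightarrow> (real^'n \<Rightarrow> real) \<Rightarrow> real^'n \<Rightarrow> real" where
  "laplace_beltrami g f q =
     (\<Sum>\<alpha>\<in>UNIV. coord_deriv \<alpha>
        (\<lambda>p. sqrt \<bar>det (g p)\<bar> * (\<Sum>\<beta>\<in>UNIV. matrix_inv (g p) $ \<alpha> $ \<beta> * coord_deriv \<beta> f p)) q)
     / sqrt \<bar>det (g q)\<bar>"

text \<open>The energy-momentum tensor
  \<open>T\<^sub>\<alpha>\<^sub>\<beta> = D\<^sub>\<alpha>\<phi> D\<^sub>\<beta>\<phi> - 1/2 g\<^sub>\<alpha>\<^sub>\<beta> (D\<^sup>\<gamma>\<phi> D\<^sub>\<gamma>\<phi> + V \<phi>\<^sup>2)\<close>, with \<open>V\<close> the potential as a function on the chart,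
  and the contraction \<open>T\<^sub>\<alpha>\<^sub>\<beta> n\<^sup>\<alpha> \<xi>\<^sup>\<beta>\<close> of its current \<open>P\<^sup>\<xi>\<close> with a vector \<open>n\<close>.\<close>

definition energy_momentum ::
  "(real^'n \<Rightarrow> real^'n^'n) \<Rightarrow> (real^'n \<Rightarrow> real) \<Rightarrow> (real^'n \<Rightarrow> real) \<Rightarrow> real^'n \<Rightarrow> 'n \<Rightarrow> 'n \<Rightarrow> real"
where
  "energy_momentum g V f q \<alpha> \<beta> =
     coord_deriv \<alpha> f q * coord_deriv \<beta> f q
     - 1/2 * g q $ \<alpha> $ \<beta> *
       ((\<Sum>\<gamma>\<in>UNIV. \<Sum>\<delta>\<in>UNIV. matrix_inv (g q) $ \<gamma> $ \<delta> * coord_deriv \<gamma> f q * coord_deriv \<delta> f q)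
        + V q * (f q)\<^sup>2)"

definition current_flux ::
  "(real^'n \<Rightarrow> real^'n^'n) \<Rightarrow> (real^'n \<Rightarrow> real) \<Rightarrow> (real^'n \<Rightarrow> real) \<Rightarrow> real^'n \<Rightarrow> real^'n \<Rightarrow> real^'n \<Rightarrow> real"
where
  "current_flux g V f \<xi> n q =
     (\<Sum>\<alpha>\<in>UNIV. \<Sum>\<beta>\<in>UNIV. energy_momentum g V f q \<alpha> \<beta> * \<xi> $ \<beta> * n $ \<alpha>)"

section \<open>The round sphere and spherical harmonics\<close>

text \<open>Coordinates on \<open>S\<^sup>2\<close> are \<open>(\<theta>, \<phi>)\<close>, in this order.\<close>

definition sphere_point :: "real \<Rightarrow> real \<Rightarrow> real^3" where
  "sphere_point \<theta> \<phi> = vector [sin \<theta> * cos \<phi>, sin \<theta> * sin \<phi>, cos \<theta>]"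

definition sphere_metric :: "real^2 \<Rightarrow> real^2^2" where
  "sphere_metric s = vector [vector [1, 0], vector [0, (sin (s $ 1))\<^sup>2]]"

definition sphere_integral :: "(real \<Rightarrow> real \<Rightarrow> real) \<Rightarrow> real" where
  "sphere_integral F =
     integral {0..pi} (\<lambda>\<theta>. integral {0..2 * pi} (\<lambda>\<phi>. F \<theta> \<phi> * sin \<theta>))"

text \<open>Smooth eigenfunctions of the Laplacian of the unit sphere. The chart degenerates only at the
  poles, where the equation follows by continuity.\<close>

definition spherical_harmonic :: "nat \<Rightarrow> (real^3 \<Rightarrow> real) \<Rightarrow> bool" where
  "spherical_harmonic l Y \<longleftrightarrow>
     smooth_near Y (sphere 0 1) \<and>
     (\<forall>s. 0 < s $ 1 \<and> s $ 1 < pi \<longrightarrow>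
        laplace_beltrami sphere_metric (\<lambda>s. Y (sphere_point (s $ 1) (s $ 2))) s
          = - (real l * (real l + 1)) * Y (sphere_point (s $ 1) (s $ 2)))"

section \<open>The Schwarzschild exterior\<close>

text \<open>A point of the exterior, future event horizon included, is a pair \<open>(v, x)\<close> with
  \<open>x = r \<omega> \<in> \<real>\<^sup>3\<close>, \<open>r \<ge> 2M\<close>, \<open>\<omega> \<in> S\<^sup>2\<close>, where \<open>v = t + r\<^sup>*\<close>. This describes the manifold with
  boundary \<open>\<real> \<times> [2M, \<infinity>) \<times> S\<^sup>2\<close> globally, so smoothness at the horizon and at the poles is plain
  smoothness in \<open>(v, x)\<close>.\<close>

definition exterior :: "real \<Rightarrow> (real \<times> (real^3)) set" where
  "exterior M = {(v, x). norm x \<ge> 2 * M}"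

text \<open>The coordinates \<open>(v, r, \<theta>, \<phi>)\<close>, in this order, in which tensor components are taken.\<close>

definition chart_point :: "real^4 \<Rightarrow> real \<times> (real^3)" where
  "chart_point q = (q $ 1, q $ 2 *\<^sub>R sphere_point (q $ 3) (q $ 4))"

abbreviation coords :: "real \<Rightarrow> real \<Rightarrow> real \<Rightarrow> real \<Rightarrow> real^4" where
  "coords v r \<theta> \<phi> \<equiv> (\<chi> i. if i = 1 then v else if i = 2 then r else if i = 3 then \<theta> else \<phi>)"

definition mu :: "real \<Rightarrow> real \<Rightarrow> real" where
  "mu M r = 2 * M / r"

text \<open>\<open>g = -(1 - \<mu>) dv\<^sup>2 + 2 dr dv + r\<^sup>2 (d\<theta>\<^sup>2 + sin\<^sup>2\<theta> d\<phi>\<^sup>2)\<close>.\<close>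

definition schwarzschild :: "real \<Rightarrow> real^4 \<Rightarrow> real^4^4" where
  "schwarzschild M q = (\<chi> i j.
     if i = 1 \<and> j = 1 then - (1 - mu M (q $ 2))
     else if (i = 1 \<and> j = 2) \<or> (i = 2 \<and> j = 1) then 1
     else if i = 3 \<and> j = 3 then (q $ 2)\<^sup>2
     else if i = 4 \<and> j = 4 then (q $ 2)\<^sup>2 * (sin (q $ 3))\<^sup>2
     else 0)"

definition tortoise :: "real \<Rightarrow> real \<Rightarrow> real" where
  "tortoise M r = r + 2 * M * ln (r - 2 * M) - 3 * M - 2 * M * ln M"

text \<open>Components in \<open>(v, r, \<theta>, \<phi>)\<close> of the coordinate fields of \<open>(v, r)\<close> (here \<open>e_v\<close>, \<open>e_r\<close>) and of
  \<open>(t, r\<^sup>*)\<close>. Since \<open>v = t + r\<^sup>*\<close> and \<open>dr/dr\<^sup>* = 1 - \<mu>\<close>, the \<open>(t, r\<^sup>*)\<close>-derivatives are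
  \<open>\<partial>\<^sub>t = e_v\<close> and \<open>\<partial>\<^sub>r\<^sub>* = e_v + (1 - \<mu>) e_r\<close>. The field \<open>\<partial>\<^sub>v = \<partial>\<^sub>t + \<partial>\<^sub>r\<^sub>*\<close> is not \<open>e_v\<close>.\<close>

definition e_v :: "real^4" where "e_v = axis 1 1"
definition e_r :: "real^4" where "e_r = axis 2 1"

definition d_t :: "real^4" where "d_t = e_v"
definition d_rstar :: "real \<Rightarrow> real \<Rightarrow> real^4" where "d_rstar M r = e_v + (1 - mu M r) *\<^sub>R e_r"
definition d_u :: "real \<Rightarrow> real \<Rightarrow> real^4" where "d_u M r = d_t - d_rstar M r"
definition d_v :: "real \<Rightarrow> real \<Rightarrow> real^4" where "d_v M r = d_t + d_rstar M r"

text \<open>\<open>N = \<partial>\<^sub>t + y\<^sub>1/(1 - \<mu>) \<partial>\<^sub>u + y\<^sub>2 \<partial>\<^sub>v\<close>. As \<open>\<partial>\<^sub>u = -(1 - \<mu>) e_r\<close>, the middle term is \<open>- y\<^sub>1 e_r\<close>,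
  which is how it extends to the horizon.\<close>

definition N_field :: "real \<Rightarrow> (real \<Rightarrow> real) \<Rightarrow> (real \<Rightarrow> real) \<Rightarrow> real \<Rightarrow> real^4" where
  "N_field M y1 y2 r = d_t - y1 r *\<^sub>R e_r + y2 r *\<^sub>R d_v M r"

lemma N_field_eq:
  assumes "M > 0" "r > 2 * M"
  shows "N_field M y1 y2 r = d_t + (y1 r / (1 - mu M r)) *\<^sub>R d_u M r + y2 r *\<^sub>R d_v M r"
proof -
  have "1 - mu M r \<noteq> 0" using assms by (simp add: mu_def)
  then show ?thesis by (simp add: N_field_def d_u_def d_rstar_def d_t_def)
qed

definition N_profiles :: "real \<Rightarrow> real \<Rightarrow> (real \<Rightarrow> real) \<Rightarrow> (real \<Rightarrow> real) \<Rightarrow> bool" where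
  "N_profiles M r_NH y1 y2 \<longleftrightarrow>
     smooth_near y1 {2 * M..} \<and> smooth_near y2 {2 * M..} \<and>
     (\<forall>r. 2 * M < r \<and> r < r_NH \<longrightarrow> y1 r > 0 \<and> y2 r > 0) \<and>
     (\<forall>r\<ge>r_NH. y1 r = 0 \<and> y2 r = 0) \<and>
     y1 (2 * M) = 1 \<and> y2 (2 * M) = 0 \<and>
     (\<forall>q. q $ 2 \<ge> 2 * M \<longrightarrow>
        N_field M y1 y2 (q $ 2) \<bullet> (schwarzschild M q *v N_field M y1 y2 (q $ 2)) < 0)"

section \<open>The Regge--Wheeler and Zerilli equations\<close>

definition V_RW :: "real \<Rightarrow> real \<Rightarrow> real" where
  "V_RW M r = - 8 * M / r^3"

definition V_Z :: "real \<Rightarrow> nat \<Rightarrow> real \<Rightarrow> real" where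
  "V_Z M l r = (let lam = (real l - 1) * (real l + 2) / 2 in
     - 8 * M / r^3 * (((2 * lam + 3) * (2 * lam * r + 3 * M) * r) / (4 * (lam * r + 3 * M)\<^sup>2)))"

text \<open>Smooth solutions of \<open>\<box>\<^sub>g \<psi> - V \<psi> = 0\<close> on the exterior. Again the poles are covered by
  continuity.\<close>

definition wave_solution :: "real \<Rightarrow> (real \<Rightarrow> real) \<Rightarrow> (real \<times> (real^3) \<Rightarrow> real) \<Rightarrow> bool" where
  "wave_solution M V \<psi> \<longleftrightarrow>
     smooth_near \<psi> (exterior M) \<and>
     (\<forall>q. q $ 2 \<ge> 2 * M \<and> 0 < q $ 3 \<and> q $ 3 < pi \<longrightarrow>
        laplace_beltrami (schwarzschild M) (\<psi> \<circ> chart_point) q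
          - V (q $ 2) * \<psi> (chart_point q) = 0)"

text \<open>\<open>\<psi> = \<Sum>\<^bsub>l\<ge>2\<^esub> \<psi>\<^sub>l\<close>, with convergence in \<open>L\<^sup>2\<close> of every sphere of constant \<open>v, r\<close>. By orthogonality
  the modes are determined by \<open>\<psi>\<close> on the exterior.\<close>

definition modes_ge2 :: "real \<Rightarrow> (real \<times> (real^3) \<Rightarrow> real) \<Rightarrow> (nat \<Rightarrow> real \<times> (real^3) \<Rightarrow> real) \<Rightarrow> bool" where
  "modes_ge2 M \<psi> \<psi>\<^sub>m \<longleftrightarrow>
     smooth_near \<psi> (exterior M) \<and>
     (\<forall>l\<ge>2. smooth_near (\<psi>\<^sub>m l) (exterior M)) \<and>
     (\<forall>l\<ge>2. \<forall>v. \<forall>r\<ge>2 * M. spherical_harmonic l (\<lambda>\<omega>. \<psi>\<^sub>m l (v, r *\<^sub>R \<omega>))) \<and>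
     (\<forall>v. \<forall>r\<ge>2 * M.
        (\<lambda>n. sphere_integral (\<lambda>\<theta> \<phi>.
           (\<psi> (v, r *\<^sub>R sphere_point \<theta> \<phi>) - (\<Sum>l\<in>{2..n}. \<psi>\<^sub>m l (v, r *\<^sub>R sphere_point \<theta> \<phi>)))\<^sup>2))
        \<longlonglongrightarrow> 0)"

definition RW_solution :: "real \<Rightarrow> (real \<times> (real^3) \<Rightarrow> real) \<Rightarrow> bool" where
  "RW_solution M \<psi> \<longleftrightarrow> wave_solution M (V_RW M) \<psi> \<and> (\<exists>\<psi>\<^sub>m. modes_ge2 M \<psi> \<psi>\<^sub>m)"

definition Zerilli_solution ::
  "real \<Rightarrow> (real \<times> (real^3) \<Rightarrow> real) \<Rightarrow> (nat \<Rightarrow> real \<times> (real^3) \<Rightarrow> real) \<Rightarrow> bool" where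
  "Zerilli_solution M \<psi> \<psi>\<^sub>m \<longleftrightarrow>
     modes_ge2 M \<psi> \<psi>\<^sub>m \<and> (\<forall>l\<ge>2. wave_solution M (V_Z M l) (\<psi>\<^sub>m l))"

section \<open>The energy\<close>

text \<open>The flux of \<open>P\<^sup>N\<close> through the two pieces of \<open>\<Sigma>\<^sub>\<tau>\<close>. On \<open>{v = \<tau> + r\<^sup>*\<^sub>N\<^sub>H}\<close>, which is null, the normal
  is \<open>-e_r\<close> and the measure \<open>r\<^sup>2 dr d\<sigma>\<close>. On \<open>{t = \<tau>} = {v = \<tau> + r\<^sup>*}\<close> the future unit normal is
  \<open>(1 - \<mu>)\<^sup>-\<^sup>1\<^sup>/\<^sup>2 \<partial>\<^sub>t\<close> and the induced measure \<open>(1 - \<mu>)\<^sup>-\<^sup>1\<^sup>/\<^sup>2 r\<^sup>2 dr d\<sigma>\<close>.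

  As \<open>V < 0\<close>, the density is nonnegative only after integration over the spheres (for \<open>l \<ge> 2\<close>), so
  these integrals are done first; the radial integral then has a value in \<open>[0, \<infinity>]\<close>.\<close>

definition energy ::
  "real \<Rightarrow> real \<Rightarrow> (real \<Rightarrow> real) \<Rightarrow> (real \<Rightarrow> real) \<Rightarrow> (real \<Rightarrow> real) \<Rightarrow> (real \<times> (real^3) \<Rightarrow> real) \<Rightarrow> real \<Rightarrow> ennreal"
where
  "energy M r_NH y1 y2 V \<phi> \<tau> =
     (let flux = (\<lambda>v r n. sphere_integral (\<lambda>\<theta> \<phi>'.
            current_flux (schwarzschild M) (\<lambda>q. V (q $ 2)) (\<phi> \<circ> chart_point)
              (N_field M y1 y2 r) n (coords v r \<theta> \<phi>')))
      in (\<integral>\<^sup>+ r\<in>{2 * M..<r_NH}. ennreal (flux (\<tau> + tortoise M r_NH) r (- e_r) * r\<^sup>2) \<partial>lborel)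
       + (\<integral>\<^sup>+ r\<in>{r_NH..}. ennreal (flux (\<tau> + tortoise M r) r ((1 / sqrt (1 - mu M r)) *\<^sub>R d_t)
            * (r\<^sup>2 / sqrt (1 - mu M r))) \<partial>lborel))"

definition energy_RW ::
  "real \<Rightarrow> real \<Rightarrow> (real \<Rightarrow> real) \<Rightarrow> (real \<Rightarrow> real) \<Rightarrow> (real \<times> (real^3) \<Rightarrow> real) \<Rightarrow> real \<Rightarrow> ennreal" where
  "energy_RW M r_NH y1 y2 \<psi> \<tau> = energy M r_NH y1 y2 (V_RW M) \<psi> \<tau>"

text \<open>The potential depends on the mode, so the energy is the sum of those of the modes, each with
  its own potential (cross terms between different modes integrate to zero over the spheres).\<close>

definition energy_Z ::
  "real \<Rightarrow> real \<Rightarrow> (real \<Rightarrow> real) \<Rightarrow> (real \<Rightarrow> real) \<Rightarrow> (nat \<Rightarrow> real \<times> (real^3) \<Rightarrow> real) \<Rightarrow> real \<Rightarrow> ennreal" where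
  "energy_Z M r_NH y1 y2 \<psi>\<^sub>m \<tau> = (\<Sum>\<^sub>\<infinity>l\<in>{2..}. energy M r_NH y1 y2 (V_Z M l) (\<psi>\<^sub>m l) \<tau>)"

end

theory Submission
  imports Defs
begin

text \<open>Of the potentials only \<open>-4 \<le> r\<^sup>2 V \<le> 0\<close> matters. On modes \<open>l \<ge> 2\<close> the Poincare
  inequality on the unit sphere has the constant 6, so after integration over a sphere
  \<open>|\<nabla>\<psi>|\<^sup>2 + V \<psi>\<^sup>2\<close> still dominates a third of its gradient part.

  The current of \<open>\<partial>\<^sub>t\<close> is conserved and its flux through the horizon and through the hypersurfaces
  of constant \<open>v\<close> is nonnegative; so its energy does not increase, and a cutoff that decreases in
  \<open>v\<close> makes this rigorous without decay in \<open>r\<close>. The energy degenerates only in the derivative \<open>\<partial>\<^sub>r \<psi>\<close> at the horizon.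

  That derivative is recovered without bulk terms in \<open>\<partial>\<^sub>v \<psi>\<close> (which \<open>\<Sigma>\<^sup>i\<^sub>\<tau>\<close> does not control) from
  the equation of \<open>\<Psi> = r \<psi>\<close>,
  \<open>2 \<partial>\<^sub>v \<partial>\<^sub>r \<Psi> + \<partial>\<^sub>r ((1 - \<mu>) \<partial>\<^sub>r \<Psi>) + r\<^sup>-\<^sup>2 \<Delta> \<Psi> - (V + 2 M / r\<^sup>3) \<Psi> = 0\<close>,
  multiplied by \<open>(r\<^sub>N\<^sub>H - r) \<partial>\<^sub>r \<Psi>\<close>: the derivative of \<open>1 - \<mu>\<close> is positive (red-shift), which gives
  \<open>G' \<le> -\<kappa> G + C E\<close> for \<open>G = \<integral> (r\<^sub>N\<^sub>H - r) |\<partial>\<^sub>r \<Psi>|\<^sup>2\<close> on \<open>\<Sigma>\<^sup>i\<^sub>\<tau>\<close>, with \<open>E\<close> the bounded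
  energy of \<open>\<partial>\<^sub>t\<close>. The resulting constant does not depend on \<open>V\<close>, hence is uniform in the mode of
  the Zerilli equations.\<close>

section \<open>Calculus of smooth functions\<close>

text \<open>No decay in \<open>r\<close> is assumed and the energy may be infinite, so a boundary
  term at infinity cannot simply be dropped. A cutoff depending on \<open>v\<close> alone is
  constant on \<Sigma>^i, and its gradient is null: the error it produces is a multiple of the flux
  of the \<partial>_t current through a hypersurface of constant \<open>v\<close>, which has a sign.
  On \<Sigma>^e one has \<open>v = \<tau> + tortoise M r\<close>, so both pieces stay in the
  coordinates (v, r), and after integration over the spheres only functions of these two variables
  remain.

  The weight r_NH - r vanishes at r_NH, so the red-shift identity has no boundary term there; at the
  horizon the radial boundary term is killed by 1 - \<mu> = 0 and the angular one has the favourable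
  sign. Nothing is lost near r_NH, where 1 - \<mu> is bounded below and the \<partial>_t energy
  itself controls the radial derivative. The damping \<kappa> makes the final constant independent
  of the elapsed time.

  The modes sum to \<psi> only in L^2 of each sphere, so gradients cannot be summed termwise; an
  inequality of Bessel type for the gradients replaces this.\<close>

lemma has_real_derivative_along_curve:
  fixes f :: "'a::real_inner \<Rightarrow> real"
  assumes "(f has_derivative (\<lambda>h. g \<bullet> h)) (at (\<gamma> t))" "(\<gamma> has_vector_derivative \<gamma>') (at t within S)"
  shows "((\<lambda>t. f (\<gamma> t)) has_real_derivative g \<bullet> \<gamma>') (at t within S)"
  unfolding has_field_derivative_def
  by (rule has_derivative_eq_rhs[OF has_derivative_compose[OF assms(2)[unfolded has_vector_derivative_def] assms(1)]])
     (simp add: fun_eq_iff)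

lemma has_vector_derivative_along_curve:
  assumes "(F has_derivative H) (at (\<gamma> t))" "(\<gamma> has_vector_derivative \<gamma>') (at t within S)"
  shows "((\<lambda>t. F (\<gamma> t)) has_vector_derivative H \<gamma>') (at t within S)"
  using has_derivative_compose[OF assms(2)[unfolded has_vector_derivative_def] assms(1)]
    linear_scale[OF has_derivative_linear[OF assms(1)]]
  by (simp add: has_vector_derivative_def)

lemma has_vector_derivative_line:
  "((\<lambda>s. x + s *\<^sub>R a) has_vector_derivative a) (at s within S)"
  by (auto simp: has_vector_derivative_def intro!: derivative_eq_intros)

lemma has_real_derivative_inner_curve:
  assumes "(F has_vector_derivative F') (at t within S)" "(G has_vector_derivative G') (at t within S)"
  shows "((\<lambda>t. F t \<bullet> G t) has_real_derivative (F' \<bullet> G t + F t \<bullet> G')) (at t within S)"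
  unfolding has_field_derivative_def
  by (rule has_derivative_eq_rhs[OF has_derivative_inner[OF assms[unfolded has_vector_derivative_def]]])
     (simp add: fun_eq_iff algebra_simps)

text \<open>Schwarz's theorem, with continuity of the Hessian only in each fixed direction. The
  increment f(x + s a + t b) - f(x + s a) is an integral of the gradient in direction b;
  differentiating it in s at 0 in two ways, and then in t at 0, gives the two mixed
  derivatives.\<close>

lemma second_derivative_symmetric:
  fixes f :: "'a::euclidean_space \<Rightarrow> real" and gr :: "'a \<Rightarrow> 'a"
  assumes "open U" "x \<in> U"
    and f: "\<And>x. x \<in> U \<Longrightarrow> (f has_derivative (\<lambda>h. gr x \<bullet> h)) (at x)"
    and gr: "\<And>x. x \<in> U \<Longrightarrow> (gr has_derivative Hs x) (at x)"
    and Hs: "\<And>a. continuous_on U (\<lambda>x. Hs x a)"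
  shows "Hs x a \<bullet> b = Hs x b \<bullet> a"
proof -
  obtain \<epsilon> where \<epsilon>: "\<epsilon> > 0" "ball x \<epsilon> \<subseteq> U"
    using assms openE by blast
  \<comment> \<open>The summand 1 keeps \<open>n\<close> positive when both directions vanish;
    \<open>\<delta>\<close> then keeps the whole parallelogram inside the ball.\<close>
  define n where "n = 1 + norm a + norm b"
  define \<delta> where "\<delta> = \<epsilon> / 2 / n"
  have pos: "n > 0" unfolding n_def by (simp add: add_pos_nonneg)
  have \<delta>: "\<delta> > 0" using \<epsilon> pos by (simp add: \<delta>_def)
  have inU: "x + s *\<^sub>R a + t *\<^sub>R b \<in> U" if "\<bar>s\<bar> \<le> \<delta>" "\<bar>t\<bar> \<le> \<delta>" for s t
  proof -
    have "norm (s *\<^sub>R a + t *\<^sub>R b) \<le> \<bar>s\<bar> * norm a + \<bar>t\<bar> * norm b"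
      by (metis norm_scaleR norm_triangle_ineq)
    also have "\<dots> \<le> \<delta> * norm a + \<delta> * norm b"
      using that by (intro add_mono mult_right_mono) auto
    also have "\<dots> \<le> \<delta> * n" using \<delta> by (simp add: algebra_simps n_def)
    also have "\<dots> = \<epsilon> / 2" using pos unfolding \<delta>_def by simp
    also have "\<dots> < \<epsilon>" using \<epsilon> by simp
    finally have "x + (s *\<^sub>R a + t *\<^sub>R b) \<in> ball x \<epsilon>" by (metis add_diff_cancel_left' dist_commute dist_norm mem_ball)
    then show ?thesis using \<epsilon> by (auto simp: add.assoc)
  qed
  have cgr: "continuous_on U gr"
    using gr by (meson continuous_at_imp_continuous_on has_derivative_continuous)
  note ci = continuous_on_compose2[OF cgr] continuous_on_compose2[OF Hs]
  \<comment> \<open>Both sides are the derivative at s = 0 of the increment in direction b: once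
    under the integral sign, once by the chain rule.\<close>
  have main: "integral {0..t} (\<lambda>\<tau>. Hs (x + \<tau> *\<^sub>R b) a \<bullet> b) = gr (x + t *\<^sub>R b) \<bullet> a - gr x \<bullet> a"
    if t: "t \<in> {0..\<delta>}" for t
  proof -
    have 1: "integral (cbox 0 t) (\<lambda>\<tau>. gr (x + s *\<^sub>R a + \<tau> *\<^sub>R b) \<bullet> b)
        = f (x + s *\<^sub>R a + t *\<^sub>R b) - f (x + s *\<^sub>R a)" if "s \<in> {-\<delta>..\<delta>}" for s
    proof -
      have "((\<lambda>\<tau>. f (x + s *\<^sub>R a + \<tau> *\<^sub>R b)) has_vector_derivative gr (x + s *\<^sub>R a + \<tau> *\<^sub>R b) \<bullet> b)
          (at \<tau> within {0..t})" if "\<tau> \<in> {0..t}" for \<tau>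
      proof -
        have "x + s *\<^sub>R a + \<tau> *\<^sub>R b \<in> U" using that t \<open>s \<in> _\<close> by (intro inU) auto
        from has_real_derivative_along_curve[OF f[OF this] has_vector_derivative_line]
        show ?thesis by (simp add: has_real_derivative_iff_has_vector_derivative)
      qed
      from fundamental_theorem_of_calculus[OF _ this] t show ?thesis
        by (auto intro!: integral_unique)
    qed
    have "((\<lambda>s. integral (cbox 0 t) (\<lambda>\<tau>. gr (x + s *\<^sub>R a + \<tau> *\<^sub>R b) \<bullet> b)) has_field_derivative
        integral (cbox 0 t) (\<lambda>\<tau>. Hs (x + 0 *\<^sub>R a + \<tau> *\<^sub>R b) a \<bullet> b)) (at 0 within {-\<delta>..\<delta>})"
    proof (rule leibniz_rule_field_derivative)
      fix s \<tau> assume s: "s \<in> {-\<delta>..\<delta>}" "\<tau> \<in> cbox 0 t"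
      have "x + s *\<^sub>R a + \<tau> *\<^sub>R b \<in> U" using s t by (intro inU) auto
      then have inU': "(x + \<tau> *\<^sub>R b) + s *\<^sub>R a \<in> U" by (simp add: algebra_simps)
      from has_real_derivative_inner_curve[OF has_vector_derivative_along_curve[OF gr[OF inU'] has_vector_derivative_line]
           has_vector_derivative_const[of b]]
      show "((\<lambda>s. gr (x + s *\<^sub>R a + \<tau> *\<^sub>R b) \<bullet> b) has_real_derivative Hs (x + s *\<^sub>R a + \<tau> *\<^sub>R b) a \<bullet> b)
          (at s within {-\<delta>..\<delta>})"
        by (simp add: ac_simps)
    next
      fix s assume s: "s \<in> {-\<delta>..\<delta>}"
      show "(\<lambda>\<tau>. gr (x + s *\<^sub>R a + \<tau> *\<^sub>R b) \<bullet> b) integrable_on cbox 0 t"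
        using s t by (intro integrable_continuous continuous_intros ci) (auto intro!: inU)
    next
      show "continuous_on ({-\<delta>..\<delta>} \<times> cbox 0 t) (\<lambda>(s, \<tau>). Hs (x + s *\<^sub>R a + \<tau> *\<^sub>R b) a \<bullet> b)"
        unfolding case_prod_unfold using t by (intro continuous_intros ci) (auto intro!: inU)
    qed (use \<delta> in auto)
    then have A: "((\<lambda>s. f (x + s *\<^sub>R a + t *\<^sub>R b) - f (x + s *\<^sub>R a)) has_field_derivative
        integral (cbox 0 t) (\<lambda>\<tau>. Hs (x + 0 *\<^sub>R a + \<tau> *\<^sub>R b) a \<bullet> b)) (at 0 within {-\<delta>..\<delta>})"
      by (rule has_field_derivative_transform_within[where d=1]) (use \<delta> 1 in auto)
    have inU': "x \<in> U" "x + t *\<^sub>R b \<in> U" using inU[of 0 0] inU[of 0 t] t \<delta> by auto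
    have "((\<lambda>s. f (x + s *\<^sub>R a + t *\<^sub>R b) - f (x + s *\<^sub>R a)) has_field_derivative
        gr (x + t *\<^sub>R b) \<bullet> a - gr x \<bullet> a) (at 0 within {-\<delta>..\<delta>})"
      using DERIV_diff[OF has_real_derivative_along_curve[OF _ has_vector_derivative_line, of f "gr (x + t *\<^sub>R b)" "x + t *\<^sub>R b" 0 a]
         has_real_derivative_along_curve[OF _ has_vector_derivative_line, of f "gr x" x 0 a]] f inU'
      by (simp add: algebra_simps)
    with A show ?thesis
      using vector_derivative_unique_within_closed_interval[of "-\<delta>" \<delta> 0]
      using \<delta> by (auto simp: has_real_derivative_iff_has_vector_derivative)
  qed
  have "((\<lambda>t. integral {0..t} (\<lambda>\<tau>. Hs (x + \<tau> *\<^sub>R b) a \<bullet> b)) has_vector_derivative Hs (x + 0 *\<^sub>R b) a \<bullet> b)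
       (at 0 within {0..\<delta>})"
    using \<delta> inU[of 0] by (intro integral_has_vector_derivative continuous_intros ci) auto
  then have 1: "((\<lambda>t. gr (x + t *\<^sub>R b) \<bullet> a - gr x \<bullet> a) has_vector_derivative Hs x a \<bullet> b)
       (at 0 within {0..\<delta>})"
    using \<delta> main by (auto elim!: has_vector_derivative_transform[rotated 2])
  have "((\<lambda>t. gr (x + t *\<^sub>R b)) has_vector_derivative Hs x b) (at 0 within {0..\<delta>})"
    by (rule has_vector_derivative_along_curve[OF _ has_vector_derivative_line])
       (use gr[OF \<open>x \<in> U\<close>] in simp)
  from DERIV_diff[OF has_real_derivative_inner_curve[OF this has_vector_derivative_const[of a]]
      DERIV_const[of "gr x \<bullet> a"]]
  have "((\<lambda>t. gr (x + t *\<^sub>R b) \<bullet> a - gr x \<bullet> a) has_vector_derivative Hs x b \<bullet> a)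
       (at 0 within {0..\<delta>})"
    by (simp add: has_real_derivative_iff_has_vector_derivative)
  with 1 show ?thesis
    using vector_derivative_unique_within_closed_interval[of 0 \<delta> 0] \<delta> by auto
qed

text \<open>The energy argument needs two derivatives. They are packaged as a gradient vector and a
  Hessian map rather than as partial derivatives, so that derivatives along the curves of spherical
  coordinates are instances of the chain rule.\<close>

lemma smooth_nearE:
  fixes f :: "'a::euclidean_space \<Rightarrow> real"
  assumes "smooth_near f S"
  obtains U and gr :: "'a \<Rightarrow> 'a" and Hs where "open U" "S \<subseteq> U"
    "\<And>x. x \<in> U \<Longrightarrow> (f has_derivative (\<lambda>h. gr x \<bullet> h)) (at x)"
    "\<And>x. x \<in> U \<Longrightarrow> (gr has_derivative Hs x) (at x)"
    "\<And>a. continuous_on U (\<lambda>x. Hs x a)"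
proof -
  obtain U where U: "open U" "S \<subseteq> U" and C: "\<And>k. Ck_on k f U"
    using assms unfolding smooth_near_def by blast
  define p where "p b x = frechet_derivative f (at x) b" for b x
  define H where "H b c x = frechet_derivative (p b) (at x) c" for b c x
  have C1: "f differentiable_on U" and C2: "b \<in> Basis \<Longrightarrow> p b differentiable_on U"
    and C3: "b \<in> Basis \<Longrightarrow> c \<in> Basis \<Longrightarrow> continuous_on U (H b c)" for b c
    using C[of "Suc (Suc 0)"] unfolding Ck_on.simps p_def[abs_def] H_def[abs_def] by blast+
  have fd: "(f has_derivative frechet_derivative f (at x)) (at x)" if "x \<in> U" for x
    using C1 that U(1) frechet_derivative_works differentiable_on_eq_differentiable_at by blast
  have pd: "(p b has_derivative frechet_derivative (p b) (at x)) (at x)" if "x \<in> U" "b \<in> Basis" for x b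
    using C2[of b] that U(1) frechet_derivative_works differentiable_on_eq_differentiable_at by blast
  have expand: "L h = (\<Sum>c\<in>Basis. (h \<bullet> c) * L c)" if "linear L" for L :: "'a \<Rightarrow> real" and h
  proof -
    have "L h = L (\<Sum>c\<in>Basis. (h \<bullet> c) *\<^sub>R c)" by (simp add: euclidean_representation)
    also have "\<dots> = (\<Sum>c\<in>Basis. (h \<bullet> c) * L c)" using that by (simp add: linear_sum linear_scale)
    finally show ?thesis .
  qed
  show thesis
  proof (rule that[OF U])
    fix x assume x: "x \<in> U"
    have "frechet_derivative f (at x) h = (\<Sum>b\<in>Basis. p b x *\<^sub>R b) \<bullet> h" for h
    proof -
      have "frechet_derivative f (at x) h = (\<Sum>b\<in>Basis. (h \<bullet> b) * p b x)"
        unfolding p_def using expand[OF has_derivative_linear[OF fd[OF x]]] .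
      also have "\<dots> = (\<Sum>b\<in>Basis. p b x *\<^sub>R b) \<bullet> h"
        unfolding inner_sum_left inner_scaleR_left by (intro sum.cong refl) (metis inner_commute mult.commute)
      finally show ?thesis .
    qed
    then show "(f has_derivative (\<lambda>h. (\<Sum>b\<in>Basis. p b x *\<^sub>R b) \<bullet> h)) (at x)"
      by (intro has_derivative_eq_rhs[OF fd[OF x]] ext)
    show "((\<lambda>x. \<Sum>b\<in>Basis. p b x *\<^sub>R b) has_derivative
       (\<lambda>h. \<Sum>b\<in>Basis. (\<Sum>c\<in>Basis. (h \<bullet> c) * H b c x) *\<^sub>R b)) (at x)"
    proof (rule has_derivative_sum)
      fix b :: 'a assume b: "b \<in> Basis"
      have "frechet_derivative (p b) (at x) = (\<lambda>h. \<Sum>c\<in>Basis. (h \<bullet> c) * H b c x)"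
        unfolding H_def by (rule ext) (rule expand[OF has_derivative_linear[OF pd[OF x b]]])
      then show "((\<lambda>x. p b x *\<^sub>R b) has_derivative (\<lambda>h. (\<Sum>c\<in>Basis. (h \<bullet> c) * H b c x) *\<^sub>R b)) (at x)"
        using has_derivative_scaleR_left[OF pd[OF x b]] by simp
    qed
  next
    fix a
    show "continuous_on U (\<lambda>x. \<Sum>b\<in>Basis. (\<Sum>c\<in>Basis. (a \<bullet> c) * H b c x) *\<^sub>R b)"
      by (intro continuous_intros C3)
  qed
qed

section \<open>Spherical coordinates on the exterior\<close>

text \<open>With \<open>p = (\<theta>, \<phi>)\<close>, \<open>radial\<close>, \<open>lat\<close>
  and \<open>lon\<close> form an orthonormal frame. The \<phi>-derivative of \<open>radial\<close>
  is sin \<theta> times \<open>lon\<close>, and \<open>lon\<close> itself has no singularity at the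
  poles; splitting off this factor is what makes (\<partial>_\<phi> u) / sin \<theta>
  harmless.\<close>

definition lon :: "real \<times> real \<Rightarrow> real^3" where
  "lon p = (- sin (snd p)) *\<^sub>R axis 1 1 + cos (snd p) *\<^sub>R axis 2 1"

definition lat :: "real \<times> real \<Rightarrow> real^3" where
  "lat p = (cos (fst p) * cos (snd p)) *\<^sub>R axis 1 1 + (cos (fst p) * sin (snd p)) *\<^sub>R axis 2 1
     + (- sin (fst p)) *\<^sub>R axis 3 1"

definition radial :: "real \<times> real \<Rightarrow> real^3" where
  "radial p = (sin (fst p) * cos (snd p)) *\<^sub>R axis 1 1 + (sin (fst p) * sin (snd p)) *\<^sub>R axis 2 1
     + cos (fst p) *\<^sub>R axis 3 1"

definition horiz :: "real \<times> real \<Rightarrow> real^3" where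
  "horiz p = cos (snd p) *\<^sub>R axis 1 1 + sin (snd p) *\<^sub>R axis 2 1"

lemma sphere_point_radial: "sphere_point \<theta> \<phi> = radial (\<theta>, \<phi>)"
  by (simp add: sphere_point_def radial_def vec_eq_iff forall_3 axis_def)

lemma norm_radial [simp]: "norm (radial p) = 1"
proof -
  have "(norm (radial p))\<^sup>2 = (sin (fst p) * cos (snd p))\<^sup>2 + (sin (fst p) * sin (snd p))\<^sup>2 + (cos (fst p))\<^sup>2"
    unfolding power2_norm_eq_inner
    by (simp add: radial_def inner_vec_def sum_3 axis_def power2_eq_square)
  also have "\<dots> = (sin (fst p))\<^sup>2 * ((cos (snd p))\<^sup>2 + (sin (snd p))\<^sup>2) + (cos (fst p))\<^sup>2"
    by (simp only: power_mult_distrib distrib_left)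
  finally show ?thesis by (simp add: power2_eq_1_iff) (metis abs_norm_cancel abs_minus_cancel abs_one)
qed

lemma continuous_on_frame [continuous_intros]:
  fixes S :: "'z::t2_space set"
  assumes "continuous_on S p"
  shows "continuous_on S (\<lambda>x. radial (p x))" "continuous_on S (\<lambda>x. lat (p x))"
    "continuous_on S (\<lambda>x. lon (p x))" "continuous_on S (\<lambda>x. horiz (p x))"
  using assms by (auto simp: radial_def lat_def lon_def horiz_def intro!: continuous_intros)

lemma frame_periodic:
  "radial (\<theta>, \<phi> + 2 * pi) = radial (\<theta>, \<phi>)"
  "lon (\<theta>, \<phi> + 2 * pi) = lon (\<theta>, \<phi>)"
  by (simp_all add: radial_def lon_def)

lemma frame_derivatives:
  "((\<lambda>\<theta>. radial (\<theta>, \<phi>)) has_vector_derivative lat (\<theta>, \<phi>)) (at \<theta> within S)"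
  "((\<lambda>\<theta>. lat (\<theta>, \<phi>)) has_vector_derivative - radial (\<theta>, \<phi>)) (at \<theta> within S)"
  "((\<lambda>\<phi>. radial (\<theta>, \<phi>)) has_vector_derivative sin \<theta> *\<^sub>R lon (\<theta>, \<phi>)) (at \<phi> within S)"
  "((\<lambda>\<phi>. lon (\<theta>, \<phi>)) has_vector_derivative - horiz (\<theta>, \<phi>)) (at \<phi> within S)"
  unfolding radial_def lat_def lon_def horiz_def fst_conv snd_conv
  by (auto intro!: derivative_eq_intros simp: vec_eq_iff forall_3 axis_def)

locale smooth_exterior =
  fixes M :: real and f :: "real \<times> (real^3) \<Rightarrow> real" and U gr Hs
  assumes M_pos: "M > 0" and U_open: "open U" and U_ext: "exterior M \<subseteq> U"
    and f_deriv: "\<And>x. x \<in> U \<Longrightarrow> (f has_derivative (\<lambda>h. gr x \<bullet> h)) (at x)"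
    and gr_deriv: "\<And>x. x \<in> U \<Longrightarrow> (gr has_derivative Hs x) (at x)"
    and Hs_cont: "\<And>a. continuous_on U (\<lambda>x. Hs x a)"
begin

lemma Hs_sym: "x \<in> U \<Longrightarrow> Hs x a \<bullet> b = Hs x b \<bullet> a"
  using second_derivative_symmetric[OF U_open _ f_deriv gr_deriv Hs_cont] .

lemma Hs_scale: "x \<in> U \<Longrightarrow> Hs x (c *\<^sub>R a) = c *\<^sub>R Hs x a"
  using gr_deriv has_derivative_linear linear_scale by blast

lemma f_cont: "continuous_on U f"
  using f_deriv by (meson continuous_at_imp_continuous_on has_derivative_continuous)

lemma gr_cont: "continuous_on U gr"
  using gr_deriv by (meson continuous_at_imp_continuous_on has_derivative_continuous)

text \<open>Continuity is given for fixed directions only; expanding a moving direction in the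
  basis, by linearity, gives joint continuity.\<close>

lemma Hs_cont':
  assumes "continuous_on S X" "continuous_on S a" "\<And>x. x \<in> S \<Longrightarrow> X x \<in> U"
  shows "continuous_on S (\<lambda>x. Hs (X x) (a x))"
proof -
  have "Hs (X x) (a x) = (\<Sum>c\<in>Basis. (a x \<bullet> c) *\<^sub>R Hs (X x) c)" if "x \<in> S" for x
  proof -
    have "linear (Hs (X x))" using gr_deriv[OF assms(3)[OF that]] has_derivative_linear by blast
    then have "(\<Sum>c\<in>Basis. (a x \<bullet> c) *\<^sub>R Hs (X x) c) = Hs (X x) (\<Sum>c\<in>Basis. (a x \<bullet> c) *\<^sub>R c)"
      by (simp add: linear_sum linear_scale)
    then show ?thesis by (simp add: euclidean_representation)
  qed
  moreover have "continuous_on S (\<lambda>x. \<Sum>c\<in>Basis. (a x \<bullet> c) *\<^sub>R Hs (X x) c)"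
    using assms by (intro continuous_intros continuous_on_compose2[OF Hs_cont]) auto
  ultimately show ?thesis by (metis (no_types, lifting) continuous_on_eq)
qed

definition pos :: "real \<Rightarrow> real \<Rightarrow> real \<times> real \<Rightarrow> real \<times> (real^3)" where
  "pos v r p = (v, r *\<^sub>R radial p)"

lemma pos_in_U [simp]: "r \<ge> 2 * M \<Longrightarrow> pos v r p \<in> U"
  using U_ext M_pos by (auto simp: exterior_def pos_def)

text \<open>The subscript \<open>t\<close> stands for \<open>\<theta>\<close>, and \<open>u_w\<close> is \<open>(\<partial>\<^sub>\<phi> u) / sin \<theta>\<close>, which unlike the quotient
  extends smoothly to the poles; \<open>w_v\<close>, \<open>w_r\<close>, \<open>w_p\<close> are its derivatives in \<open>v, r, \<phi>\<close>. All of
  them are expressed by the gradient and the Hessian of \<open>f\<close>, so that joint continuity is immediate.\<close>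

definition "u v r p = f (pos v r p)"
definition "u_v v r p = gr (pos v r p) \<bullet> (1, 0)"
definition "u_r v r p = gr (pos v r p) \<bullet> (0, radial p)"
definition "u_t v r p = gr (pos v r p) \<bullet> (0, r *\<^sub>R lat p)"
definition "u_w v r p = gr (pos v r p) \<bullet> (0, r *\<^sub>R lon p)"
definition "u_vv v r p = Hs (pos v r p) (1, 0) \<bullet> (1, 0)"
definition "u_vr v r p = Hs (pos v r p) (0, radial p) \<bullet> (1, 0)"
definition "u_rr v r p = Hs (pos v r p) (0, radial p) \<bullet> (0, radial p)"
definition "u_vt v r p = Hs (pos v r p) (1, 0) \<bullet> (0, r *\<^sub>R lat p)"
definition "u_rt v r p = Hs (pos v r p) (0, radial p) \<bullet> (0, r *\<^sub>R lat p) + gr (pos v r p) \<bullet> (0, lat p)"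
definition "u_tt v r p = Hs (pos v r p) (0, r *\<^sub>R lat p) \<bullet> (0, r *\<^sub>R lat p) + gr (pos v r p) \<bullet> (0, r *\<^sub>R (- radial p))"
definition "w_v v r p = Hs (pos v r p) (1, 0) \<bullet> (0, r *\<^sub>R lon p)"
definition "w_r v r p = Hs (pos v r p) (0, radial p) \<bullet> (0, r *\<^sub>R lon p) + gr (pos v r p) \<bullet> (0, lon p)"
definition "w_p v r p = Hs (pos v r p) (0, r *\<^sub>R (sin (fst p) *\<^sub>R lon p)) \<bullet> (0, r *\<^sub>R lon p)
   + gr (pos v r p) \<bullet> (0, r *\<^sub>R (- horiz p))"

lemmas u_defs = u_def u_v_def u_r_def u_t_def u_w_def u_vv_def u_vr_def u_rr_def u_vt_def u_rt_def
  u_tt_def w_v_def w_r_def w_p_def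

lemma pos_derivatives:
  "((\<lambda>v. pos v r p) has_vector_derivative (1, 0)) (at v within S)"
  "((\<lambda>r. pos v r p) has_vector_derivative (0, radial p)) (at r within S)"
  "((\<lambda>\<theta>. pos v r (\<theta>, \<phi>)) has_vector_derivative (0, r *\<^sub>R lat (\<theta>, \<phi>))) (at \<theta> within S)"
  "((\<lambda>\<phi>. pos v r (\<theta>, \<phi>)) has_vector_derivative (0, r *\<^sub>R (sin \<theta> *\<^sub>R lon (\<theta>, \<phi>)))) (at \<phi> within S)"
  unfolding pos_def
  by (auto intro!: derivative_eq_intros has_vector_derivative_Pair frame_derivatives)

lemma scaled_frame_derivatives:
  "((\<lambda>\<theta>. (0::real, c *\<^sub>R lat (\<theta>, \<phi>))) has_vector_derivative (0, c *\<^sub>R (- radial (\<theta>, \<phi>)))) (at \<theta> within S)"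
  "((\<lambda>\<theta>. (0::real, radial (\<theta>, \<phi>))) has_vector_derivative (0, lat (\<theta>, \<phi>))) (at \<theta> within S)"
  "((\<lambda>\<phi>. (0::real, radial (\<theta>, \<phi>))) has_vector_derivative (0, sin \<theta> *\<^sub>R lon (\<theta>, \<phi>))) (at \<phi> within S)"
  "((\<lambda>\<phi>. (0::real, c *\<^sub>R lon (\<theta>, \<phi>))) has_vector_derivative (0, c *\<^sub>R (- horiz (\<theta>, \<phi>)))) (at \<phi> within S)"
  "((\<lambda>r. (0::real, r *\<^sub>R x)) has_vector_derivative (0, x)) (at t within S)" for x :: "real^3"
  by (rule has_vector_derivative_Pair[OF has_vector_derivative_const]
      bounded_linear.has_vector_derivative[OF bounded_linear_scaleR_right] frame_derivatives
    | (auto intro!: derivative_eq_intros)[1])+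

context
  fixes v r p assumes inU: "pos v r p \<in> U"
begin

lemma derivatives_v:
  "((\<lambda>v. u v r p) has_real_derivative u_v v r p) (at v within S)"
  "((\<lambda>v. u_v v r p) has_real_derivative u_vv v r p) (at v within S)"
  "((\<lambda>v. u_r v r p) has_real_derivative u_vr v r p) (at v within S)"
  "((\<lambda>v. u_t v r p) has_real_derivative u_vt v r p) (at v within S)"
  "((\<lambda>v. u_w v r p) has_real_derivative w_v v r p) (at v within S)"
  unfolding u_defs Hs_sym[OF inU, of "(0, radial p)" "(1, 0)"]
  by (rule has_real_derivative_along_curve[where f=f] f_deriv inU pos_derivatives
       DERIV_cong[OF has_real_derivative_inner_curve[OF has_vector_derivative_along_curve[where F=gr] has_vector_derivative_const]]
       gr_deriv | simp)+

lemma derivatives_r: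
  "((\<lambda>r. u v r p) has_real_derivative u_r v r p) (at r within S)"
  "((\<lambda>r. u_v v r p) has_real_derivative u_vr v r p) (at r within S)"
  "((\<lambda>r. u_r v r p) has_real_derivative u_rr v r p) (at r within S)"
  "((\<lambda>r. u_t v r p) has_real_derivative u_rt v r p) (at r within S)"
  "((\<lambda>r. u_w v r p) has_real_derivative w_r v r p) (at r within S)"
  unfolding u_defs
  by (rule has_real_derivative_along_curve[where f=f] f_deriv inU pos_derivatives
       DERIV_cong[OF has_real_derivative_inner_curve[OF has_vector_derivative_along_curve[where F=gr] has_vector_derivative_const]]
       has_real_derivative_inner_curve[OF has_vector_derivative_along_curve[where F=gr] scaled_frame_derivatives(5)]
       gr_deriv | simp)+

end

lemma derivatives_t:
  assumes inU: "pos v r (\<theta>, \<phi>) \<in> U"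
  shows
  "((\<lambda>\<theta>. u v r (\<theta>, \<phi>)) has_real_derivative u_t v r (\<theta>, \<phi>)) (at \<theta> within S)"
  "((\<lambda>\<theta>. u_v v r (\<theta>, \<phi>)) has_real_derivative u_vt v r (\<theta>, \<phi>)) (at \<theta> within S)"
  "((\<lambda>\<theta>. u_r v r (\<theta>, \<phi>)) has_real_derivative u_rt v r (\<theta>, \<phi>)) (at \<theta> within S)"
  "((\<lambda>\<theta>. u_t v r (\<theta>, \<phi>)) has_real_derivative u_tt v r (\<theta>, \<phi>)) (at \<theta> within S)"
  unfolding u_defs Hs_sym[OF inU, of "(1, 0)" "(0, r *\<^sub>R lat (\<theta>, \<phi>))"]
    Hs_sym[OF inU, of "(0, radial (\<theta>, \<phi>))" "(0, r *\<^sub>R lat (\<theta>, \<phi>))"]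
  by (rule has_real_derivative_along_curve[where f=f] f_deriv inU pos_derivatives
       DERIV_cong[OF has_real_derivative_inner_curve[OF has_vector_derivative_along_curve[where F=gr] has_vector_derivative_const]]
       has_real_derivative_inner_curve[OF has_vector_derivative_along_curve[where F=gr] scaled_frame_derivatives(1)]
       has_real_derivative_inner_curve[OF has_vector_derivative_along_curve[where F=gr] scaled_frame_derivatives(2)]
       gr_deriv | simp)+

lemma derivatives_p:
  assumes inU: "pos v r (\<theta>, \<phi>) \<in> U"
  shows
  "((\<lambda>\<phi>. u v r (\<theta>, \<phi>)) has_real_derivative sin \<theta> * u_w v r (\<theta>, \<phi>)) (at \<phi> within S)"
  "((\<lambda>\<phi>. u_v v r (\<theta>, \<phi>)) has_real_derivative sin \<theta> * w_v v r (\<theta>, \<phi>)) (at \<phi> within S)"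
  "((\<lambda>\<phi>. u_r v r (\<theta>, \<phi>)) has_real_derivative sin \<theta> * w_r v r (\<theta>, \<phi>)) (at \<phi> within S)"
  "((\<lambda>\<phi>. u_w v r (\<theta>, \<phi>)) has_real_derivative w_p v r (\<theta>, \<phi>)) (at \<phi> within S)"
proof -
  have e: "(0::real, r *\<^sub>R (sin \<theta> *\<^sub>R lon (\<theta>, \<phi>))) = sin \<theta> *\<^sub>R (0, r *\<^sub>R lon (\<theta>, \<phi>))"
     "(0::real, sin \<theta> *\<^sub>R lon (\<theta>, \<phi>)) = sin \<theta> *\<^sub>R (0, lon (\<theta>, \<phi>))" by auto
  note g = has_real_derivative_inner_curve[OF has_vector_derivative_along_curve[where F=gr, OF gr_deriv[OF inU] pos_derivatives(4)]]
  show "((\<lambda>\<phi>. u v r (\<theta>, \<phi>)) has_real_derivative sin \<theta> * u_w v r (\<theta>, \<phi>)) (at \<phi> within S)"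
    using has_real_derivative_along_curve[where f=f, OF f_deriv[OF inU] pos_derivatives(4)]
    unfolding e u_def u_w_def by (simp del: scaleR_Pair)
  show "((\<lambda>\<phi>. u_v v r (\<theta>, \<phi>)) has_real_derivative sin \<theta> * w_v v r (\<theta>, \<phi>)) (at \<phi> within S)"
    using g[OF has_vector_derivative_const]  inU unfolding e
    by (simp add: u_v_def w_v_def Hs_scale Hs_sym[OF inU, of "(1, 0)"] del: scaleR_Pair)
  show "((\<lambda>\<phi>. u_r v r (\<theta>, \<phi>)) has_real_derivative sin \<theta> * w_r v r (\<theta>, \<phi>)) (at \<phi> within S)"
    using g[OF scaled_frame_derivatives(3)[where \<theta>=\<theta> and \<phi>=\<phi> and S=S]]  inU unfolding e
    by (simp add: u_r_def w_r_def Hs_scale Hs_sym[OF inU, of "(0, radial (\<theta>, \<phi>))"] algebra_simps del: scaleR_Pair)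
  show "((\<lambda>\<phi>. u_w v r (\<theta>, \<phi>)) has_real_derivative w_p v r (\<theta>, \<phi>)) (at \<phi> within S)"
    using g[OF scaled_frame_derivatives(4)[where \<theta>=\<theta> and \<phi>=\<phi> and S=S]] by (simp add: u_w_def w_p_def)
qed

lemma periodic:
  "pos v r (\<theta>, 2 * pi) = pos v r (\<theta>, 0)" "u v r (\<theta>, 2 * pi) = u v r (\<theta>, 0)"
  "u_v v r (\<theta>, 2 * pi) = u_v v r (\<theta>, 0)" "u_r v r (\<theta>, 2 * pi) = u_r v r (\<theta>, 0)"
  "u_w v r (\<theta>, 2 * pi) = u_w v r (\<theta>, 0)"
  using frame_periodic[of \<theta> 0] by (auto simp: pos_def u_defs)

lemma continuous_on_fields [continuous_intros]:
  fixes S :: "'z::t2_space set"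
  assumes "continuous_on S V" "continuous_on S R" "continuous_on S P" "\<And>x. x \<in> S \<Longrightarrow> R x \<ge> 2 * M"
  shows "continuous_on S (\<lambda>x. u (V x) (R x) (P x))" "continuous_on S (\<lambda>x. u_v (V x) (R x) (P x))"
    "continuous_on S (\<lambda>x. u_r (V x) (R x) (P x))" "continuous_on S (\<lambda>x. u_t (V x) (R x) (P x))"
    "continuous_on S (\<lambda>x. u_w (V x) (R x) (P x))" "continuous_on S (\<lambda>x. u_vv (V x) (R x) (P x))"
    "continuous_on S (\<lambda>x. u_vr (V x) (R x) (P x))" "continuous_on S (\<lambda>x. u_rr (V x) (R x) (P x))"
    "continuous_on S (\<lambda>x. u_vt (V x) (R x) (P x))" "continuous_on S (\<lambda>x. u_rt (V x) (R x) (P x))"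
    "continuous_on S (\<lambda>x. u_tt (V x) (R x) (P x))" "continuous_on S (\<lambda>x. w_v (V x) (R x) (P x))"
    "continuous_on S (\<lambda>x. w_r (V x) (R x) (P x))" "continuous_on S (\<lambda>x. w_p (V x) (R x) (P x))"
proof -
  have pos: "continuous_on S (\<lambda>x. pos (V x) (R x) (P x))"
    unfolding pos_def by (intro continuous_intros assms)
  have inU: "pos (V x) (R x) (P x) \<in> U" if "x \<in> S" for x using assms(4)[OF that] by simp
  note ci = continuous_intros assms Hs_cont'[OF pos] inU continuous_on_compose2[OF f_cont pos]
    continuous_on_compose2[OF gr_cont pos]
  show "continuous_on S (\<lambda>x. u (V x) (R x) (P x))" "continuous_on S (\<lambda>x. u_v (V x) (R x) (P x))"
    "continuous_on S (\<lambda>x. u_r (V x) (R x) (P x))" "continuous_on S (\<lambda>x. u_t (V x) (R x) (P x))"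
    "continuous_on S (\<lambda>x. u_w (V x) (R x) (P x))" "continuous_on S (\<lambda>x. u_vv (V x) (R x) (P x))"
    "continuous_on S (\<lambda>x. u_vr (V x) (R x) (P x))" "continuous_on S (\<lambda>x. u_rr (V x) (R x) (P x))"
    "continuous_on S (\<lambda>x. u_vt (V x) (R x) (P x))" "continuous_on S (\<lambda>x. u_rt (V x) (R x) (P x))"
    "continuous_on S (\<lambda>x. u_tt (V x) (R x) (P x))" "continuous_on S (\<lambda>x. w_v (V x) (R x) (P x))"
    "continuous_on S (\<lambda>x. w_r (V x) (R x) (P x))" "continuous_on S (\<lambda>x. w_p (V x) (R x) (P x))"
    unfolding u_defs by (auto intro!: ci simp: assms)
qed

end

section \<open>Integration over the sphere\<close>

abbreviation sbox :: "(real \<times> real) set" where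
  "sbox \<equiv> cbox (0, 0) (pi, 2 * pi)"

text \<open>Only the product with sin \<theta> has to agree with a continuous function, so
  \<open>F\<close> may take arbitrary values at the poles, where the chart degenerates.\<close>

lemma sphere_integral_eq:
  assumes "\<And>\<theta> \<phi>. \<theta> \<in> {0..pi} \<Longrightarrow> \<phi> \<in> {0..2 * pi} \<Longrightarrow> F \<theta> \<phi> * sin \<theta> = H (\<theta>, \<phi>)"
    and "continuous_on sbox H"
  shows "sphere_integral F = integral sbox H"
proof -
  have "integral sbox H = integral (cbox 0 pi) (\<lambda>\<theta>. integral (cbox 0 (2 * pi)) (\<lambda>\<phi>. H (\<theta>, \<phi>)))"
    by (rule integral_prod_continuous) (use assms(2) in auto)
  also have "\<dots> = sphere_integral F"
    unfolding sphere_integral_def cbox_interval by (intro integral_cong) (rule assms(1)[symmetric])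
  finally show ?thesis by simp
qed

text \<open>The \<theta> integral has to become the inner one, hence the swap of the variables. In
  the application the values at 0 and pi agree because of a factor sin \<theta>.\<close>

lemma integral_sbox_dtheta:
  assumes "continuous_on UNIV G'"
    and "\<And>\<theta> \<phi>. \<theta> \<in> {0..pi} \<Longrightarrow> ((\<lambda>\<theta>. G (\<theta>, \<phi>)) has_real_derivative G' (\<theta>, \<phi>)) (at \<theta>)"
    and "\<And>\<phi>. G (pi, \<phi>) = G (0, \<phi>)"
  shows "integral sbox G' = (0::real)"
proof -
  have "integral sbox G' = integral (cbox (0, 0) (pi, 2 * pi)) (\<lambda>(x, y). (\<lambda>x y. G' (x, y)) x y)"
    by simp
  also have "\<dots> = integral (cbox (0, 0) (2 * pi, pi)) (\<lambda>(x, y). (\<lambda>x y. G' (x, y)) y x)"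
    by (rule integral_swap_2dim) (use assms(1) continuous_on_subset in auto)
  also have "\<dots> = integral (cbox 0 (2 * pi)) (\<lambda>\<phi>. integral (cbox 0 pi) (\<lambda>\<theta>. G' (\<theta>, \<phi>)))"
    by (subst integral_prod_continuous)
       (use assms(1) in \<open>auto simp: case_prod_unfold intro!: continuous_on_compose2[OF assms(1)] continuous_intros\<close>)
  also have "\<dots> = integral (cbox 0 (2 * pi)) (\<lambda>\<phi>. 0)"
  proof (rule integral_cong)
    fix \<phi> :: real
    have "((\<lambda>\<theta>. G' (\<theta>, \<phi>)) has_integral G (pi, \<phi>) - G (0, \<phi>)) {0..pi}"
      by (rule fundamental_theorem_of_calculus)
         (use assms(2) in \<open>auto simp: has_real_derivative_iff_has_vector_derivative[symmetric] intro: has_field_derivative_at_within\<close>)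
    then show "integral (cbox 0 pi) (\<lambda>\<theta>. G' (\<theta>, \<phi>)) = 0"
      using assms(3) by (auto simp: integral_unique)
  qed
  finally show ?thesis by simp
qed

lemma integral_sbox_dphi:
  assumes "continuous_on UNIV G'"
    and "\<And>\<theta> \<phi>. ((\<lambda>\<phi>. G (\<theta>, \<phi>)) has_real_derivative G' (\<theta>, \<phi>)) (at \<phi>)"
    and "\<And>\<theta>. G (\<theta>, 2 * pi) = G (\<theta>, 0)"
  shows "integral sbox G' = (0::real)"
proof -
  have "integral sbox G' = integral (cbox 0 pi) (\<lambda>\<theta>. integral (cbox 0 (2 * pi)) (\<lambda>\<phi>. G' (\<theta>, \<phi>)))"
    by (rule integral_prod_continuous) (use assms(1) continuous_on_subset in auto)
  also have "\<dots> = integral (cbox 0 pi) (\<lambda>\<theta>. 0)"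
  proof (rule integral_cong)
    fix \<theta> :: real
    have "((\<lambda>\<phi>. G' (\<theta>, \<phi>)) has_integral G (\<theta>, 2 * pi) - G (\<theta>, 0)) {0..2 * pi}"
      by (rule fundamental_theorem_of_calculus)
         (use assms(2) in \<open>auto simp: has_real_derivative_iff_has_vector_derivative[symmetric] intro: has_field_derivative_at_within\<close>)
    then show "integral (cbox 0 (2 * pi)) (\<lambda>\<phi>. G' (\<theta>, \<phi>)) = 0"
      using assms(3) by (auto simp: integral_unique)
  qed
  finally show ?thesis by simp
qed

text \<open>Identities computed in the chart hold for 0 < \<theta> < pi; density carries them to the
  poles.\<close>

lemma eq_0_on_sbox:
  fixes F :: "real \<times> real \<Rightarrow> real"
  assumes "continuous_on UNIV F" "\<And>p. 0 < fst p \<Longrightarrow> fst p < pi \<Longrightarrow> F p = 0" "p \<in> sbox"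
  shows "F p = 0"
proof -
  have "closure ({0<..<pi} \<times> (UNIV::real set)) = {0..pi} \<times> UNIV"
    by (simp add: closure_Times)
  then have "p \<in> closure ({0<..<pi} \<times> (UNIV::real set))"
    using assms(3) by (cases p) auto
  moreover have "continuous_on (closure ({0<..<pi} \<times> (UNIV::real set))) F"
    by (rule continuous_on_subset[OF assms(1)]) simp
  ultimately show ?thesis
    by (rule continuous_constant_on_closure[rotated 2, of _ _ F 0]) (use assms(2) in auto)
qed

lemma continuous_on_imp_integrable_sbox:
  fixes H :: "real \<times> real \<Rightarrow> real"
  shows "continuous_on UNIV H \<Longrightarrow> H integrable_on sbox"
  by (meson continuous_on_subset integrable_continuous subset_UNIV)

text \<open>Green's identity on the unit sphere for the operator
  \<open>\<partial>\<^sub>\<theta> (sin \<theta> a) + \<partial>\<^sub>\<phi> b\<close>, which is \<open>sin \<theta>\<close> times the Laplacian of \<open>y\<close> when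
  \<open>a = \<partial>\<^sub>\<theta> y\<close> and \<open>b = (\<partial>\<^sub>\<phi> y) / sin \<theta>\<close>.\<close>

lemma green_sphere:
  fixes a b g :: "real \<times> real \<Rightarrow> real"
  assumes cont: "continuous_on UNIV a" "continuous_on UNIV a_t" "continuous_on UNIV b" "continuous_on UNIV b_p"
      "continuous_on UNIV g" "continuous_on UNIV g_t" "continuous_on UNIV g_p"
    and a: "\<And>\<theta> \<phi>. ((\<lambda>\<theta>. a (\<theta>, \<phi>)) has_real_derivative a_t (\<theta>, \<phi>)) (at \<theta>)"
    and b: "\<And>\<theta> \<phi>. ((\<lambda>\<phi>. b (\<theta>, \<phi>)) has_real_derivative b_p (\<theta>, \<phi>)) (at \<phi>)"
    and gt: "\<And>\<theta> \<phi>. ((\<lambda>\<theta>. g (\<theta>, \<phi>)) has_real_derivative g_t (\<theta>, \<phi>)) (at \<theta>)"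
    and gp: "\<And>\<theta> \<phi>. ((\<lambda>\<phi>. g (\<theta>, \<phi>)) has_real_derivative g_p (\<theta>, \<phi>)) (at \<phi>)"
    and per: "\<And>\<theta>. b (\<theta>, 2 * pi) = b (\<theta>, 0)" "\<And>\<theta>. g (\<theta>, 2 * pi) = g (\<theta>, 0)"
  shows "integral sbox (\<lambda>p. (cos (fst p) * a p + sin (fst p) * a_t p + b_p p) * g p)
       = - integral sbox (\<lambda>p. sin (fst p) * a p * g_t p + b p * g_p p)"
proof -
  let ?G = "\<lambda>p. (cos (fst p) * a p + sin (fst p) * a_t p) * g p + sin (fst p) * a p * g_t p"
  let ?K = "\<lambda>p. b_p p * g p + b p * g_p p"
  have cG: "continuous_on UNIV ?G" and cK: "continuous_on UNIV ?K"
    by (intro continuous_intros cont)+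
  have "integral sbox ?G = 0"
    by (rule integral_sbox_dtheta[where G="\<lambda>p. sin (fst p) * a p * g p", OF cG])
       (auto intro!: derivative_eq_intros a gt)
  moreover have "integral sbox ?K = 0"
    by (rule integral_sbox_dphi[where G="\<lambda>p. b p * g p", OF cK])
       (auto intro!: derivative_eq_intros b gp simp: per)
  moreover have "integral sbox (\<lambda>p. (cos (fst p) * a p + sin (fst p) * a_t p + b_p p) * g p)
      + integral sbox (\<lambda>p. sin (fst p) * a p * g_t p + b p * g_p p) = integral sbox ?G + integral sbox ?K"
  proof -
    have i: "(\<lambda>p. (cos (fst p) * a p + sin (fst p) * a_t p + b_p p) * g p) integrable_on sbox"
      "(\<lambda>p. sin (fst p) * a p * g_t p + b p * g_p p) integrable_on sbox"
      by (intro continuous_on_imp_integrable_sbox continuous_intros cont)+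
    show ?thesis
      unfolding integral_add[OF i, symmetric]
        integral_add[OF cG[THEN continuous_on_imp_integrable_sbox] cK[THEN continuous_on_imp_integrable_sbox], symmetric]
      by (simp add: algebra_simps)
  qed
  ultimately show ?thesis by simp
qed

text \<open>Derivatives are taken within \<open>S\<close> because the radial one is one-sided at the
  horizon.\<close>

lemma integral_sbox_has_derivative:
  fixes X :: "real \<Rightarrow> real \<times> real \<Rightarrow> real"
  assumes "convex S" "x \<in> S"
    and "\<And>x p. x \<in> S \<Longrightarrow> ((\<lambda>x. X x p) has_real_derivative X' x p) (at x within S)"
    and "\<And>x. x \<in> S \<Longrightarrow> continuous_on UNIV (X x)"
    and "continuous_on (S \<times> UNIV) (\<lambda>y. X' (fst y) (snd y))"
  shows "((\<lambda>x. integral sbox (X x)) has_real_derivative integral sbox (X' x)) (at x within S)"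
  by (rule leibniz_rule_field_derivative)
     (use assms in \<open>auto intro: continuous_on_imp_integrable_sbox continuous_on_subset simp: case_prod_unfold\<close>)

lemma continuous_on_integral_sbox:
  fixes X :: "'z::topological_space \<Rightarrow> real \<times> real \<Rightarrow> real"
  assumes "continuous_on (S \<times> UNIV) (\<lambda>y. X (fst y) (snd y))"
  shows "continuous_on S (\<lambda>x. integral sbox (X x))"
  by (rule integral_continuous_on_param)
     (use assms in \<open>auto intro: continuous_on_subset simp: case_prod_unfold\<close>)

context smooth_exterior
begin

definition "lap v r p = cos (fst p) * u_t v r p + sin (fst p) * u_tt v r p + w_p v r p"

lemma r_pos: "r \<ge> 2 * M \<Longrightarrow> r > 0" using M_pos by linarith

lemma green:
  assumes "r \<ge> 2 * M"
    and "continuous_on UNIV g" "continuous_on UNIV g_t" "continuous_on UNIV g_w"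
    and "\<And>\<theta> \<phi>. ((\<lambda>\<theta>. g (\<theta>, \<phi>)) has_real_derivative g_t (\<theta>, \<phi>)) (at \<theta>)"
    and "\<And>\<theta> \<phi>. ((\<lambda>\<phi>. g (\<theta>, \<phi>)) has_real_derivative sin \<theta> * g_w (\<theta>, \<phi>)) (at \<phi>)"
    and "\<And>\<theta>. g (\<theta>, 2 * pi) = g (\<theta>, 0)"
  shows "integral sbox (\<lambda>p. lap v r p * g p)
       = - integral sbox (\<lambda>p. sin (fst p) * (u_t v r p * g_t p + u_w v r p * g_w p))"
proof -
  have "integral sbox (\<lambda>p. lap v r p * g p)
       = - integral sbox (\<lambda>p. sin (fst p) * u_t v r p * g_t p + u_w v r p * (sin (fst p) * g_w p))"
    unfolding lap_def using assms
    by (intro green_sphere) (auto intro!: continuous_intros derivatives_t derivatives_p simp: periodic)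
  then show ?thesis by (simp add: algebra_simps)
qed

end

section \<open>Divergence identities\<close>

text \<open>The common ground of both equations. The wave equation appears multiplied by r^2 sin
  \<theta>, which leaves coefficients that are regular at the poles. The bounds of \<open>V\<close>
  contain no mode number, so every constant obtained here is uniform in the mode.\<close>

locale wave_exterior = smooth_exterior +
  fixes V :: "real \<Rightarrow> real"
  assumes V_cont: "continuous_on {2 * M..} V"
    and V_bounds: "\<And>r. r \<ge> 2 * M \<Longrightarrow> V r \<le> 0" "\<And>r. r \<ge> 2 * M \<Longrightarrow> - 4 \<le> r\<^sup>2 * V r"
    and wave_eq_open: "\<And>v r p. r \<ge> 2 * M \<Longrightarrow> 0 < fst p \<Longrightarrow> fst p < pi \<Longrightarrow>
      sin (fst p) * (2 * r\<^sup>2 * u_vr v r p + 2 * r * u_v v r p + (2 * r - 2 * M) * u_r v r p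
        + r * (r - 2 * M) * u_rr v r p - r\<^sup>2 * V r * u v r p)
      + (cos (fst p) * u_t v r p + sin (fst p) * u_tt v r p + w_p v r p) = 0"
    and poincare: "\<And>v r. r \<ge> 2 * M \<Longrightarrow>
      6 * integral sbox (\<lambda>p. sin (fst p) * (u v r p)\<^sup>2)
        \<le> integral sbox (\<lambda>p. sin (fst p) * ((u_t v r p)\<^sup>2 + (u_w v r p)\<^sup>2))"
begin

lemma wave_eq:
  assumes "r \<ge> 2 * M" "p \<in> sbox"
  shows "sin (fst p) * (2 * r\<^sup>2 * u_vr v r p + 2 * r * u_v v r p + (2 * r - 2 * M) * u_r v r p
        + r * (r - 2 * M) * u_rr v r p - r\<^sup>2 * V r * u v r p) + lap v r p = 0" (is "?F p = 0")
proof (rule eq_0_on_sbox[of ?F])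
  show "continuous_on UNIV ?F" unfolding lap_def using assms(1) by (intro continuous_intros) auto
  show "?F p = 0" if "0 < fst p" "fst p < pi" for p
    unfolding lap_def by (rule wave_eq_open[OF assms(1) that])
qed (rule assms(2))

text \<open>\<open>flux\<close> and \<open>- mom\<close> are the \<open>v\<close> and \<open>r\<close> components of the current of \<open>\<partial>\<^sub>t\<close>; \<open>nrg\<close> and
  \<open>cross\<close> are the spherical means of \<open>|\<partial>\<^sub>r (r u)|\<^sup>2\<close> and of \<open>r u \<partial>\<^sub>r (r u)\<close>.\<close>

definition "flux v r = integral sbox (\<lambda>p. sin (fst p) *
   (r * (r - 2 * M) * (u_r v r p)\<^sup>2 + ((u_t v r p)\<^sup>2 + (u_w v r p)\<^sup>2) + r\<^sup>2 * V r * (u v r p)\<^sup>2)) / 2"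
definition "flux_v v r = integral sbox (\<lambda>p. sin (fst p) *
   (r * (r - 2 * M) * (u_r v r p * u_vr v r p) + (u_t v r p * u_vt v r p + u_w v r p * w_v v r p)
    + r\<^sup>2 * V r * (u v r p * u_v v r p)))"
definition "mom v r = integral sbox (\<lambda>p. sin (fst p) * (r\<^sup>2 * (u_v v r p)\<^sup>2 + r * (r - 2 * M) * (u_v v r p * u_r v r p)))"
definition "mom_v v r = integral sbox (\<lambda>p. sin (fst p) * (2 * r\<^sup>2 * (u_v v r p * u_vv v r p)
   + r * (r - 2 * M) * (u_vv v r p * u_r v r p + u_v v r p * u_vr v r p)))"
definition "mom_r v r = integral sbox (\<lambda>p. sin (fst p) * (2 * r * (u_v v r p)\<^sup>2 + 2 * r\<^sup>2 * (u_v v r p * u_vr v r p)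
   + (2 * r - 2 * M) * (u_v v r p * u_r v r p) + r * (r - 2 * M) * (u_vr v r p * u_r v r p + u_v v r p * u_rr v r p)))"

definition "nrg v r = integral sbox (\<lambda>p. sin (fst p) * (r * u_r v r p + u v r p)\<^sup>2)"
definition "nrg_v v r = integral sbox (\<lambda>p. sin (fst p) * (2 * (r * u_r v r p + u v r p) * (r * u_vr v r p + u_v v r p)))"
definition "nrg_r v r = integral sbox (\<lambda>p. sin (fst p) * (2 * (r * u_r v r p + u v r p) * (r * u_rr v r p + 2 * u_r v r p)))"
definition "ang v r = integral sbox (\<lambda>p. sin (fst p) * ((u_t v r p)\<^sup>2 + (u_w v r p)\<^sup>2))"
definition "ang_r v r = integral sbox (\<lambda>p. sin (fst p) * (2 * (u_t v r p * u_rt v r p + u_w v r p * w_r v r p)))"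
definition "msq v r = integral sbox (\<lambda>p. sin (fst p) * (u v r p)\<^sup>2)"
definition "cross v r = integral sbox (\<lambda>p. sin (fst p) * (r * u v r p * (r * u_r v r p + u v r p)))"

lemma flux_deriv_v: "r \<ge> 2 * M \<Longrightarrow> ((\<lambda>v. flux v r) has_real_derivative flux_v v r) (at v)"
proof -
  assume r: "r \<ge> 2 * M"
  have "((\<lambda>v. integral sbox (\<lambda>p. sin (fst p) *
       (r * (r - 2 * M) * (u_r v r p)\<^sup>2 + ((u_t v r p)\<^sup>2 + (u_w v r p)\<^sup>2) + r\<^sup>2 * V r * (u v r p)\<^sup>2)))
     has_real_derivative integral sbox (\<lambda>p. 2 * (sin (fst p) *
   (r * (r - 2 * M) * (u_r v r p * u_vr v r p) + (u_t v r p * u_vt v r p + u_w v r p * w_v v r p)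
    + r\<^sup>2 * V r * (u v r p * u_v v r p))))) (at v)"
    using r by (intro integral_sbox_has_derivative)
       (auto intro!: derivative_eq_intros derivatives_v continuous_intros simp: algebra_simps power2_eq_square)
  from DERIV_cdivide[OF this, of 2] show ?thesis unfolding flux_def flux_v_def by simp
qed

lemma mom_deriv_v: "r \<ge> 2 * M \<Longrightarrow> ((\<lambda>v. mom v r) has_real_derivative mom_v v r) (at v)"
  unfolding mom_def mom_v_def
  by (intro integral_sbox_has_derivative)
     (auto intro!: derivative_eq_intros derivatives_v continuous_intros simp: algebra_simps power2_eq_square)

lemma mom_deriv_r: "r \<ge> 2 * M \<Longrightarrow> ((\<lambda>r. mom v r) has_real_derivative mom_r v r) (at r within {2 * M..})"
  unfolding mom_def mom_r_def
  by (intro integral_sbox_has_derivative)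
     (auto intro!: derivative_eq_intros derivatives_r continuous_intros simp: algebra_simps power2_eq_square)

lemma nrg_deriv_v: "r \<ge> 2 * M \<Longrightarrow> ((\<lambda>v. nrg v r) has_real_derivative nrg_v v r) (at v)"
  unfolding nrg_def nrg_v_def
  by (intro integral_sbox_has_derivative)
     (auto intro!: derivative_eq_intros derivatives_v continuous_intros simp: algebra_simps power2_eq_square)

lemma nrg_deriv_r: "r \<ge> 2 * M \<Longrightarrow> ((\<lambda>r. nrg v r) has_real_derivative nrg_r v r) (at r within {2 * M..})"
  unfolding nrg_def nrg_r_def
  by (intro integral_sbox_has_derivative)
     (auto intro!: derivative_eq_intros derivatives_r continuous_intros simp: algebra_simps power2_eq_square)

lemma ang_deriv_r: "r \<ge> 2 * M \<Longrightarrow> ((\<lambda>r. ang v r) has_real_derivative ang_r v r) (at r within {2 * M..})"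
  unfolding ang_def ang_r_def
  by (intro integral_sbox_has_derivative)
     (auto intro!: derivative_eq_intros derivatives_r continuous_intros simp: algebra_simps power2_eq_square)

lemma V_cont' [continuous_intros]:
  "continuous_on S R \<Longrightarrow> (\<And>x. x \<in> S \<Longrightarrow> R x \<ge> 2 * M) \<Longrightarrow> continuous_on S (\<lambda>x. V (R x))"
  by (rule continuous_on_compose2[OF V_cont]) auto

lemma continuous_on_averages [continuous_intros]:
  fixes S :: "'z::t2_space set"
  assumes "continuous_on S A" "continuous_on S R" "\<And>x. x \<in> S \<Longrightarrow> R x \<ge> 2 * M"
  shows "continuous_on S (\<lambda>x. flux (A x) (R x))" "continuous_on S (\<lambda>x. flux_v (A x) (R x))"
    "continuous_on S (\<lambda>x. mom (A x) (R x))" "continuous_on S (\<lambda>x. mom_v (A x) (R x))"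
    "continuous_on S (\<lambda>x. mom_r (A x) (R x))" "continuous_on S (\<lambda>x. nrg (A x) (R x))"
    "continuous_on S (\<lambda>x. nrg_v (A x) (R x))" "continuous_on S (\<lambda>x. nrg_r (A x) (R x))"
    "continuous_on S (\<lambda>x. ang (A x) (R x))" "continuous_on S (\<lambda>x. ang_r (A x) (R x))"
    "continuous_on S (\<lambda>x. msq (A x) (R x))" "continuous_on S (\<lambda>x. cross (A x) (R x))"
proof -
  have *: "continuous_on (S \<times> UNIV) (\<lambda>y. A (fst y))" "continuous_on (S \<times> UNIV) (\<lambda>y. R (fst y))"
    by (intro continuous_on_compose2[OF assms(1)] continuous_on_compose2[OF assms(2)] continuous_intros; force)+
  show "continuous_on S (\<lambda>x. flux (A x) (R x))" "continuous_on S (\<lambda>x. flux_v (A x) (R x))"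
    "continuous_on S (\<lambda>x. mom (A x) (R x))" "continuous_on S (\<lambda>x. mom_v (A x) (R x))"
    "continuous_on S (\<lambda>x. mom_r (A x) (R x))" "continuous_on S (\<lambda>x. nrg (A x) (R x))"
    "continuous_on S (\<lambda>x. nrg_v (A x) (R x))" "continuous_on S (\<lambda>x. nrg_r (A x) (R x))"
    "continuous_on S (\<lambda>x. ang (A x) (R x))" "continuous_on S (\<lambda>x. ang_r (A x) (R x))"
    "continuous_on S (\<lambda>x. msq (A x) (R x))" "continuous_on S (\<lambda>x. cross (A x) (R x))"
    unfolding flux_def flux_v_def mom_def mom_v_def mom_r_def nrg_def nrg_v_def nrg_r_def ang_def
      ang_r_def msq_def cross_def
    by (intro continuous_intros continuous_on_integral_sbox * assms; use assms in force)+
qed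

lemma has_integral_sbox:
  fixes H :: "real \<times> real \<Rightarrow> real"
  shows "continuous_on UNIV H \<Longrightarrow> (H has_integral integral sbox H) sbox"
  using continuous_on_imp_integrable_sbox integrable_integral by blast

text \<open>Conservation of the \<partial>_t current: multiply the equation by \<open>u_v\<close>
  and move the angular derivatives with Green's identity, tested with \<open>u_v\<close>.\<close>

lemma flux_v_eq_mom_r:
  assumes r: "r \<ge> 2 * M"
  shows "flux_v v r = mom_r v r"
proof -
  have G: "integral sbox (\<lambda>p. lap v r p * u_v v r p)
       = - integral sbox (\<lambda>p. sin (fst p) * (u_t v r p * u_vt v r p + u_w v r p * w_v v r p))"
    using r by (intro green) (auto intro!: continuous_intros derivatives_t derivatives_p simp: periodic)
  let ?A = "\<lambda>p. sin (fst p) * (2 * r * (u_v v r p)\<^sup>2 + 2 * r\<^sup>2 * (u_v v r p * u_vr v r p)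
   + (2 * r - 2 * M) * (u_v v r p * u_r v r p) + r * (r - 2 * M) * (u_vr v r p * u_r v r p + u_v v r p * u_rr v r p))"
  let ?B = "\<lambda>p. sin (fst p) *
   (r * (r - 2 * M) * (u_r v r p * u_vr v r p) + (u_t v r p * u_vt v r p + u_w v r p * w_v v r p)
    + r\<^sup>2 * V r * (u v r p * u_v v r p))"
  let ?C = "\<lambda>p. sin (fst p) * (u_t v r p * u_vt v r p + u_w v r p * w_v v r p)"
  \<comment> \<open>The added bracket has integral zero by \<open>G\<close>; with it the integrand
    is \<open>u_v\<close> times the equation and vanishes pointwise.\<close>
  have "((\<lambda>p. ?A p - ?B p + (?C p + lap v r p * u_v v r p)) has_integral
       (mom_r v r - flux_v v r + (integral sbox ?C + integral sbox (\<lambda>p. lap v r p * u_v v r p)))) sbox"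
    unfolding mom_r_def flux_v_def lap_def using r
    by (intro has_integral_add has_integral_diff has_integral_sbox continuous_intros) auto
  moreover have "?A p - ?B p + (?C p + lap v r p * u_v v r p) = 0" if "p \<in> sbox" for p
  proof -
    have "?A p - ?B p + (?C p + lap v r p * u_v v r p) = u_v v r p * (sin (fst p) * (2 * r\<^sup>2 * u_vr v r p + 2 * r * u_v v r p + (2 * r - 2 * M) * u_r v r p
        + r * (r - 2 * M) * u_rr v r p - r\<^sup>2 * V r * u v r p) + lap v r p)"
      by (simp add: algebra_simps power2_eq_square)
    then show ?thesis using wave_eq[OF r that] by simp
  qed
  ultimately have "mom_r v r - flux_v v r + (integral sbox ?C + integral sbox (\<lambda>p. lap v r p * u_v v r p)) = 0"
    by (metis (no_types, lifting) has_integral_is_0 has_integral_unique)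
  then show ?thesis using G by simp
qed

text \<open>The multiplier is \<open>u_r + u / r\<close>, that is \<partial>_r (r u) / r. Passing to
  r u absorbs the first order term \<open>2 * r * u_v\<close> into a \<partial>_v derivative of
  \<partial>_r (r u), so no \<open>u_v\<close> survives on the right; the price is the extra
  potential 2 M / r^3.\<close>

lemma nrg_v_eq:
  assumes r: "r \<ge> 2 * M"
  shows "nrg_v v r = - ((1 - 2 * M / r) * nrg_r v r - ang_r v r) / 2 - 2 * M / r\<^sup>2 * nrg v r
    + ang v r / r + (V r + 2 * M / r^3) * cross v r"
proof -
  have r0: "r > 0" using r r_pos by simp
  let ?g = "\<lambda>p. u_r v r p + u v r p / r"
  have G: "integral sbox (\<lambda>p. lap v r p * ?g p)
       = - integral sbox (\<lambda>p. sin (fst p) * (u_t v r p * (u_rt v r p + u_t v r p / r) + u_w v r p * (w_r v r p + u_w v r p / r)))"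
    using r r0 by (intro green) (auto intro!: derivative_eq_intros continuous_intros derivatives_t derivatives_p simp: periodic distrib_left)
  let ?R = "\<lambda>p. sin (fst p) * (2 * (u_t v r p * u_rt v r p + u_w v r p * w_r v r p))"
  let ?E = "\<lambda>p. sin (fst p) * ((u_t v r p)\<^sup>2 + (u_w v r p)\<^sup>2)"
  have "((\<lambda>p. 1/2 * ?R p + 1 / r * ?E p) has_integral (1/2 * ang_r v r + 1 / r * ang v r)) sbox"
    unfolding ang_r_def ang_def using r
    by (intro has_integral_add has_integral_mult_right has_integral_sbox continuous_intros) auto
  then have "integral sbox (\<lambda>p. sin (fst p) * (u_t v r p * (u_rt v r p + u_t v r p / r) + u_w v r p * (w_r v r p + u_w v r p / r)))
      = ang_r v r / 2 + ang v r / r"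
    by (intro integral_unique) (auto simp: algebra_simps power2_eq_square)
  with G have G': "integral sbox (\<lambda>p. lap v r p * ?g p) = - (ang_r v r / 2 + ang v r / r)" by simp
  let ?A = "\<lambda>p. sin (fst p) * (2 * (r * u_r v r p + u v r p) * (r * u_vr v r p + u_v v r p))"
  let ?B = "\<lambda>p. sin (fst p) * (2 * (r * u_r v r p + u v r p) * (r * u_rr v r p + 2 * u_r v r p))"
  let ?C = "\<lambda>p. sin (fst p) * (r * u_r v r p + u v r p)\<^sup>2"
  let ?D = "\<lambda>p. sin (fst p) * (r * u v r p * (r * u_r v r p + u v r p))"
  have "((\<lambda>p. ?A p + (1 - 2 * M / r) / 2 * ?B p + 2 * M / r\<^sup>2 * ?C p - (V r + 2 * M / r^3) * ?D p + lap v r p * ?g p)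
      has_integral (nrg_v v r + (1 - 2 * M / r) / 2 * nrg_r v r + 2 * M / r\<^sup>2 * nrg v r - (V r + 2 * M / r^3) * cross v r
        + integral sbox (\<lambda>p. lap v r p * ?g p))) sbox"
    unfolding nrg_v_def nrg_r_def nrg_def cross_def lap_def using r r0
    by (intro has_integral_add has_integral_diff has_integral_mult_right has_integral_sbox continuous_intros) auto
  moreover have "?A p + (1 - 2 * M / r) / 2 * ?B p + 2 * M / r\<^sup>2 * ?C p - (V r + 2 * M / r^3) * ?D p + lap v r p * ?g p = 0"
    if "p \<in> sbox" for p
  proof -
    have "?A p + (1 - 2 * M / r) / 2 * ?B p + 2 * M / r\<^sup>2 * ?C p - (V r + 2 * M / r^3) * ?D p + lap v r p * ?g p
       = (u_r v r p + u v r p / r) * (sin (fst p) * (2 * r\<^sup>2 * u_vr v r p + 2 * r * u_v v r p + (2 * r - 2 * M) * u_r v r p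
        + r * (r - 2 * M) * u_rr v r p - r\<^sup>2 * V r * u v r p) + lap v r p)"
      using r0 by (simp add: field_simps power2_eq_square power3_eq_cube)
    then show ?thesis using wave_eq[OF r that] by simp
  qed
  ultimately have "nrg_v v r + (1 - 2 * M / r) / 2 * nrg_r v r + 2 * M / r\<^sup>2 * nrg v r - (V r + 2 * M / r^3) * cross v r
        + integral sbox (\<lambda>p. lap v r p * ?g p) = 0"
    by (metis (no_types, lifting) has_integral_is_0 has_integral_unique)
  then show ?thesis using G' by (simp add: field_simps)
qed

end

section \<open>The energy estimate\<close>

definition cutoff :: "real \<Rightarrow> real" where
  "cutoff x = (max 0 x)\<^sup>2 / (1 + (max 0 x)\<^sup>2)"

definition cutoff' :: "real \<Rightarrow> real" where
  "cutoff' x = 2 * max 0 x / (1 + (max 0 x)\<^sup>2)\<^sup>2"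

text \<open>One continuous derivative of the cutoff suffices, and the squared positive part provides
  it: at 0 its difference quotient is at most |h|.\<close>

lemma has_real_derivative_max_square:
  "((\<lambda>x::real. (max 0 x)\<^sup>2) has_real_derivative 2 * max 0 x) (at x)"
proof -
  consider "x > 0" | "x < 0" | "x = 0" by linarith
  then show ?thesis
  proof cases
    case 1
    have "((\<lambda>x. x\<^sup>2) has_real_derivative 2 * max 0 x) (at x)"
      using 1 by (auto intro!: derivative_eq_intros)
    then show ?thesis
      by (rule has_field_derivative_transform_within_open[of _ _ _ "{0<..}"]) (use 1 in auto)
  next
    case 2
    have "((\<lambda>x. 0) has_real_derivative 2 * max 0 x) (at x)"
      using 2 by (auto intro!: derivative_eq_intros)
    then show ?thesis
      by (rule has_field_derivative_transform_within_open[of _ _ _ "{..<0}"]) (use 2 in auto)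
  next
    case 3
    have "((\<lambda>h::real. (max 0 h)\<^sup>2 / h) \<longlongrightarrow> 0) (at 0)"
    proof (rule Lim_null_comparison)
      show "\<forall>\<^sub>F h in at 0. norm ((max 0 h)\<^sup>2 / h) \<le> \<bar>h\<bar>" for h :: real
        by (intro always_eventually) (auto simp: max_def power2_eq_square)
      show "((\<lambda>h::real. \<bar>h\<bar>) \<longlongrightarrow> 0) (at 0)"
        by (rule tendsto_eq_intros refl)+ auto
    qed
    then show ?thesis using 3 by (simp add: DERIV_def)
  qed
qed

lemma one_plus_square_pos: "1 + (x::real)\<^sup>2 > 0"
  by (simp add: add_pos_nonneg)

lemma cutoff_deriv: "(cutoff has_real_derivative cutoff' x) (at x)"
proof -
  have "1 + (max 0 x)\<^sup>2 \<noteq> 0" using one_plus_square_pos[of "max 0 x"] by linarith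
  then have "(cutoff has_real_derivative
      (2 * max 0 x * (1 + (max 0 x)\<^sup>2) - (max 0 x)\<^sup>2 * (0 + 2 * max 0 x)) / ((1 + (max 0 x)\<^sup>2) * (1 + (max 0 x)\<^sup>2))) (at x)"
    unfolding cutoff_def[abs_def]
    by (intro DERIV_divide DERIV_add DERIV_const has_real_derivative_max_square)
  then show ?thesis by (simp add: cutoff'_def power2_eq_square algebra_simps)
qed

lemma cutoff_nonneg: "cutoff x \<ge> 0" "cutoff' x \<ge> 0" and cutoff_le_1: "cutoff x \<le> 1"
  and cutoff_eq_0: "x \<le> 0 \<Longrightarrow> cutoff x = 0"
  using one_plus_square_pos[of "max 0 x"] by (auto simp: cutoff_def cutoff'_def)

lemma continuous_on_cutoff [continuous_intros]:
  "continuous_on S g \<Longrightarrow> continuous_on S (\<lambda>x. cutoff (g x))"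
  "continuous_on S g \<Longrightarrow> continuous_on S (\<lambda>x. cutoff' (g x))"
  unfolding cutoff_def cutoff'_def
  by (auto intro!: continuous_intros simp: add_nonneg_eq_0_iff)

lemma mono_cutoff: "x \<le> y \<Longrightarrow> cutoff x \<le> cutoff y"
  using DERIV_nonneg_imp_nondecreasing[of x y cutoff] cutoff_deriv cutoff_nonneg by blast

lemma cutoff_tendsto_1: "(\<lambda>n. cutoff (real n - x)) \<longlonglongrightarrow> 1"
proof -
  have "((\<lambda>y::real. y\<^sup>2 / (1 + y\<^sup>2)) \<longlongrightarrow> 1) at_top" by real_asymp
  moreover have "filterlim (\<lambda>n. max 0 (real n - x)) at_top sequentially"
  proof (rule filterlim_at_top_mono)
    show "filterlim (\<lambda>n. real n - x) at_top sequentially" by real_asymp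
  qed auto
  ultimately show ?thesis unfolding cutoff_def by (rule filterlim_compose)
qed

lemma tortoise_deriv:
  "M > 0 \<Longrightarrow> r > 2 * M \<Longrightarrow> (tortoise M has_real_derivative r / (r - 2 * M)) (at r within S)"
  unfolding tortoise_def[abs_def] by (auto intro!: derivative_eq_intros simp: field_simps)

text \<open>The normalisation makes the tortoise coordinate vanish at r = 3 M. The linear growth
  beyond shows that a cutoff in \<open>v\<close> has bounded radial support on \<Sigma>^e.\<close>

lemma tortoise_ge:
  assumes "M > 0" "r \<ge> 3 * M"
  shows "tortoise M r \<ge> r - 3 * M"
proof -
  have "ln M \<le> ln (r - 2 * M)" using assms by simp
  then have "2 * M * ln M \<le> 2 * M * ln (r - 2 * M)" using assms by (intro mult_left_mono) auto
  then show ?thesis by (simp add: tortoise_def)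
qed

section \<open>Inequalities between the spherical means\<close>

context wave_exterior
begin

lemma continuous_on_tortoise [continuous_intros]:
  "continuous_on S R \<Longrightarrow> (\<And>x. x \<in> S \<Longrightarrow> R x > 2 * M) \<Longrightarrow> continuous_on S (\<lambda>x. tortoise M (R x))"
  unfolding tortoise_def by (intro continuous_intros) force+

definition "rad v r = integral sbox (\<lambda>p. sin (fst p) * (r * u_r v r p)\<^sup>2)"

lemma continuous_on_rad [continuous_intros]:
  fixes S :: "'z::t2_space set"
  assumes "continuous_on S A" "continuous_on S R" "\<And>x. x \<in> S \<Longrightarrow> R x \<ge> 2 * M"
  shows "continuous_on S (\<lambda>x. rad (A x) (R x))"
proof -
  have *: "continuous_on (S \<times> UNIV) (\<lambda>y. A (fst y))" "continuous_on (S \<times> UNIV) (\<lambda>y. R (fst y))"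
    by (intro continuous_on_compose2[OF assms(1)] continuous_on_compose2[OF assms(2)] continuous_intros; force)+
  show ?thesis unfolding rad_def
    by (intro continuous_intros continuous_on_integral_sbox * assms; use assms in force)+
qed

lemma sin_sbox: "p \<in> sbox \<Longrightarrow> sin (fst p) \<ge> 0"
  by (cases p) (auto intro: sin_ge_zero)

text \<open>Integrability need not be checked: a non-integrable function has integral 0 by
  convention.\<close>

lemma integral_sbox_nonneg:
  assumes "\<And>p. p \<in> sbox \<Longrightarrow> 0 \<le> X p"
  shows "0 \<le> integral sbox (\<lambda>p. sin (fst p) * X p)"
  using assms sin_sbox by (cases "(\<lambda>p. sin (fst p) * X p) integrable_on sbox")
     (auto intro!: integral_nonneg simp: not_integrable_integral)

lemma averages_nonneg: "rad v r \<ge> 0" "ang v r \<ge> 0" "msq v r \<ge> 0" "nrg v r \<ge> 0"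
  unfolding rad_def ang_def msq_def nrg_def by (intro integral_sbox_nonneg; simp)+

lemma msq_le_ang: "r \<ge> 2 * M \<Longrightarrow> 6 * msq v r \<le> ang v r"
  unfolding ang_def msq_def by (rule poincare)

definition "pot v r = ang v r + r\<^sup>2 * V r * msq v r"

text \<open>The potential costs at most \<open>4 * msq\<close>, which by Poincare is at most two
  thirds of \<open>ang\<close>.\<close>

lemma ang_le_pot: "r \<ge> 2 * M \<Longrightarrow> ang v r \<le> 3 * pot v r"
  using mult_right_mono[OF V_bounds(2) averages_nonneg(3), of r v r] msq_le_ang[of r v]
  by (simp add: pot_def)

lemma pot_nonneg: "r \<ge> 2 * M \<Longrightarrow> pot v r \<ge> 0"
  using ang_le_pot[of r v] averages_nonneg(2)[of v r] by linarith

lemma flux_eq: "r \<ge> 2 * M \<Longrightarrow> flux v r = ((1 - 2 * M / r) * rad v r + pot v r) / 2"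
proof -
  assume r: "r \<ge> 2 * M"
  have "((\<lambda>p. (1 - 2 * M / r) * (sin (fst p) * (r * u_r v r p)\<^sup>2) + (sin (fst p) * ((u_t v r p)\<^sup>2 + (u_w v r p)\<^sup>2)
       + r\<^sup>2 * V r * (sin (fst p) * (u v r p)\<^sup>2))) has_integral ((1 - 2 * M / r) * rad v r + pot v r)) sbox"
    unfolding rad_def pot_def ang_def msq_def using r
    by (intro has_integral_add has_integral_mult_right has_integral_sbox continuous_intros) auto
  moreover have "(1 - 2 * M / r) * (sin (fst p) * (r * u_r v r p)\<^sup>2) + (sin (fst p) * ((u_t v r p)\<^sup>2 + (u_w v r p)\<^sup>2)
       + r\<^sup>2 * V r * (sin (fst p) * (u v r p)\<^sup>2))
     = sin (fst p) * (r * (r - 2 * M) * (u_r v r p)\<^sup>2 + ((u_t v r p)\<^sup>2 + (u_w v r p)\<^sup>2) + r\<^sup>2 * V r * (u v r p)\<^sup>2)" for p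
    using r_pos[OF r] by (simp add: field_simps power2_eq_square)
  ultimately show ?thesis unfolding flux_def by (simp add: integral_unique)
qed

lemma flux_ge_pot: "r \<ge> 2 * M \<Longrightarrow> pot v r \<le> 2 * flux v r"
proof -
  assume r: "r \<ge> 2 * M"
  then have "(1 - 2 * M / r) * rad v r \<ge> 0"
    using averages_nonneg(1)[of v r] r_pos[of r] by (intro mult_nonneg_nonneg) auto
  then show ?thesis using flux_eq[OF r, of v] by simp
qed

lemma flux_nonneg: "r \<ge> 2 * M \<Longrightarrow> flux v r \<ge> 0"
  using flux_ge_pot[of r v] pot_nonneg[of r v] by linarith

text \<open>Together with \<open>rad_le\<close> this passes between \<partial>_r (r u), in which the
  red-shift identity is written, and r \<partial>_r u, which occurs in the energy; the difference is
  a zeroth order term controlled by \<open>pot\<close>.\<close>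

lemma nrg_le:
  assumes "r \<ge> 2 * M" shows "nrg v r \<le> 2 * rad v r + 2 * msq v r"
proof (rule has_integral_le)
  show "((\<lambda>p. sin (fst p) * (r * u_r v r p + u v r p)\<^sup>2) has_integral nrg v r) sbox"
    "((\<lambda>p. 2 * (sin (fst p) * (r * u_r v r p)\<^sup>2) + 2 * (sin (fst p) * (u v r p)\<^sup>2)) has_integral 2 * rad v r + 2 * msq v r) sbox"
    unfolding nrg_def rad_def msq_def using assms
    by (intro has_integral_add has_integral_mult_right has_integral_sbox continuous_intros; simp)+
next
  fix p assume "p \<in> sbox"
  have "(r * u_r v r p + u v r p)\<^sup>2 \<le> 2 * (r * u_r v r p)\<^sup>2 + 2 * (u v r p)\<^sup>2"
    using sum_squares_ge_zero[of "r * u_r v r p - u v r p" 0] by (simp add: power2_eq_square algebra_simps)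
  from mult_left_mono[OF this sin_sbox[OF \<open>p \<in> sbox\<close>]]
  show "sin (fst p) * (r * u_r v r p + u v r p)\<^sup>2 \<le> 2 * (sin (fst p) * (r * u_r v r p)\<^sup>2) + 2 * (sin (fst p) * (u v r p)\<^sup>2)"
    by (simp add: algebra_simps)
qed

lemma rad_le:
  assumes "r \<ge> 2 * M" shows "rad v r \<le> 2 * nrg v r + 2 * msq v r"
proof (rule has_integral_le)
  show "((\<lambda>p. sin (fst p) * (r * u_r v r p)\<^sup>2) has_integral rad v r) sbox"
    "((\<lambda>p. 2 * (sin (fst p) * (r * u_r v r p + u v r p)\<^sup>2) + 2 * (sin (fst p) * (u v r p)\<^sup>2)) has_integral 2 * nrg v r + 2 * msq v r) sbox"
    unfolding nrg_def rad_def msq_def using assms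
    by (intro has_integral_add has_integral_mult_right has_integral_sbox continuous_intros; simp)+
next
  fix p assume "p \<in> sbox"
  have "(r * u_r v r p)\<^sup>2 \<le> 2 * (r * u_r v r p + u v r p)\<^sup>2 + 2 * (u v r p)\<^sup>2"
    using sum_squares_ge_zero[of "r * u_r v r p + 2 * u v r p" 0] by (simp add: power2_eq_square algebra_simps)
  from mult_left_mono[OF this sin_sbox[OF \<open>p \<in> sbox\<close>]]
  show "sin (fst p) * (r * u_r v r p)\<^sup>2 \<le> 2 * (sin (fst p) * (r * u_r v r p + u v r p)\<^sup>2) + 2 * (sin (fst p) * (u v r p)\<^sup>2)"
    by (simp add: algebra_simps)
qed

text \<open>Young's inequality with weight M, chosen so that the first term is half of the damping M
  / r^2 that is available in \<open>red_deriv_le\<close>. Since r^2 V lies in [-4, 0] and 2 M / r in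
  [0, 1], their sum \<open>W\<close> satisfies |W| <= 4, whence 16 / (2 M) = 8 / M.\<close>

lemma cross_le:
  assumes r: "r \<ge> 2 * M"
  shows "(V r + 2 * M / r^3) * cross v r \<le> M / (2 * r\<^sup>2) * nrg v r + 8 / M * msq v r"
proof (rule has_integral_le)
  show "((\<lambda>p. (V r + 2 * M / r^3) * (sin (fst p) * (r * u v r p * (r * u_r v r p + u v r p)))) has_integral (V r + 2 * M / r^3) * cross v r) sbox"
    "((\<lambda>p. M / (2 * r\<^sup>2) * (sin (fst p) * (r * u_r v r p + u v r p)\<^sup>2) + 8 / M * (sin (fst p) * (u v r p)\<^sup>2))
       has_integral M / (2 * r\<^sup>2) * nrg v r + 8 / M * msq v r) sbox"
    unfolding nrg_def cross_def msq_def using assms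
    by (intro has_integral_add has_integral_mult_right has_integral_sbox continuous_intros; simp)+
next
  fix p assume "p \<in> sbox"
  define a where "a = r * u_r v r p + u v r p"
  define b where "b = u v r p"
  define W where "W = r\<^sup>2 * V r + 2 * M / r"
  have r0: "r > 0" using r_pos[OF r] .
  have "2 * M / r \<le> 1" "2 * M / r \<ge> 0" using r r0 M_pos by auto
  then have "\<bar>W\<bar> \<le> 4" unfolding W_def using V_bounds[OF r] mult_nonneg_nonpos[of "r\<^sup>2" "V r"] by auto
  then have "W\<^sup>2 \<le> 4\<^sup>2" by (metis abs_le_square_iff abs_numeral)
  then have "W\<^sup>2 \<le> 16" by simp
  have "(V r + 2 * M / r^3) * (r * b * a) = (a / r) * (W * b)"
    unfolding W_def using r0 by (simp add: field_simps power2_eq_square power3_eq_cube)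
  also have "\<dots> \<le> M / 2 * (a / r)\<^sup>2 + (W * b)\<^sup>2 / (2 * M)"
  proof -
    have "0 \<le> (M * (a / r) - W * b)\<^sup>2 / (2 * M)" using M_pos by simp
    also have "\<dots> = M / 2 * (a / r)\<^sup>2 + (W * b)\<^sup>2 / (2 * M) - (a / r) * (W * b)"
      using M_pos by (simp add: power2_diff power_mult_distrib field_simps) (simp add: power2_eq_square)
    finally show ?thesis by simp
  qed
  also have "(W * b)\<^sup>2 / (2 * M) \<le> 16 * b\<^sup>2 / (2 * M)"
    using \<open>W\<^sup>2 \<le> 16\<close> M_pos by (intro divide_right_mono) (auto simp: power_mult_distrib mult_right_mono)
  finally have "(V r + 2 * M / r^3) * (r * b * a) \<le> M / (2 * r\<^sup>2) * a\<^sup>2 + 8 / M * b\<^sup>2"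
    by (simp add: power_divide)
  from mult_left_mono[OF this sin_sbox[OF \<open>p \<in> sbox\<close>]]
  show "(V r + 2 * M / r^3) * (sin (fst p) * (r * u v r p * (r * u_r v r p + u v r p)))
     \<le> M / (2 * r\<^sup>2) * (sin (fst p) * (r * u_r v r p + u v r p)\<^sup>2) + 8 / M * (sin (fst p) * (u v r p)\<^sup>2)"
    unfolding a_def b_def by (simp add: algebra_simps)
qed

section \<open>Monotonicity of the cut-off energy of \<partial>_t\<close>

lemma mom_horizon_nonneg: "mom v (2 * M) \<ge> 0"
  \<comment> \<open>On the horizon the factor \<open>r - 2 * M\<close> removes the mixed term and
    leaves a square.\<close>
  unfolding mom_def by (intro integral_sbox_nonneg) simp

text \<open>The flux of the current of \<open>\<partial>\<^sub>t\<close> through \<open>{v = \<tau> + r\<^sup>*}\<close>, where \<open>dr\<^sup>*/dr = r / (r - 2 M)\<close>.\<close>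

definition "ext_flux \<tau> r = flux (\<tau> + tortoise M r) r + r / (r - 2 * M) * mom (\<tau> + tortoise M r) r"

text \<open>Completing the square: \<open>u_v + (1 - 2 * M / r) * u_r\<close> is the tortoise
  derivative at fixed t and \<open>u_v\<close> is \<partial>_t u, so the part without
  \<open>pot\<close> is the usual sum of two squares on a slice of constant t.\<close>

lemma ext_flux_nonneg:
  assumes r: "r > 2 * M"
  shows "ext_flux \<tau> r \<ge> 0"
proof -
  define v where "v = \<tau> + tortoise M r"
  have r': "r \<ge> 2 * M" "r > 0" using r M_pos by auto
  let ?S = "\<lambda>p. r\<^sup>2 / (1 - 2 * M / r) * (((u_v v r p + (1 - 2 * M / r) * u_r v r p)\<^sup>2 + (u_v v r p)\<^sup>2) / 2)"
  have 1: "((\<lambda>p. sin (fst p) * ?S p) has_integral (integral sbox (\<lambda>p. sin (fst p) * ?S p))) sbox"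
    using r' r by (intro has_integral_sbox continuous_intros) auto
  have 2: "((\<lambda>p. (1 - 2 * M / r) / 2 * (sin (fst p) * (r * u_r v r p)\<^sup>2) + r / (r - 2 * M) *
       (sin (fst p) * (r\<^sup>2 * (u_v v r p)\<^sup>2 + r * (r - 2 * M) * (u_v v r p * u_r v r p))))
     has_integral (1 - 2 * M / r) / 2 * rad v r + r / (r - 2 * M) * mom v r) sbox"
    unfolding rad_def mom_def using r'
    by (intro has_integral_add has_integral_mult_right has_integral_sbox continuous_intros) auto
  have 3: "(1 - 2 * M / r) / 2 * (sin (fst p) * (r * u_r v r p)\<^sup>2) + r / (r - 2 * M) *
       (sin (fst p) * (r\<^sup>2 * (u_v v r p)\<^sup>2 + r * (r - 2 * M) * (u_v v r p * u_r v r p))) = sin (fst p) * ?S p" for p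
  proof -
    have "1 - 2 * M / r = (r - 2 * M) / r" using r' by (simp add: field_simps)
    then show ?thesis using r r' by (simp add: divide_simps) (simp add: algebra_simps power2_eq_square)
  qed
  have "(1 - 2 * M / r) / 2 * rad v r + r / (r - 2 * M) * mom v r = integral sbox (\<lambda>p. sin (fst p) * ?S p)"
    using has_integral_unique[OF has_integral_eq[OF 3 2] 1] .
  moreover have "\<dots> \<ge> 0" using r r' by (intro integral_sbox_nonneg) (auto simp: field_simps)
  ultimately show ?thesis using flux_eq[OF r'(1), of v] pot_nonneg[OF r'(1), of v]
    unfolding ext_flux_def v_def[symmetric] by (simp add: add_divide_distrib)
qed

text \<open>A chain rule for a function known through its partial derivatives, the radial one being
  one-sided at r = 2 M. Their continuity yields a total derivative within a half plane, of which (v,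
  r) is an interior point.\<close>

lemma mom_along_slice:
  assumes r: "r > 2 * M"
  shows "((\<lambda>r. mom (\<tau> + tortoise M r) r) has_real_derivative
     (mom_v (\<tau> + tortoise M r) r * (r / (r - 2 * M)) + mom_r (\<tau> + tortoise M r) r)) (at r within S)"
proof -
  let ?v = "\<tau> + tortoise M r"
  have "((\<lambda>(v, r). mom v r) has_derivative
      (\<lambda>(tv, tr). mom_v ?v r * tv + blinfun_mult_right (mom_r ?v r) tr)) (at (?v, r) within UNIV \<times> {2 * M..})"
  proof (rule has_derivative_partialsI)
    show "((\<lambda>v. mom v r) has_derivative (*) (mom_v ?v r)) (at ?v within UNIV)"
      using mom_deriv_v[of r] r unfolding has_field_derivative_def by simp
    show "((\<lambda>y. mom x y) has_derivative blinfun_apply (blinfun_mult_right (mom_r x y))) (at y within {2 * M..})"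
      if "y \<in> {2 * M..}" for x y
      using mom_deriv_r[of y x] that unfolding has_field_derivative_def by simp
    have "continuous_on (UNIV \<times> {2 * M..}) (\<lambda>y. blinfun_mult_right (mom_r (fst y) (snd y)))"
      by (intro bounded_linear.continuous_on[OF bounded_linear_blinfun_mult_right] continuous_intros) auto
    then show "continuous (at (?v, r) within UNIV \<times> {2 * M..}) (\<lambda>(x, y). blinfun_mult_right (mom_r x y))"
      using r by (auto simp: continuous_on_eq_continuous_within case_prod_unfold)
  qed (use r in auto)
  then have "((\<lambda>y. mom (fst y) (snd y)) has_derivative
      (\<lambda>y. mom_v ?v r * fst y + mom_r ?v r * snd y)) (at (?v, r))"
    by (subst (asm) at_within_interior) (use r in \<open>auto simp: interior_Times case_prod_unfold\<close>)
  moreover have "((\<lambda>r. (\<tau> + tortoise M r, r)) has_derivative (\<lambda>h. (r / (r - 2 * M) * h, h))) (at r within S)"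
    using tortoise_deriv[OF M_pos r, of S] unfolding has_field_derivative_def
    by (auto intro!: derivative_eq_intros)
  ultimately show ?thesis
    unfolding has_field_derivative_def
    using has_derivative_compose[of "\<lambda>r. (\<tau> + tortoise M r, r)" "\<lambda>h. (r / (r - 2 * M) * h, h)" r S
         "\<lambda>y. mom (fst y) (snd y)" "\<lambda>y. mom_v ?v r * fst y + mom_r ?v r * snd y"]
    by (auto simp: algebra_simps elim!: has_derivative_eq_rhs)
qed

lemma integral_derivative:
  fixes F :: "real \<Rightarrow> real \<Rightarrow> real"
  assumes "\<And>\<tau> r. r \<in> {a..b} \<Longrightarrow> ((\<lambda>\<tau>. F \<tau> r) has_real_derivative F' \<tau> r) (at \<tau>)"
    and "\<And>\<tau>. continuous_on {a..b} (F \<tau>)"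
    and "continuous_on (UNIV \<times> {a..b}) (\<lambda>y. F' (fst y) (snd y))"
  shows "((\<lambda>\<tau>. integral {a..b} (F \<tau>)) has_real_derivative integral {a..b} (F' \<tau>)) (at \<tau>)"
  using leibniz_rule_field_derivative[of UNIV a b F F' \<tau>] assms
  by (auto simp: case_prod_unfold intro: integrable_continuous_real)

text \<open>On the inner piece \<open>v\<close> is constant, so the cutoff is a mere factor there.
  \<open>L\<close> is to be chosen beyond the radial support of the cutoff, which keeps the outer
  integral over a compact interval.\<close>

definition "cut_energy R L n \<tau> = cutoff (n - (\<tau> + tortoise M R)) * integral {2 * M..R} (flux (\<tau> + tortoise M R))
   + integral {R..L} (\<lambda>r. cutoff (n - (\<tau> + tortoise M r)) * ext_flux \<tau> r)"

text \<open>The terms with \<open>mom\<close> at \<open>R\<close> cancel between the two pieces, the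
  one at \<open>L\<close> is cut off, and the one at the horizon has the good sign. The derivative
  of the cutoff enters only through products with \<open>flux\<close>, again of good sign.\<close>

lemma cut_energy_deriv:
  assumes R: "R > 2 * M" and L: "R \<le> L" "n - (\<tau> + tortoise M L) \<le> 0"
  shows "\<exists>d \<le> 0. (cut_energy R L n has_real_derivative d) (at \<tau>)"
proof -
  define h where "h = tortoise M"
  define c where "c = h R"
  define k where "k r = r / (r - 2 * M)" for r
  have k_cont: "continuous_on S (\<lambda>x. k (g x))" if "continuous_on S g" "\<And>x. x \<in> S \<Longrightarrow> g x \<ge> R" for S :: "'z::t2_space set" and g
    unfolding k_def using that R by (intro continuous_intros) force+
  have h_cont: "continuous_on S (\<lambda>x. h (g x))" if "continuous_on S g" "\<And>x. x \<in> S \<Longrightarrow> g x \<ge> R" for S :: "'z::t2_space set" and g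
    unfolding h_def using that R by (intro continuous_intros) force+
  let ?I1 = "integral {2 * M..R} (flux (\<tau> + c))"
  have "((\<lambda>\<tau>. integral {2 * M..R} (flux (\<tau> + c))) has_real_derivative
      integral {2 * M..R} (flux_v (\<tau> + c))) (at \<tau>)"
    by (rule integral_derivative)
       (auto intro!: continuous_intros DERIV_cong[OF DERIV_chain2[OF flux_deriv_v]] derivative_eq_intros)
  moreover have "integral {2 * M..R} (flux_v (\<tau> + c)) = mom (\<tau> + c) R - mom (\<tau> + c) (2 * M)"
  proof (rule integral_unique)
    have "(mom_r (\<tau> + c) has_integral mom (\<tau> + c) R - mom (\<tau> + c) (2 * M)) {2 * M..R}"
      using R by (intro fundamental_theorem_of_calculus)
        (auto simp: has_real_derivative_iff_has_vector_derivative[symmetric] intro!: DERIV_subset[OF mom_deriv_r])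
    then show "(flux_v (\<tau> + c) has_integral mom (\<tau> + c) R - mom (\<tau> + c) (2 * M)) {2 * M..R}"
      by (rule has_integral_eq[rotated]) (auto simp: flux_v_eq_mom_r)
  qed
  ultimately have D1: "((\<lambda>\<tau>. integral {2 * M..R} (flux (\<tau> + c))) has_real_derivative
      mom (\<tau> + c) R - mom (\<tau> + c) (2 * M)) (at \<tau>)" by simp
  have C: "((\<lambda>\<tau>. cutoff (n - (\<tau> + x))) has_real_derivative - cutoff' (n - (\<tau> + x))) (at \<tau>)" for x \<tau>
    by (rule DERIV_cong[OF DERIV_chain2[OF cutoff_deriv]]) (auto intro!: derivative_eq_intros)
  let ?E' = "\<lambda>\<tau> r. - cutoff' (n - (\<tau> + h r)) * ext_flux \<tau> r + (flux_v (\<tau> + h r) r + k r * mom_v (\<tau> + h r) r) * cutoff (n - (\<tau> + h r))"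
  have D2: "((\<lambda>\<tau>. integral {R..L} (\<lambda>r. cutoff (n - (\<tau> + h r)) * ext_flux \<tau> r)) has_real_derivative
      integral {R..L} (?E' \<tau>)) (at \<tau>)"
  proof (rule integral_derivative)
    fix \<tau> r assume "r \<in> {R..L}"
    then have r: "r \<ge> 2 * M" using R by auto
    have "((\<lambda>\<tau>. ext_flux \<tau> r) has_real_derivative (flux_v (\<tau> + h r) r + k r * mom_v (\<tau> + h r) r)) (at \<tau>)"
      unfolding ext_flux_def h_def k_def
      by (intro DERIV_add DERIV_cmult DERIV_cong[OF DERIV_chain2[OF flux_deriv_v[OF r]]]
           DERIV_cong[OF DERIV_chain2[OF mom_deriv_v[OF r]]])
         (auto intro!: derivative_eq_intros)
    from DERIV_mult[OF C this]
    show "((\<lambda>\<tau>. cutoff (n - (\<tau> + h r)) * ext_flux \<tau> r) has_real_derivative ?E' \<tau> r) (at \<tau>)" .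
  next
    show "continuous_on {R..L} (\<lambda>r. cutoff (n - (\<tau> + h r)) * ext_flux \<tau> r)" for \<tau>
      unfolding ext_flux_def h_def[symmetric] k_def[symmetric] using R
      by (intro continuous_intros k_cont h_cont) auto
    show "continuous_on (UNIV \<times> {R..L}) (\<lambda>y. ?E' (fst y) (snd y))"
      unfolding ext_flux_def h_def[symmetric] k_def[symmetric] using R
      by (intro continuous_intros k_cont h_cont) auto
  qed
  \<comment> \<open>By conservation, \<open>?E'\<close> is the radial derivative of
    \<open>?Z\<close> along the slice minus \<open>cutoff'\<close> times \<open>flux\<close>: the
    \<open>mom\<close> part of \<open>ext_flux\<close> is exactly what differentiating the cutoff
    along the slice produces.\<close>
  let ?Z = "\<lambda>r. cutoff (n - (\<tau> + h r)) * mom (\<tau> + h r) r"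
  let ?Z' = "\<lambda>r. - (cutoff' (n - (\<tau> + h r)) * k r) * mom (\<tau> + h r) r
      + (mom_v (\<tau> + h r) r * k r + mom_r (\<tau> + h r) r) * cutoff (n - (\<tau> + h r))"
  have "(?Z' has_integral ?Z L - ?Z R) {R..L}"
  proof (rule fundamental_theorem_of_calculus[OF L(1)])
    fix r assume "r \<in> {R..L}"
    then have r: "r > 2 * M" using R by auto
    have "((\<lambda>r. cutoff (n - (\<tau> + h r))) has_real_derivative - (cutoff' (n - (\<tau> + h r)) * k r)) (at r within {R..L})"
      by (rule DERIV_cong[OF DERIV_chain2[OF cutoff_deriv]])
         (auto intro!: derivative_eq_intros tortoise_deriv[OF M_pos r] simp: h_def k_def)
    from DERIV_mult[OF this mom_along_slice[OF r, of \<tau> "{R..L}", folded h_def k_def]]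
    show "(?Z has_vector_derivative ?Z' r) (at r within {R..L})"
      by (simp add: has_real_derivative_iff_has_vector_derivative)
  qed
  moreover have "((\<lambda>r. - (cutoff' (n - (\<tau> + h r)) * flux (\<tau> + h r) r)) has_integral
      - integral {R..L} (\<lambda>r. cutoff' (n - (\<tau> + h r)) * flux (\<tau> + h r) r)) {R..L}"
    using R by (intro has_integral_neg integrable_integral integrable_continuous_real continuous_intros h_cont) auto
  ultimately have "((\<lambda>r. ?Z' r + - (cutoff' (n - (\<tau> + h r)) * flux (\<tau> + h r) r)) has_integral
     ?Z L - ?Z R + - integral {R..L} (\<lambda>r. cutoff' (n - (\<tau> + h r)) * flux (\<tau> + h r) r)) {R..L}"
    by (rule has_integral_add)
  then have "(?E' \<tau> has_integral
     ?Z L - ?Z R + - integral {R..L} (\<lambda>r. cutoff' (n - (\<tau> + h r)) * flux (\<tau> + h r) r)) {R..L}"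
    by (rule has_integral_eq[rotated])
       (use R in \<open>auto simp: ext_flux_def h_def[symmetric] k_def flux_v_eq_mom_r algebra_simps\<close>)
  then have I2: "integral {R..L} (?E' \<tau>) =
     ?Z L - ?Z R - integral {R..L} (\<lambda>r. cutoff' (n - (\<tau> + h r)) * flux (\<tau> + h r) r)"
    by (simp add: integral_unique)
  have ZL: "?Z L = 0" using L by (simp add: h_def cutoff_eq_0)
  have P: "integral {R..L} (\<lambda>r. cutoff' (n - (\<tau> + h r)) * flux (\<tau> + h r) r) \<ge> 0"
    using R by (intro integral_nonneg integrable_continuous_real continuous_intros h_cont mult_nonneg_nonneg cutoff_nonneg flux_nonneg) auto
  have P1: "?I1 \<ge> 0"
    by (intro integral_nonneg integrable_continuous_real continuous_intros flux_nonneg) auto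
  let ?d = "- cutoff' (n - (\<tau> + c)) * ?I1 + (mom (\<tau> + c) R - mom (\<tau> + c) (2 * M)) * cutoff (n - (\<tau> + c))
     + integral {R..L} (?E' \<tau>)"
  have "(cut_energy R L n has_real_derivative ?d) (at \<tau>)"
    unfolding cut_energy_def[abs_def] h_def[symmetric] unfolding c_def[symmetric]
    by (rule DERIV_add[OF DERIV_mult[OF C D1] D2])
  moreover have "?d \<le> 0"
    unfolding I2 ZL using P mult_nonneg_nonneg[OF cutoff_nonneg(2)[of "n - (\<tau> + c)"] P1]
      mult_nonneg_nonneg[OF cutoff_nonneg(1)[of "n - (\<tau> + c)"] mom_horizon_nonneg[of "\<tau> + c"]]
    by (simp add: c_def left_diff_distrib right_diff_distrib mult.commute)
  ultimately show ?thesis by blast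
qed

lemma cut_energy_decreasing:
  assumes "R > 2 * M" "R \<le> L" "n - (\<tau>\<^sub>0 + tortoise M L) \<le> 0" "\<tau>\<^sub>0 \<le> \<tau>"
  shows "cut_energy R L n \<tau> \<le> cut_energy R L n \<tau>\<^sub>0"
  using assms(4)
proof (rule DERIV_nonpos_imp_nonincreasing)
  fix x assume "\<tau>\<^sub>0 \<le> x" "x \<le> \<tau>"
  then show "\<exists>y. (cut_energy R L n has_real_derivative y) (at x) \<and> y \<le> 0"
    using cut_energy_deriv[OF assms(1,2), of n x] assms(3) by auto
qed

section \<open>Red-shift estimate for the derivative transversal to the horizon\<close>

definition "red R v = integral {2 * M..R} (\<lambda>r. (R - r) * nrg v r)"

text \<open>Integrating the term with \<open>nrg_r\<close> by parts against \<open>R - r\<close>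
  gives back M / r^2 of the damping 2 M / r^2, and \<open>cross_le\<close> takes half of the rest;
  what remains is M / (2 r^2) >= M / (2 R^2). Differentiating the weight yields a term in
  \<open>nrg\<close> of good sign and \<open>ang / 2\<close>, which joins the other angular terms on
  the side of \<open>flux\<close>.\<close>

lemma red_deriv_le:
  assumes R: "R > 2 * M"
  shows "\<exists>d. (red R has_real_derivative d) (at v) \<and>
     d \<le> - (M / (2 * R\<^sup>2)) * red R v + (3 + 12 * R / M) * integral {2 * M..R} (flux v)"
proof -
  let ?D = "\<lambda>r. 1 - 2 * M / r"
  let ?q = "\<lambda>r. (R - r) * (?D r * nrg v r - ang v r)"
  let ?q' = "\<lambda>r. (0 - 1) * (?D r * nrg v r - ang v r)
     + ((2 * M / r\<^sup>2) * nrg v r + nrg_r v r * ?D r - ang_r v r) * (R - r)"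
  have D: "(red R has_real_derivative integral {2 * M..R} (\<lambda>r. (R - r) * nrg_v v r)) (at v)"
    unfolding red_def[abs_def]
    by (rule integral_derivative) (auto intro!: continuous_intros DERIV_cmult nrg_deriv_v)
  have "(?q' has_integral ?q R - ?q (2 * M)) {2 * M..R}"
  proof (rule fundamental_theorem_of_calculus)
    fix r assume r: "r \<in> {2 * M..R}"
    then have "r > 0" using r_pos by auto
    then have "(?D has_real_derivative 2 * M / r\<^sup>2) (at r within {2 * M..R})"
      by (auto intro!: derivative_eq_intros simp: power2_eq_square)
    note d = this DERIV_subset[OF nrg_deriv_r, of r "{2 * M..R}" v] DERIV_subset[OF ang_deriv_r, of r "{2 * M..R}" v]
    have "(?q has_real_derivative ?q' r) (at r within {2 * M..R})"
      by (intro DERIV_mult DERIV_diff DERIV_const DERIV_ident d) (use r in auto)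
    then show "(?q has_vector_derivative ?q' r) (at r within {2 * M..R})"
      by (simp add: has_real_derivative_iff_has_vector_derivative)
  qed (use R in auto)
  then have 1: "((\<lambda>r. (-1/2) * ?q' r) has_integral (-1/2) * (?q R - ?q (2 * M))) {2 * M..R}"
    by (rule has_integral_mult_right)
  have 2: "((\<lambda>r. (R - r) * nrg v r) has_integral red R v) {2 * M..R}"
    unfolding red_def by (intro integrable_integral integrable_continuous_real continuous_intros) auto
  have 3: "(flux v has_integral integral {2 * M..R} (flux v)) {2 * M..R}"
    by (intro integrable_integral integrable_continuous_real continuous_intros) auto
  have "integral {2 * M..R} (\<lambda>r. (R - r) * nrg_v v r) \<le>
     (-1/2) * (?q R - ?q (2 * M)) + ((- (M / (2 * R\<^sup>2))) * red R v + (3 + 12 * R / M) * integral {2 * M..R} (flux v))"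
  proof (rule has_integral_le)
    show "((\<lambda>r. (R - r) * nrg_v v r) has_integral integral {2 * M..R} (\<lambda>r. (R - r) * nrg_v v r)) {2 * M..R}"
      by (intro integrable_integral integrable_continuous_real continuous_intros) auto
    show "((\<lambda>r. (-1/2) * ?q' r + ((- (M / (2 * R\<^sup>2))) * ((R - r) * nrg v r) + (3 + 12 * R / M) * flux v r)) has_integral
       (-1/2) * (?q R - ?q (2 * M)) + ((- (M / (2 * R\<^sup>2))) * red R v + (3 + 12 * R / M) * integral {2 * M..R} (flux v))) {2 * M..R}"
      by (intro has_integral_add has_integral_mult_right 1 2 3)
    fix r assume "r \<in> {2 * M..R}"
    then have r: "r \<ge> 2 * M" "r \<le> R" "r > 0" using r_pos by auto
    define N where "N = nrg v r"
    define a where "a = ang v r"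
    define m where "m = msq v r"
    define F where "F = flux v r"
    define X where "X = (V r + 2 * M / r^3) * cross v r"
    have facts: "N \<ge> 0" "a \<ge> 0" "m \<ge> 0" "6 * m \<le> a" "a \<le> 6 * F" "X \<le> M / (2 * r\<^sup>2) * N + 8 / M * m"
      using averages_nonneg msq_le_ang[OF r(1), of v] ang_le_pot[OF r(1), of v] flux_ge_pot[OF r(1), of v]
        cross_le[OF r(1), of v]
      by (auto simp: N_def a_def m_def F_def X_def intro: order_trans)
    have "(R - r) * nrg_v v r = (-1/2) * ?q' r - ?D r * N / 2 + a / 2
        + (R - r) * (- (M / r\<^sup>2) * N + a / r + X)"
      unfolding nrg_v_eq[OF r(1)] N_def a_def X_def using r
      by (simp add: field_simps power2_eq_square power3_eq_cube)
    also have "\<dots> \<le> (-1/2) * ?q' r + a / 2 + (R - r) * (- (M / (2 * R\<^sup>2)) * N + a / (2 * M) + 8 / M * (a / 6))"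
    proof -
      have "?D r * N \<ge> 0" using facts r M_pos by (intro mult_nonneg_nonneg) (auto simp: field_simps)
      moreover have "(R - r) * (- (M / r\<^sup>2) * N + a / r + X) \<le> (R - r) * (- (M / (2 * R\<^sup>2)) * N + a / (2 * M) + 8 / M * (a / 6))"
      proof (rule mult_left_mono)
        have "M / (2 * R\<^sup>2) * N \<le> M / (2 * r\<^sup>2) * N"
          using r M_pos facts by (intro mult_right_mono divide_left_mono mult_left_mono power_mono) auto
        moreover have "a / r \<le> a / (2 * M)" using r M_pos facts by (intro divide_left_mono) auto
        moreover have "8 / M * m \<le> 8 / M * (a / 6)" using facts M_pos by (intro mult_left_mono) auto
        moreover have "M / r\<^sup>2 * N = M / (2 * r\<^sup>2) * N + M / (2 * r\<^sup>2) * N" by (simp add: field_simps)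
        ultimately show "- (M / r\<^sup>2) * N + a / r + X \<le> - (M / (2 * R\<^sup>2)) * N + a / (2 * M) + 8 / M * (a / 6)"
          using facts(6) by simp
      qed (use r in auto)
      moreover have "x - y / 2 + b + w \<le> x + b + w'" if "0 \<le> y" "w \<le> w'" for x y b w w' :: real
        using that by linarith
      ultimately show ?thesis by blast
    qed
    also have "(R - r) * (- (M / (2 * R\<^sup>2)) * N + a / (2 * M) + 8 / M * (a / 6))
       \<le> (- (M / (2 * R\<^sup>2))) * ((R - r) * N) + 2 * R / M * a"
    proof -
      \<comment> \<open>1/2 + 8/6 = 11/6, rounded up to 2.\<close>
      have "a / (2 * M) + 8 / M * (a / 6) \<le> 2 * a / M" using M_pos facts by (simp add: field_simps)
      then have "(R - r) * (a / (2 * M) + 8 / M * (a / 6)) \<le> R * (2 * a / M)"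
        using r M_pos facts by (intro mult_mono) auto
      then show ?thesis by (simp add: algebra_simps)
    qed
    also have "(-1/2) * ?q' r + a / 2 + ((- (M / (2 * R\<^sup>2))) * ((R - r) * N) + 2 * R / M * a)
        \<le> (-1/2) * ?q' r + ((- (M / (2 * R\<^sup>2))) * ((R - r) * N) + (3 + 12 * R / M) * F)"
    proof -
      \<comment> \<open>The factor 6 comes from \<open>ang <= 3 pot <= 6 flux\<close>, and gives the
        constant 3 + 12 R / M.\<close>
      have "(1 / 2 + 2 * R / M) * a \<le> (1 / 2 + 2 * R / M) * (6 * F)"
        using facts M_pos R by (intro mult_left_mono) auto
      then show ?thesis by (simp add: algebra_simps)
    qed
    finally show "(R - r) * nrg_v v r \<le> (-1/2) * ?q' r + ((- (M / (2 * R\<^sup>2))) * ((R - r) * nrg v r) + (3 + 12 * R / M) * flux v r)"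
      unfolding N_def F_def by simp
  qed
  \<comment> \<open>The weight vanishes at \<open>R\<close>; at the horizon 1 - 2 M / r = 0, so only
    \<open>- (R - 2 * M) * ang\<close> is left of \<open>?q\<close>.\<close>
  moreover have "(-1/2) * (?q R - ?q (2 * M)) \<le> 0"
    using R M_pos averages_nonneg(2)[of v "2 * M"] by (simp add: mult_nonneg_nonneg)
  ultimately show ?thesis using D by (intro exI[of _ "integral {2 * M..R} (\<lambda>r. (R - r) * nrg_v v r)"]) auto
qed

text \<open>Gronwall with damping: \<open>A\<close> is the equilibrium value of the differential
  inequality, so \<open>(red - A) * exp (\<kappa> * v)\<close> is nonincreasing. The bound therefore
  does not grow with \<open>v\<^sub>1 - v\<^sub>0\<close>.\<close>

lemma red_bound:
  assumes R: "R > 2 * M" and v: "v\<^sub>0 \<le> v\<^sub>1"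
    and T: "\<And>v. v\<^sub>0 \<le> v \<Longrightarrow> v \<le> v\<^sub>1 \<Longrightarrow> integral {2 * M..R} (flux v) \<le> T" and T0: "T \<ge> 0"
  shows "red R v\<^sub>1 \<le> red R v\<^sub>0 + (3 + 12 * R / M) * (2 * R\<^sup>2 / M) * T"
proof -
  define \<kappa> where "\<kappa> = M / (2 * R\<^sup>2)"
  define A where "A = (3 + 12 * R / M) * (2 * R\<^sup>2 / M) * T"
  have pos: "\<kappa> > 0" "A \<ge> 0" using R M_pos T0 by (auto simp: \<kappa>_def A_def)
  have \<kappa>A: "\<kappa> * A = (3 + 12 * R / M) * T" using R M_pos unfolding \<kappa>_def A_def by simp
  have red0: "red R v \<ge> 0" for v
    unfolding red_def using averages_nonneg
    by (intro integral_nonneg integrable_continuous_real continuous_intros) auto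
  have "(red R v\<^sub>1 - A) * exp (\<kappa> * v\<^sub>1) \<le> (red R v\<^sub>0 - A) * exp (\<kappa> * v\<^sub>0)"
    using v
  proof (rule DERIV_nonpos_imp_nonincreasing)
    fix v assume vv: "v\<^sub>0 \<le> v" "v \<le> v\<^sub>1"
    obtain d where d: "(red R has_real_derivative d) (at v)"
      "d \<le> - \<kappa> * red R v + (3 + 12 * R / M) * integral {2 * M..R} (flux v)"
      using red_deriv_le[OF R, of v] unfolding \<kappa>_def by blast
    have "(3 + 12 * R / M) * integral {2 * M..R} (flux v) \<le> \<kappa> * A"
      unfolding \<kappa>A using T[OF vv] R M_pos by (intro mult_left_mono) auto
    then have le: "d + \<kappa> * (red R v - A) \<le> 0" using d(2) by (simp add: algebra_simps)
    have "((\<lambda>v. (red R v - A) * exp (\<kappa> * v)) has_real_derivative (d + \<kappa> * (red R v - A)) * exp (\<kappa> * v)) (at v)"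
      by (auto intro!: derivative_eq_intros d(1) simp: algebra_simps)
    then show "\<exists>y. ((\<lambda>v. (red R v - A) * exp (\<kappa> * v)) has_real_derivative y) (at v) \<and> y \<le> 0"
      using le by (intro exI[of _ "(d + \<kappa> * (red R v - A)) * exp (\<kappa> * v)"]) (auto simp: mult_nonpos_nonneg)
  qed
  also have "\<dots> \<le> red R v\<^sub>0 * exp (\<kappa> * v\<^sub>0)" using pos by (intro mult_right_mono) auto
  also have "\<dots> \<le> red R v\<^sub>0 * exp (\<kappa> * v\<^sub>1)" using pos red0 v by (intro mult_left_mono) auto
  finally have "red R v\<^sub>1 - A \<le> red R v\<^sub>0" by (simp del: exp_le_cancel_iff)
  then show ?thesis unfolding A_def by simp
qed

section \<open>Energies with values in [0, infinity]\<close>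

lemma nn_integral_half_open:
  fixes q :: "real \<Rightarrow> real"
  assumes "a \<le> b" "continuous_on {a..b} q" "\<And>r. r \<in> {a..b} \<Longrightarrow> q r \<ge> 0"
  shows "(\<integral>\<^sup>+ r\<in>{a..<b}. ennreal (q r) \<partial>lborel) = ennreal (integral {a..b} q)"
proof (rule nn_integral_has_integral_lebesgue')
  have "(q has_integral integral {a..b} q) {a..b}"
    using assms integrable_continuous_real by blast
  then show "(q has_integral integral {a..b} q) {a..<b}"
    by (rule has_integral_spike_set_eq[THEN iffD1, rotated -1])
       (rule negligible_subset[of "{b}"]; use assms in auto)+
qed (use assms in auto)

lemma ext_flux_cont: "R > 2 * M \<Longrightarrow> S \<subseteq> {R..} \<Longrightarrow> continuous_on S (ext_flux \<tau>)"
  unfolding ext_flux_def by (intro continuous_intros) force+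

lemma cutoff_nn_integral:
  assumes R: "R > 2 * M" and L: "R \<le> L" "\<And>r. r \<ge> L \<Longrightarrow> n - (\<tau> + tortoise M r) \<le> 0"
  shows "(\<integral>\<^sup>+ r\<in>{R..}. ennreal (cutoff (n - (\<tau> + tortoise M r)) * ext_flux \<tau> r) \<partial>lborel)
     = ennreal (integral {R..L} (\<lambda>r. cutoff (n - (\<tau> + tortoise M r)) * ext_flux \<tau> r))"
proof -
  let ?q = "\<lambda>r. cutoff (n - (\<tau> + tortoise M r)) * ext_flux \<tau> r"
  have "(\<integral>\<^sup>+ r\<in>{R..}. ennreal (?q r) \<partial>lborel) = (\<integral>\<^sup>+ r\<in>{R..L}. ennreal (?q r) \<partial>lborel)"
    using L cutoff_eq_0 by (intro nn_integral_cong) (auto simp: indicator_def not_le)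
  also have "\<dots> = ennreal (integral {R..L} ?q)"
  proof (rule nn_integral_has_integral_lebesgue')
    show "(?q has_integral integral {R..L} ?q) {R..L}" using R
      by (intro integrable_integral integrable_continuous_real continuous_intros ext_flux_cont) auto
  qed (use R in \<open>auto intro!: mult_nonneg_nonneg cutoff_nonneg ext_flux_nonneg\<close>)
  finally show ?thesis .
qed

text \<open>\<open>T\<close> bounds the cut-off energy at \<open>\<tau>\<^sub>0\<close> for every n,
  hence the one at \<tau>, and does not depend on n. As n grows the cutoff increases to 1: a plain
  limit handles the inner piece, monotone convergence the unbounded one.\<close>

lemma horizon_flux_bound:
  assumes R: "R > 2 * M" and \<tau>: "\<tau>\<^sub>0 \<le> \<tau>" and T: "T \<ge> 0"
    and E: "ennreal (integral {2 * M..R} (flux (\<tau>\<^sub>0 + tortoise M R)))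
       + (\<integral>\<^sup>+ r\<in>{R..}. ennreal (ext_flux \<tau>\<^sub>0 r) \<partial>lborel) \<le> ennreal T"
  shows "integral {2 * M..R} (flux (\<tau> + tortoise M R)) \<le> T"
    and "(\<integral>\<^sup>+ r\<in>{R..}. ennreal (ext_flux \<tau> r) \<partial>lborel) \<le> ennreal T"
proof -
  let ?I = "\<lambda>\<tau>. integral {2 * M..R} (flux (\<tau> + tortoise M R))"
  let ?q = "\<lambda>\<tau> n r. cutoff (real n - (\<tau> + tortoise M r)) * ext_flux \<tau> r"
  have I0: "?I \<tau> \<ge> 0" for \<tau>
    by (intro integral_nonneg integrable_continuous_real continuous_intros flux_nonneg) auto
  have bound: "cutoff (real n - (\<tau> + tortoise M R)) * ?I \<tau> \<le> T \<and>
     (\<integral>\<^sup>+ r\<in>{R..}. ennreal (?q \<tau> n r) \<partial>lborel) \<le> ennreal T" for n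
  proof -
    \<comment> \<open>By \<open>tortoise_ge\<close> all r beyond \<open>L\<close> lie outside the
      support of the cutoff at \<open>\<tau>\<^sub>0\<close>, and all the more at later
      times.\<close>
    define L where "L = max R (max (3 * M) (n - \<tau>\<^sub>0 + 3 * M))"
    have L: "R \<le> L" "\<And>r. r \<ge> L \<Longrightarrow> n - (\<tau>\<^sub>0 + tortoise M r) \<le> 0"
      using tortoise_ge[OF M_pos] by (fastforce simp: L_def)+
    have L': "\<And>r. r \<ge> L \<Longrightarrow> n - (\<tau> + tortoise M r) \<le> 0" using L(2) \<tau> by fastforce
    define J where "J \<tau> = integral {R..L} (?q \<tau> n)" for \<tau>
    have J0: "J \<tau> \<ge> 0" for \<tau> unfolding J_def using R
      by (intro integral_nonneg integrable_continuous_real continuous_intros ext_flux_cont mult_nonneg_nonneg cutoff_nonneg ext_flux_nonneg) auto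
    have "ennreal (J \<tau>\<^sub>0) = (\<integral>\<^sup>+ r\<in>{R..}. ennreal (?q \<tau>\<^sub>0 n r) \<partial>lborel)"
      unfolding J_def using cutoff_nn_integral[OF R L] by simp
    also have "\<dots> \<le> (\<integral>\<^sup>+ r\<in>{R..}. ennreal (ext_flux \<tau>\<^sub>0 r) \<partial>lborel)"
      using R ext_flux_nonneg cutoff_le_1 by (intro nn_integral_mono) (auto simp: indicator_def intro!: ennreal_leI mult_left_le_one_le cutoff_nonneg)
    finally have "ennreal (?I \<tau>\<^sub>0 + J \<tau>\<^sub>0) \<le> ennreal T"
      using order_trans[OF add_left_mono E] I0[of \<tau>\<^sub>0] J0[of \<tau>\<^sub>0] by (simp add: ennreal_plus)
    then have "?I \<tau>\<^sub>0 + J \<tau>\<^sub>0 \<le> T" using T by simp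
    moreover have "cutoff (real n - (\<tau>\<^sub>0 + tortoise M R)) * ?I \<tau>\<^sub>0 \<le> ?I \<tau>\<^sub>0"
      using I0 cutoff_nonneg cutoff_le_1 by (intro mult_left_le_one_le) auto
    moreover have "cut_energy R L n \<tau> \<le> cut_energy R L n \<tau>\<^sub>0"
      using cut_energy_decreasing[OF R L(1) _ \<tau>] L(2) by auto
    ultimately have le: "cutoff (real n - (\<tau> + tortoise M R)) * ?I \<tau> + J \<tau> \<le> T"
      unfolding cut_energy_def J_def by simp
    have "J \<tau> \<le> T" "cutoff (real n - (\<tau> + tortoise M R)) * ?I \<tau> \<le> T"
      using le J0[of \<tau>] mult_nonneg_nonneg[OF cutoff_nonneg(1) I0, of "real n - (\<tau> + tortoise M R)" \<tau>] by auto
    then show ?thesis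
      using cutoff_nn_integral[OF R L(1) L'] unfolding J_def by (simp add: ennreal_leI)
  qed
  have "(\<lambda>n. cutoff (real n - (\<tau> + tortoise M R)) * ?I \<tau>) \<longlonglongrightarrow> 1 * ?I \<tau>"
    by (intro tendsto_intros cutoff_tendsto_1)
  then show "?I \<tau> \<le> T" using bound by (auto intro!: LIMSEQ_le_const2)
  have "(\<lambda>n. \<integral>\<^sup>+ r\<in>{R..}. ennreal (?q \<tau> n r) \<partial>lborel) \<longlonglongrightarrow> (\<integral>\<^sup>+ r\<in>{R..}. ennreal (ext_flux \<tau> r) \<partial>lborel)"
  proof (rule nn_integral_LIMSEQ)
    show "incseq (\<lambda>n r. ennreal (?q \<tau> n r) * indicator {R..} r)"
      using R by (auto simp: incseq_def le_fun_def indicator_def intro!: ennreal_leI mult_right_mono mono_cutoff ext_flux_nonneg)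
    show "(\<lambda>r. ennreal (?q \<tau> n r) * indicator {R..} r) \<in> borel_measurable lborel" for n
    proof -
      have "(\<lambda>r. indicator {R..} r *\<^sub>R ?q \<tau> n r) \<in> borel_measurable borel"
        using R by (intro borel_measurable_continuous_on_indicator continuous_intros ext_flux_cont) auto
      then have "(\<lambda>r. ennreal (indicator {R..} r *\<^sub>R ?q \<tau> n r)) \<in> borel_measurable lborel" by simp
      moreover have "ennreal (indicator {R..} r *\<^sub>R ?q \<tau> n r) = ennreal (?q \<tau> n r) * indicator {R..} r" for r
        by (simp add: indicator_def)
      ultimately show ?thesis by simp
    qed
    show "(\<lambda>n. ennreal (?q \<tau> n r) * indicator {R..} r) \<longlonglongrightarrow> ennreal (ext_flux \<tau> r) * indicator {R..} r" for r
    proof (cases "r \<in> {R..}")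
      case True
      have "(\<lambda>n. ?q \<tau> n r) \<longlonglongrightarrow> 1 * ext_flux \<tau> r"
        by (intro tendsto_intros cutoff_tendsto_1)
      then show ?thesis using True by (auto intro!: tendsto_ennrealI)
    qed auto
  qed
  then show "(\<integral>\<^sup>+ r\<in>{R..}. ennreal (ext_flux \<tau> r) \<partial>lborel) \<le> ennreal T"
    using bound by (auto intro!: LIMSEQ_le_const2)
qed

text \<open>The density of the N energy on \<Sigma>^i. The \<partial>_v part of N contributes to
  \<open>rad\<close> twice with opposite signs, so \<open>y1\<close> alone keeps the weight of
  \<open>rad\<close> positive at the horizon.\<close>

definition "dens y1 y2 v r = ((1 - 2 * M / r) / 2 + y1 r) * rad v r + (1 / 2 + y2 r) * pot v r"

definition "slice_energy R y1 y2 \<tau> = (\<integral>\<^sup>+ r\<in>{2 * M..<R}. ennreal (dens y1 y2 (\<tau> + tortoise M R) r) \<partial>lborel)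
     + (\<integral>\<^sup>+ r\<in>{R..}. ennreal (ext_flux \<tau> r) \<partial>lborel)"

text \<open>\<open>A\<close> makes the N density equivalent to
  \<open>flux v r + (R - r) * nrg v r\<close>, whose two parts are propagated by
  \<open>horizon_flux_bound\<close> and \<open>red_bound\<close>. In the constant,
  \<open>2 * A + 2 * R\<close> and \<open>A * (4 + 2 * R)\<close> come from the two directions of
  this equivalence, the product with R^2 / M from \<open>red_bound\<close>, and the final 1 from the
  outer piece.\<close>

lemma slice_energy_bound:
  fixes y1 y2 :: "real \<Rightarrow> real"
  assumes R: "R > 2 * M" and A: "A \<ge> 1" and \<tau>: "\<tau>\<^sub>0 \<le> \<tau>"
    and y: "\<And>r. r \<in> {2 * M..<R} \<Longrightarrow> 0 \<le> y1 r \<and> 0 \<le> y2 r \<and> 1 / 2 + y2 r \<le> A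
        \<and> (1 - 2 * M / r) / 2 + y1 r \<le> A * ((1 - 2 * M / r) + (R - r)) \<and> R - r \<le> A * ((1 - 2 * M / r) / 2 + y1 r)"
  shows "slice_energy R y1 y2 \<tau> \<le>
     ennreal (A * (4 + 2 * R) * (1 + (2 * A + 2 * R) + (3 + 12 * R / M) * (2 * R\<^sup>2 / M)) + 1) * slice_energy R y1 y2 \<tau>\<^sub>0"
proof -
  define K where "K = (3 + 12 * R / M) * (2 * R\<^sup>2 / M)"
  define B where "B = A * (4 + 2 * R)"
  define C where "C = 2 * A + 2 * R"
  have R0: "R > 0" using R M_pos by simp
  have pos: "K \<ge> 0" "B \<ge> 0" "C \<ge> 0" using R0 A M_pos by (auto simp: K_def B_def C_def)
  define v where "v \<tau> = \<tau> + tortoise M R" for \<tau>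
  let ?d = "dens y1 y2"
  let ?F = "\<lambda>v. integral {2 * M..R} (flux v)"
  let ?I = "\<lambda>v. \<integral>\<^sup>+ r\<in>{2 * M..<R}. ennreal (?d v r) \<partial>lborel"
  let ?X = "\<lambda>\<tau>. \<integral>\<^sup>+ r\<in>{R..}. ennreal (ext_flux \<tau> r) \<partial>lborel"
  have F0: "?F v \<ge> 0" for v
    by (intro integral_nonneg integrable_continuous_real continuous_intros flux_nonneg) auto
  have N0: "red R v \<ge> 0" for v
    unfolding red_def using averages_nonneg
    by (intro integral_nonneg integrable_continuous_real continuous_intros) auto
  \<comment> \<open>The first two inequalities are applied at \<open>\<tau>\<^sub>0\<close>, the
    third one at \<tau>.\<close>
  have pw: "flux v r \<le> ?d v r" "(R - r) * nrg v r \<le> C * ?d v r" "?d v r \<le> B * (flux v r + (R - r) * nrg v r)"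
    if r: "r \<in> {2 * M..<R}" for v r
  proof -
    have r': "r \<ge> 2 * M" "r > 0" "r < R" using r r_pos by auto
    define D where "D = 1 - 2 * M / r"
    have D: "D \<ge> 0" using r' by (simp add: D_def)
    note yy = y[OF r, folded D_def]
    have a: "rad v r \<ge> 0" "pot v r \<ge> 0" "nrg v r \<ge> 0" using averages_nonneg pot_nonneg[OF r'(1)] by auto
    have m: "2 * msq v r \<le> pot v r" using msq_le_ang[OF r'(1), of v] ang_le_pot[OF r'(1), of v] by simp
    have f: "flux v r = (D * rad v r + pot v r) / 2" using flux_eq[OF r'(1)] by (simp add: D_def)
    have d: "?d v r = (D / 2 + y1 r) * rad v r + (1 / 2 + y2 r) * pot v r" by (simp add: dens_def D_def)
    have yr: "y1 r * rad v r \<ge> 0" "y2 r * pot v r \<ge> 0" using yy a by auto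
    show "flux v r \<le> ?d v r" using yr by (simp add: f d algebra_simps)
    have pd: "pot v r \<le> 2 * ?d v r"
      using yr D a mult_nonneg_nonneg[of D "rad v r"] by (simp add: d algebra_simps)
    have rd: "(D / 2 + y1 r) * rad v r \<le> ?d v r" using yr a by (simp add: d algebra_simps)
    have "(R - r) * nrg v r \<le> (R - r) * (2 * rad v r + pot v r)"
      using nrg_le[OF r'(1), of v] m r' by (intro mult_left_mono) auto
    also have "\<dots> = 2 * ((R - r) * rad v r) + (R - r) * pot v r" by (simp add: algebra_simps)
    also have "\<dots> \<le> 2 * (A * (D / 2 + y1 r) * rad v r) + R * pot v r"
      using yy a r' by (intro add_mono mult_left_mono mult_right_mono) auto
    also have "\<dots> \<le> 2 * (A * ?d v r) + R * (2 * ?d v r)"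
    proof -
      have "A * ((D / 2 + y1 r) * rad v r) \<le> A * ?d v r" using rd A by (intro mult_left_mono) auto
      moreover have "R * pot v r \<le> R * (2 * ?d v r)" using pd R0 by (intro mult_left_mono) auto
      ultimately show ?thesis by (simp add: mult.assoc)
    qed
    finally show "(R - r) * nrg v r \<le> C * ?d v r" by (simp add: C_def algebra_simps)
    have aux: "x \<le> p + q \<Longrightarrow> F = (a + b) / 2 \<Longrightarrow> a + x + b \<le> 2 * F + p + q" for x p q F a b :: real
      by simp
    have "?d v r \<le> A * (D + (R - r)) * rad v r + A * pot v r"
      unfolding d using yy a by (intro add_mono mult_right_mono) auto
    also have "\<dots> = A * (D * rad v r + (R - r) * rad v r + pot v r)" by (simp add: algebra_simps)
    also have "\<dots> \<le> A * ((4 + 2 * R) * (flux v r + (R - r) * nrg v r))"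
    proof (rule mult_left_mono)
      have "(R - r) * rad v r \<le> (R - r) * (2 * nrg v r + pot v r)"
        using rad_le[OF r'(1), of v] m r' by (intro mult_left_mono) auto
      also have "\<dots> \<le> 2 * ((R - r) * nrg v r) + R * pot v r"
        using a r' by (simp add: algebra_simps)
      finally have "D * rad v r + (R - r) * rad v r + pot v r \<le> 2 * flux v r + 2 * ((R - r) * nrg v r) + R * pot v r"
        using f aux by blast
      moreover have "R * pot v r \<le> R * (2 * flux v r)"
        using flux_ge_pot[OF r'(1), of v] R0 by (intro mult_left_mono) auto
      moreover have "0 \<le> (2 + 2 * R) * ((R - r) * nrg v r)" "0 \<le> flux v r"
        using R0 r' a flux_nonneg[OF r'(1)] by auto
      ultimately show "D * rad v r + (R - r) * rad v r + pot v r \<le> (4 + 2 * R) * (flux v r + (R - r) * nrg v r)"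
        by (simp add: algebra_simps)
    qed (use A in auto)
    finally show "?d v r \<le> B * (flux v r + (R - r) * nrg v r)" by (simp add: B_def mult.assoc)
  qed
  have FI: "ennreal (?F v) \<le> ?I v" for v
  proof -
    have "ennreal (?F v) = (\<integral>\<^sup>+ r\<in>{2 * M..<R}. ennreal (flux v r) \<partial>lborel)"
      using R by (intro nn_integral_half_open[symmetric] continuous_intros flux_nonneg) auto
    also have "\<dots> \<le> ?I v" using pw(1) by (intro nn_integral_mono) (auto simp: indicator_def intro!: ennreal_leI)
    finally show ?thesis .
  qed
  show ?thesis
  proof (cases "slice_energy R y1 y2 \<tau>\<^sub>0")
    case (real T)
    have "ennreal (?F (v \<tau>\<^sub>0)) + ?X \<tau>\<^sub>0 \<le> slice_energy R y1 y2 \<tau>\<^sub>0"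
      unfolding slice_energy_def v_def using FI by (intro add_mono) auto
    then have T: "ennreal (?F (v \<tau>\<^sub>0)) + ?X \<tau>\<^sub>0 \<le> ennreal T" using real by simp
    have IT: "?I (v \<tau>\<^sub>0) \<le> ennreal T"
    proof -
      have "?I (v \<tau>\<^sub>0) \<le> slice_energy R y1 y2 \<tau>\<^sub>0"
        unfolding slice_energy_def v_def by (rule add_increasing2) auto
      then show ?thesis using real by simp
    qed
    have FT: "?F (v t) \<le> T" if "\<tau>\<^sub>0 \<le> t" for t
      using horizon_flux_bound(1)[OF R that real(1)] T unfolding v_def by blast
    have XT: "?X \<tau> \<le> ennreal T"
      using horizon_flux_bound(2)[OF R \<tau> real(1)] T unfolding v_def by blast
    have "C > 0" using A R0 by (simp add: C_def)
    have "ennreal (red R (v \<tau>\<^sub>0) / C) = ennreal (integral {2 * M..R} (\<lambda>r. (R - r) * nrg (v \<tau>\<^sub>0) r / C))"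
      unfolding red_def by simp
    also have "\<dots> = (\<integral>\<^sup>+ r\<in>{2 * M..<R}. ennreal ((R - r) * nrg (v \<tau>\<^sub>0) r / C) \<partial>lborel)"
      using R averages_nonneg pos \<open>C > 0\<close>
      by (intro nn_integral_half_open[symmetric] continuous_intros) auto
    also have "\<dots> \<le> ?I (v \<tau>\<^sub>0)"
      using pw(2) \<open>C > 0\<close>
      by (intro nn_integral_mono) (auto simp: indicator_def pos_divide_le_eq mult.commute intro!: ennreal_leI)
    also have "\<dots> \<le> ennreal T" by (rule IT)
    finally have "red R (v \<tau>\<^sub>0) \<le> C * T" using \<open>C > 0\<close> real(1) by (simp add: pos_divide_le_eq mult.commute)
    moreover have "red R (v \<tau>) \<le> red R (v \<tau>\<^sub>0) + K * T"
      unfolding K_def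
    proof (rule red_bound[OF R _ _ real(1)])
      show "v \<tau>\<^sub>0 \<le> v \<tau>" using \<tau> by (simp add: v_def)
      fix x assume "v \<tau>\<^sub>0 \<le> x"
      then show "?F x \<le> T" using FT[of "x - tortoise M R"] by (simp add: v_def)
    qed
    ultimately have N: "red R (v \<tau>) \<le> C * T + K * T" by simp
    have "?I (v \<tau>) \<le> (\<integral>\<^sup>+ r\<in>{2 * M..<R}. ennreal (B * (flux (v \<tau>) r + (R - r) * nrg (v \<tau>) r)) \<partial>lborel)"
      using pw(3) by (intro nn_integral_mono) (auto simp: indicator_def intro!: ennreal_leI)
    also have "\<dots> = ennreal (integral {2 * M..R} (\<lambda>r. B * (flux (v \<tau>) r + (R - r) * nrg (v \<tau>) r)))"
      using R averages_nonneg pos by (intro nn_integral_half_open continuous_intros mult_nonneg_nonneg add_nonneg_nonneg flux_nonneg) auto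
    also have "integral {2 * M..R} (\<lambda>r. B * (flux (v \<tau>) r + (R - r) * nrg (v \<tau>) r)) = B * (?F (v \<tau>) + red R (v \<tau>))"
      unfolding red_def
      by (subst integral_mult_right, subst integral_add)
         (auto intro!: integrable_continuous_real continuous_intros)
    also have "\<dots> \<le> B * (T + (C * T + K * T))"
      using FT[OF \<tau>] N pos by (intro mult_left_mono add_mono) auto
    finally have "?I (v \<tau>) \<le> ennreal (B * (T + (C * T + K * T)))" by (simp add: ennreal_leI)
    then have "slice_energy R y1 y2 \<tau> \<le> ennreal (B * (T + (C * T + K * T))) + ennreal T"
      unfolding slice_energy_def v_def using XT by (intro add_mono) auto
    also have "\<dots> = ennreal (B * (1 + C + K) + 1) * ennreal T"
      using pos real(1) by (simp add: ennreal_mult[symmetric] ennreal_plus[symmetric] algebra_simps del: ennreal_plus)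
    finally show ?thesis using real by (simp add: B_def C_def K_def)
  next
    \<comment> \<open>Infinite initial energy: the right side is infinite because the factor is
      positive.\<close>
    case top
    have "B * (1 + C + K) + 1 > 0" using pos by (simp add: add_nonneg_pos)
    then show ?thesis using top by (simp add: B_def C_def K_def ennreal_mult_top)
  qed
qed

end

section \<open>The equation and the energy in coordinates\<close>

text \<open>\<open>matrix_inv\<close> is defined by choice; uniqueness of a two-sided inverse
  identifies it.\<close>

lemma matrix_inv_eqI:
  fixes A B :: "real^'n^'n"
  assumes "A ** B = mat 1" "B ** A = mat 1"
  shows "matrix_inv A = B"
proof -
  have "A ** matrix_inv A = mat 1 \<and> matrix_inv A ** A = mat 1"
    unfolding matrix_inv_def
    by (rule someI2[where a=B and Q="\<lambda>C. A ** C = mat 1 \<and> C ** A = mat 1"]) (use assms in auto)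
  then show ?thesis by (metis assms(1) matrix_mul_assoc matrix_mul_lid matrix_mul_rid)
qed

definition schwarzschild_inv :: "real \<Rightarrow> real^4 \<Rightarrow> real^4^4" where
  "schwarzschild_inv M q = (\<chi> i j.
     if i = 2 \<and> j = 2 then 1 - mu M (q $ 2)
     else if (i = 1 \<and> j = 2) \<or> (i = 2 \<and> j = 1) then 1
     else if i = 3 \<and> j = 3 then 1 / (q $ 2)\<^sup>2
     else if i = 4 \<and> j = 4 then 1 / ((q $ 2)\<^sup>2 * (sin (q $ 3))\<^sup>2)
     else 0)"

lemma matrix_inv_schwarzschild:
  assumes "q $ 2 \<noteq> 0" "sin (q $ 3) \<noteq> 0"
  shows "matrix_inv (schwarzschild M q) = schwarzschild_inv M q"
  by (rule matrix_inv_eqI)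
     (use assms in \<open>auto simp: matrix_matrix_mult_def sum_4 vec_eq_iff forall_4 mat_def schwarzschild_def schwarzschild_inv_def\<close>)

text \<open>The metric has a \<open>dr dv\<close> term instead of \<open>dr^2\<close>; exchanging
  the first two rows makes the matrix lower triangular.\<close>

lemma det_schwarzschild: "\<bar>det (schwarzschild M q)\<bar> = ((q $ 2)\<^sup>2 * sin (q $ 3))\<^sup>2"
proof -
  let ?p = "Transposition.transpose (1::4) 2"
  let ?B = "\<chi> i. schwarzschild M q $ ?p i"
  have "det ?B = of_int (sign ?p) * det (schwarzschild M q)"
    by (rule det_permute_rows) (simp add: permutes_swap_id)
  then have "\<bar>det (schwarzschild M q)\<bar> = \<bar>det ?B\<bar>"
    by (simp add: sign_swap_id)
  also have "det ?B = (\<Prod>i\<in>UNIV. ?B $ i $ i)"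
  proof (rule det_lowerdiagonal)
    fix i j :: 4 assume "i < j"
    \<comment> \<open>In this index type \<open>4\<close> equals \<open>0\<close>, so the order is
      not the naive one. The only off-diagonal entry left is in row 2 and column 1, so
      \<open>1 < 2\<close> is all that matters.\<close>
    have "(1::4) < 2" by (simp add: less_bit0_def bit0.Rep_1 bit0.Rep_numeral)
    with \<open>i < j\<close> show "?B $ i $ j = 0"
      by (auto simp: schwarzschild_def Transposition.transpose_def split: if_splits)
  qed
  also have "\<dots> = ((q $ 2)\<^sup>2 * sin (q $ 3))\<^sup>2"
    unfolding UNIV_4 by (simp add: schwarzschild_def Transposition.transpose_def) (simp add: power_mult_distrib)
  finally show ?thesis by simp
qed

text \<open>\<open>coord_deriv\<close> is read off the total derivative, so a partial derivative
  determines it only for a differentiable function; this is what the differentiability lemmas below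
  are for.\<close>

lemma coord_deriv_eqI:
  assumes "G differentiable (at q)" "((\<lambda>t. G (q + t *\<^sub>R axis \<alpha> 1)) has_real_derivative d) (at 0)"
  shows "coord_deriv \<alpha> G q = d"
proof -
  have "(G has_derivative frechet_derivative G (at q)) (at (q + 0 *\<^sub>R axis \<alpha> 1))"
    using assms(1) by (simp add: frechet_derivative_works[symmetric])
  from has_vector_derivative_along_curve[where \<gamma>="\<lambda>t. q + t *\<^sub>R axis \<alpha> 1", OF this has_vector_derivative_line]
  have "((\<lambda>t. G (q + t *\<^sub>R axis \<alpha> 1)) has_real_derivative coord_deriv \<alpha> G q) (at 0)"
    by (simp add: has_real_derivative_iff_has_vector_derivative coord_deriv_def)
  then show ?thesis using assms(2) DERIV_unique by blast
qed

lemma DERIV_shift_0: "(F has_real_derivative d) (at a) \<Longrightarrow> ((\<lambda>t. F (a + t)) has_real_derivative d) (at 0)"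
  by (rule DERIV_cong[OF DERIV_chain2[where f=F and g="\<lambda>t. a + t" and Da=d]]) (auto intro!: derivative_eq_intros)

lemma coord_deriv_4:
  fixes Y :: "real \<Rightarrow> real \<Rightarrow> real \<Rightarrow> real \<Rightarrow> real" and q :: "real^4"
  assumes "(\<lambda>q. Y (q $ 1) (q $ 2) (q $ 3) (q $ 4)) differentiable (at q)" (is "?G differentiable _")
  shows "((\<lambda>s. Y s (q $ 2) (q $ 3) (q $ 4)) has_real_derivative d) (at (q $ 1)) \<Longrightarrow> coord_deriv 1 ?G q = d"
    "((\<lambda>s. Y (q $ 1) s (q $ 3) (q $ 4)) has_real_derivative d) (at (q $ 2)) \<Longrightarrow> coord_deriv 2 ?G q = d"
    "((\<lambda>s. Y (q $ 1) (q $ 2) s (q $ 4)) has_real_derivative d) (at (q $ 3)) \<Longrightarrow> coord_deriv 3 ?G q = d"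
    "((\<lambda>s. Y (q $ 1) (q $ 2) (q $ 3) s) has_real_derivative d) (at (q $ 4)) \<Longrightarrow> coord_deriv 4 ?G q = d"
  by (rule coord_deriv_eqI[OF assms], drule DERIV_shift_0, simp add: axis_def)+

lemma coord_deriv_2:
  fixes Y :: "real \<Rightarrow> real \<Rightarrow> real"
  assumes "(\<lambda>q::real^2. Y (q $ 1) (q $ 2)) differentiable (at q)" (is "?G differentiable _")
  shows "((\<lambda>s. Y s (q $ 2)) has_real_derivative d) (at (q $ 1)) \<Longrightarrow> coord_deriv 1 ?G q = d"
    "((\<lambda>s. Y (q $ 1) s) has_real_derivative d) (at (q $ 2)) \<Longrightarrow> coord_deriv 2 ?G q = d"
  by (rule coord_deriv_eqI[OF assms], drule DERIV_shift_0, simp add: axis_def)+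

text \<open>The closed formulas for the components under the divergence hold only where sin \<theta>
  is nonzero, so functions are compared on an open neighbourhood.\<close>

lemma coord_deriv_cong:
  assumes "open N" "q \<in> N" "\<And>p. p \<in> N \<Longrightarrow> F p = G p" "G differentiable (at q)"
  shows "coord_deriv \<alpha> F q = coord_deriv \<alpha> G q"
  unfolding coord_deriv_def
  using frechet_derivative_transform_within_open[OF assms(4,1,2), of F] assms(3) by metis

lemma differentiable_sin_cos:
  fixes \<theta> :: "'a::real_normed_vector \<Rightarrow> real"
  assumes "\<theta> differentiable (at q)"
  shows "(\<lambda>q. sin (\<theta> q)) differentiable (at q)" "(\<lambda>q. cos (\<theta> q)) differentiable (at q)"
  using assms unfolding differentiable_def by (blast intro: has_derivative_sin has_derivative_cos)+

lemma differentiable_frame: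
  fixes \<theta> \<phi> :: "'a::real_normed_vector \<Rightarrow> real"
  assumes "\<theta> differentiable (at q)" "\<phi> differentiable (at q)"
  shows "(\<lambda>q. radial (\<theta> q, \<phi> q)) differentiable (at q)" "(\<lambda>q. lat (\<theta> q, \<phi> q)) differentiable (at q)"
    "(\<lambda>q. lon (\<theta> q, \<phi> q)) differentiable (at q)"
  unfolding radial_def lat_def lon_def fst_conv snd_conv
  by (intro differentiable_add differentiable_scaleR differentiable_mult differentiable_minus
      differentiable_const differentiable_sin_cos assms)+

lemma differentiable_inner':
  "f differentiable (at q) \<Longrightarrow> g differentiable (at q) \<Longrightarrow> (\<lambda>x. f x \<bullet> g x) differentiable (at q)"
  unfolding differentiable_def using has_derivative_inner by blast

lemma differentiable_Pair':
  "f differentiable (at q) \<Longrightarrow> g differentiable (at q) \<Longrightarrow> (\<lambda>x. (f x, g x)) differentiable (at q)"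
  unfolding differentiable_def using has_derivative_Pair by blast

lemma differentiable_vec_nth: "(\<lambda>q. q $ i) differentiable F"
  using bounded_linear_imp_differentiable bounded_linear_vec_nth by blast

section \<open>Coordinate derivatives and the d'Alembertian in the chart\<close>

context smooth_exterior
begin

lemma pos_differentiable:
  assumes "a differentiable (at q)" "b differentiable (at q)" "\<theta> differentiable (at q)" "\<phi> differentiable (at q)"
  shows "(\<lambda>q. pos (a q) (b q) (\<theta> q, \<phi> q)) differentiable (at q)"
  unfolding pos_def using assms
  by (intro differentiable_Pair' differentiable_scaleR differentiable_frame)

lemma fields_differentiable:
  assumes "a differentiable (at q)" "b differentiable (at q)" "\<theta> differentiable (at q)" "\<phi> differentiable (at q)"
    and "pos (a q) (b q) (\<theta> q, \<phi> q) \<in> U"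
  shows "(\<lambda>q. u (a q) (b q) (\<theta> q, \<phi> q)) differentiable (at q)"
    "(\<lambda>q. u_v (a q) (b q) (\<theta> q, \<phi> q)) differentiable (at q)"
    "(\<lambda>q. u_r (a q) (b q) (\<theta> q, \<phi> q)) differentiable (at q)"
    "(\<lambda>q. u_t (a q) (b q) (\<theta> q, \<phi> q)) differentiable (at q)"
    "(\<lambda>q. u_w (a q) (b q) (\<theta> q, \<phi> q)) differentiable (at q)"
proof -
  have f: "(\<lambda>q. f (pos (a q) (b q) (\<theta> q, \<phi> q))) differentiable (at q)"
    using differentiable_chain_at[OF pos_differentiable[OF assms(1-4)], of f] f_deriv[OF assms(5)]
    by (auto simp: o_def differentiable_def)
  have g: "(\<lambda>q. gr (pos (a q) (b q) (\<theta> q, \<phi> q))) differentiable (at q)"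
    using differentiable_chain_at[OF pos_differentiable[OF assms(1-4)], of gr] gr_deriv[OF assms(5)]
    by (auto simp: o_def differentiable_def)
  show "(\<lambda>q. u (a q) (b q) (\<theta> q, \<phi> q)) differentiable (at q)"
    "(\<lambda>q. u_v (a q) (b q) (\<theta> q, \<phi> q)) differentiable (at q)"
    "(\<lambda>q. u_r (a q) (b q) (\<theta> q, \<phi> q)) differentiable (at q)"
    "(\<lambda>q. u_t (a q) (b q) (\<theta> q, \<phi> q)) differentiable (at q)"
    "(\<lambda>q. u_w (a q) (b q) (\<theta> q, \<phi> q)) differentiable (at q)"
    unfolding u_defs using f g differentiable_frame[OF assms(3,4)] assms(2)
    by (auto intro!: differentiable_inner' differentiable_Pair' differentiable_scaleR)
qed

lemma chart_point_eq: "chart_point q = pos (q $ 1) (q $ 2) (q $ 3, q $ 4)"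
  by (simp add: chart_point_def pos_def sphere_point_radial)

lemmas chart_differentiable = fields_differentiable[OF differentiable_vec_nth differentiable_vec_nth differentiable_vec_nth differentiable_vec_nth]

lemma coord_deriv_chart:
  assumes "chart_point q \<in> U"
  shows "coord_deriv 1 (f \<circ> chart_point) q = u_v (q $ 1) (q $ 2) (q $ 3, q $ 4)"
    "coord_deriv 2 (f \<circ> chart_point) q = u_r (q $ 1) (q $ 2) (q $ 3, q $ 4)"
    "coord_deriv 3 (f \<circ> chart_point) q = u_t (q $ 1) (q $ 2) (q $ 3, q $ 4)"
    "coord_deriv 4 (f \<circ> chart_point) q = sin (q $ 3) * u_w (q $ 1) (q $ 2) (q $ 3, q $ 4)"
proof -
  have e: "f \<circ> chart_point = (\<lambda>q. u (q $ 1) (q $ 2) (q $ 3, q $ 4))"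
    by (auto simp: chart_point_eq u_def)
  have inU: "pos (q $ 1) (q $ 2) (q $ 3, q $ 4) \<in> U" using assms by (simp add: chart_point_eq)
  note d = coord_deriv_4[where Y="\<lambda>a b c d. u a b (c, d)", OF chart_differentiable(1)[OF inU]]
  show "coord_deriv 1 (f \<circ> chart_point) q = u_v (q $ 1) (q $ 2) (q $ 3, q $ 4)"
    unfolding e by (intro d derivatives_v inU)
  show "coord_deriv 2 (f \<circ> chart_point) q = u_r (q $ 1) (q $ 2) (q $ 3, q $ 4)"
    unfolding e by (intro d derivatives_r inU)
  show "coord_deriv 3 (f \<circ> chart_point) q = u_t (q $ 1) (q $ 2) (q $ 3, q $ 4)"
    unfolding e by (intro d derivatives_t inU)
  show "coord_deriv 4 (f \<circ> chart_point) q = sin (q $ 3) * u_w (q $ 1) (q $ 2) (q $ 3, q $ 4)"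
    unfolding e by (intro d derivatives_p inU)
qed

text \<open>Multiplication by the volume factor r^2 sin \<theta> leaves the bare divergence. In its
  \<phi> component this factor and the sin \<theta> of \<open>coord_deriv 4\<close> cancel the 1 /
  (r^2 sin^2 \<theta>) of the inverse metric, and \<open>u_w\<close> remains.\<close>

lemma laplace_chart:
  assumes q: "q $ 2 \<ge> 2 * M" "0 < q $ 3" "q $ 3 < pi"
  shows "laplace_beltrami (schwarzschild M) (f \<circ> chart_point) q * ((q $ 2)\<^sup>2 * sin (q $ 3)) =
     sin (q $ 3) * (2 * (q $ 2)\<^sup>2 * u_vr (q $ 1) (q $ 2) (q $ 3, q $ 4) + 2 * (q $ 2) * u_v (q $ 1) (q $ 2) (q $ 3, q $ 4)
      + (2 * (q $ 2) - 2 * M) * u_r (q $ 1) (q $ 2) (q $ 3, q $ 4)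
        + (q $ 2) * (q $ 2 - 2 * M) * u_rr (q $ 1) (q $ 2) (q $ 3, q $ 4))
      + (cos (q $ 3) * u_t (q $ 1) (q $ 2) (q $ 3, q $ 4) + sin (q $ 3) * u_tt (q $ 1) (q $ 2) (q $ 3, q $ 4)
        + w_p (q $ 1) (q $ 2) (q $ 3, q $ 4))"
proof -
  define N where "N = {p. chart_point p \<in> U \<and> 0 < p $ 2 \<and> 0 < p $ 3 \<and> p $ 3 < pi}"
  have "continuous_on UNIV chart_point"
    unfolding chart_point_def sphere_point_radial by (intro continuous_intros)
  then have "open (chart_point -` U)" using U_open by (simp add: open_vimage)
  moreover have "open {p::real^4. 0 < p $ 2}" "open {p::real^4. 0 < p $ 3}" "open {p::real^4. p $ 3 < pi}"
    by (intro open_Collect_less continuous_intros)+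
  moreover have "N = chart_point -` U \<inter> {p. 0 < p $ 2} \<inter> {p. 0 < p $ 3} \<inter> {p. p $ 3 < pi}"
    by (auto simp: N_def)
  ultimately have N_open: "open N" by (simp add: open_Int)
  have inU: "pos (q $ 1) (q $ 2) (q $ 3, q $ 4) \<in> U" using q by simp
  have qN: "q \<in> N" using q inU M_pos by (auto simp: N_def chart_point_eq)
  define F where "F \<alpha> p = sqrt \<bar>det (schwarzschild M p)\<bar> *
      (\<Sum>\<beta>\<in>UNIV. matrix_inv (schwarzschild M p) $ \<alpha> $ \<beta> * coord_deriv \<beta> (f \<circ> chart_point) p)" for \<alpha> p
  have F: "F 1 p = (p $ 2)\<^sup>2 * sin (p $ 3) * u_r (p $ 1) (p $ 2) (p $ 3, p $ 4)"
     "F 2 p = (p $ 2)\<^sup>2 * sin (p $ 3) * (u_v (p $ 1) (p $ 2) (p $ 3, p $ 4) + (1 - 2 * M / p $ 2) * u_r (p $ 1) (p $ 2) (p $ 3, p $ 4))"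
     "F 3 p = sin (p $ 3) * u_t (p $ 1) (p $ 2) (p $ 3, p $ 4)"
     "F 4 p = u_w (p $ 1) (p $ 2) (p $ 3, p $ 4)" if "p \<in> N" for p
  proof -
    have p: "p $ 2 > 0" "sin (p $ 3) > 0" "chart_point p \<in> U" using that by (auto simp: N_def sin_gt_zero)
    have s: "sqrt \<bar>det (schwarzschild M p)\<bar> = (p $ 2)\<^sup>2 * sin (p $ 3)"
      unfolding det_schwarzschild using p by simp
    show "F 1 p = (p $ 2)\<^sup>2 * sin (p $ 3) * u_r (p $ 1) (p $ 2) (p $ 3, p $ 4)"
     "F 2 p = (p $ 2)\<^sup>2 * sin (p $ 3) * (u_v (p $ 1) (p $ 2) (p $ 3, p $ 4) + (1 - 2 * M / p $ 2) * u_r (p $ 1) (p $ 2) (p $ 3, p $ 4))"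
     "F 3 p = sin (p $ 3) * u_t (p $ 1) (p $ 2) (p $ 3, p $ 4)"
     "F 4 p = u_w (p $ 1) (p $ 2) (p $ 3, p $ 4)"
      unfolding F_def s using p
      by (simp_all add: matrix_inv_schwarzschild sum_4 coord_deriv_chart schwarzschild_inv_def mu_def field_simps power2_eq_square)
  qed
  have sin_dif: "(\<lambda>p::real^4. sin (p $ 3)) differentiable at q"
    by (intro differentiable_sin_cos differentiable_vec_nth)
  have q2: "q $ 2 \<noteq> 0" using q M_pos by auto
  note cd = chart_differentiable[OF inU]
  note r_dif = differentiable_mult[OF differentiable_power[OF differentiable_vec_nth, where n=2] sin_dif]
  note dif1 = differentiable_mult[OF r_dif cd(3)]
  have D_dif: "(\<lambda>p::real^4. 1 - 2 * M / p $ 2) differentiable at q"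
    by (rule differentiable_diff[OF differentiable_const differentiable_divide[OF differentiable_const differentiable_vec_nth q2]])
  note dif2 = differentiable_mult[OF r_dif differentiable_add[OF cd(2) differentiable_mult[OF D_dif cd(3)]]]
  note dif3 = differentiable_mult[OF sin_dif cd(4)]
  have "coord_deriv 1 (F 1) q = coord_deriv 1 (\<lambda>p. (p $ 2)\<^sup>2 * sin (p $ 3) * u_r (p $ 1) (p $ 2) (p $ 3, p $ 4)) q"
    by (rule coord_deriv_cong[OF N_open qN F(1) dif1])
  also have "\<dots> = (q $ 2)\<^sup>2 * sin (q $ 3) * u_vr (q $ 1) (q $ 2) (q $ 3, q $ 4)"
    by (rule coord_deriv_4(1)[where Y="\<lambda>a b c d. b\<^sup>2 * sin c * u_r a b (c, d)"])
       (rule dif1 DERIV_cmult derivatives_v inU)+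
  finally have 1: "coord_deriv 1 (F 1) q = (q $ 2)\<^sup>2 * sin (q $ 3) * u_vr (q $ 1) (q $ 2) (q $ 3, q $ 4)" .
  have "coord_deriv 2 (F 2) q = coord_deriv 2 (\<lambda>p. (p $ 2)\<^sup>2 * sin (p $ 3) * (u_v (p $ 1) (p $ 2) (p $ 3, p $ 4) + (1 - 2 * M / p $ 2) * u_r (p $ 1) (p $ 2) (p $ 3, p $ 4))) q"
    by (rule coord_deriv_cong[OF N_open qN F(2) dif2])
  also have "\<dots> = sin (q $ 3) * (2 * (q $ 2) * (u_v (q $ 1) (q $ 2) (q $ 3, q $ 4) + (1 - 2 * M / q $ 2) * u_r (q $ 1) (q $ 2) (q $ 3, q $ 4))
     + (q $ 2)\<^sup>2 * (u_vr (q $ 1) (q $ 2) (q $ 3, q $ 4) + 2 * M / (q $ 2)\<^sup>2 * u_r (q $ 1) (q $ 2) (q $ 3, q $ 4) + (1 - 2 * M / q $ 2) * u_rr (q $ 1) (q $ 2) (q $ 3, q $ 4)))"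
  proof (rule coord_deriv_4(2)[where Y="\<lambda>a b c d. b\<^sup>2 * sin c * (u_v a b (c, d) + (1 - 2 * M / b) * u_r a b (c, d))"])
    have "((\<lambda>b. b\<^sup>2 * sin (q $ 3)) has_real_derivative 2 * (q $ 2) * sin (q $ 3)) (at (q $ 2))"
      "((\<lambda>b. 1 - 2 * M / b) has_real_derivative 2 * M / (q $ 2)\<^sup>2) (at (q $ 2))"
      using q2 by (auto intro!: derivative_eq_intros simp: power2_eq_square)
    from DERIV_mult[OF this(1) DERIV_add[OF derivatives_r(2)[OF inU] DERIV_mult[OF this(2) derivatives_r(3)[OF inU]]]]
    show "((\<lambda>b. b\<^sup>2 * sin (q $ 3) * (u_v (q $ 1) b (q $ 3, q $ 4) + (1 - 2 * M / b) * u_r (q $ 1) b (q $ 3, q $ 4)))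
      has_real_derivative
      sin (q $ 3) * (2 * (q $ 2) * (u_v (q $ 1) (q $ 2) (q $ 3, q $ 4) + (1 - 2 * M / q $ 2) * u_r (q $ 1) (q $ 2) (q $ 3, q $ 4))
     + (q $ 2)\<^sup>2 * (u_vr (q $ 1) (q $ 2) (q $ 3, q $ 4) + 2 * M / (q $ 2)\<^sup>2 * u_r (q $ 1) (q $ 2) (q $ 3, q $ 4) + (1 - 2 * M / q $ 2) * u_rr (q $ 1) (q $ 2) (q $ 3, q $ 4)))) (at (q $ 2))"
      by (rule DERIV_cong) (simp only: algebra_simps)
  qed (rule dif2)
  finally have 2: "coord_deriv 2 (F 2) q = sin (q $ 3) * (2 * (q $ 2) * (u_v (q $ 1) (q $ 2) (q $ 3, q $ 4) + (1 - 2 * M / q $ 2) * u_r (q $ 1) (q $ 2) (q $ 3, q $ 4))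
     + (q $ 2)\<^sup>2 * (u_vr (q $ 1) (q $ 2) (q $ 3, q $ 4) + 2 * M / (q $ 2)\<^sup>2 * u_r (q $ 1) (q $ 2) (q $ 3, q $ 4) + (1 - 2 * M / q $ 2) * u_rr (q $ 1) (q $ 2) (q $ 3, q $ 4)))" .
  have "coord_deriv 3 (F 3) q = coord_deriv 3 (\<lambda>p. sin (p $ 3) * u_t (p $ 1) (p $ 2) (p $ 3, p $ 4)) q"
    by (rule coord_deriv_cong[OF N_open qN F(3) dif3])
  also have "\<dots> = cos (q $ 3) * u_t (q $ 1) (q $ 2) (q $ 3, q $ 4) + sin (q $ 3) * u_tt (q $ 1) (q $ 2) (q $ 3, q $ 4)"
    by (rule coord_deriv_4(3)[where Y="\<lambda>a b c d. sin c * u_t a b (c, d)"], rule dif3)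
       (auto intro!: derivative_eq_intros derivatives_t inU)
  finally have 3: "coord_deriv 3 (F 3) q = cos (q $ 3) * u_t (q $ 1) (q $ 2) (q $ 3, q $ 4) + sin (q $ 3) * u_tt (q $ 1) (q $ 2) (q $ 3, q $ 4)" .
  have "coord_deriv 4 (F 4) q = coord_deriv 4 (\<lambda>p. u_w (p $ 1) (p $ 2) (p $ 3, p $ 4)) q"
    by (rule coord_deriv_cong[OF N_open qN F(4) cd(5)])
  also have "\<dots> = w_p (q $ 1) (q $ 2) (q $ 3, q $ 4)"
    by (rule coord_deriv_4(4)[where Y="\<lambda>a b c d. u_w a b (c, d)"])
       (rule cd(5) derivatives_p inU)+
  finally have 4: "coord_deriv 4 (F 4) q = w_p (q $ 1) (q $ 2) (q $ 3, q $ 4)" .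
  have s: "sin (q $ 3) > 0" using q by (simp add: sin_gt_zero)
  have "laplace_beltrami (schwarzschild M) (f \<circ> chart_point) q = (\<Sum>\<alpha>\<in>UNIV. coord_deriv \<alpha> (F \<alpha>) q) / ((q $ 2)\<^sup>2 * sin (q $ 3))"
    unfolding laplace_beltrami_def F_def[abs_def] det_schwarzschild using s by simp
  then have s1: "laplace_beltrami (schwarzschild M) (f \<circ> chart_point) q * ((q $ 2)\<^sup>2 * sin (q $ 3)) = (\<Sum>\<alpha>\<in>UNIV. coord_deriv \<alpha> (F \<alpha>) q)"
    using s q2 by simp
  have s2: "(\<Sum>\<alpha>\<in>UNIV. coord_deriv \<alpha> (F \<alpha>) q) =
      (q $ 2)\<^sup>2 * sin (q $ 3) * u_vr (q $ 1) (q $ 2) (q $ 3, q $ 4)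
      + sin (q $ 3) * (2 * (q $ 2) * (u_v (q $ 1) (q $ 2) (q $ 3, q $ 4) + (1 - 2 * M / q $ 2) * u_r (q $ 1) (q $ 2) (q $ 3, q $ 4))
        + (q $ 2)\<^sup>2 * (u_vr (q $ 1) (q $ 2) (q $ 3, q $ 4) + 2 * M / (q $ 2)\<^sup>2 * u_r (q $ 1) (q $ 2) (q $ 3, q $ 4) + (1 - 2 * M / q $ 2) * u_rr (q $ 1) (q $ 2) (q $ 3, q $ 4)))
      + (cos (q $ 3) * u_t (q $ 1) (q $ 2) (q $ 3, q $ 4) + sin (q $ 3) * u_tt (q $ 1) (q $ 2) (q $ 3, q $ 4)) + w_p (q $ 1) (q $ 2) (q $ 3, q $ 4)"
    by (simp only: sum_4 1 2 3 4)
  have s3: "R\<^sup>2 * S * a + S * (2 * R * (b + (1 - 2 * M / R) * c) + R\<^sup>2 * (a + 2 * M / R\<^sup>2 * c + (1 - 2 * M / R) * d)) + l + w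
      = S * (2 * R\<^sup>2 * a + 2 * R * b + (2 * R - 2 * M) * c + R * (R - 2 * M) * d) + (l + w)"
    if "R \<noteq> 0" for R S a b c d l w :: real
    using that by (simp add: field_simps power2_eq_square)
  show ?thesis
    unfolding s1 s2 by (rule s3[OF q2])
qed

end

section \<open>The Poincare inequality on modes \<open>l \<ge> 2\<close>\<close>

text \<open>Gradients are given by \<open>g_t = \<partial>\<^sub>\<theta> g\<close> and \<open>g_w = (\<partial>\<^sub>\<phi> g) / sin \<theta>\<close>; \<open>eigen\<close> is the weak form of
  the eigenvalue equation.\<close>

definition sphere_fun :: "(real \<times> real \<Rightarrow> real) \<Rightarrow> (real \<times> real \<Rightarrow> real) \<Rightarrow> (real \<times> real \<Rightarrow> real) \<Rightarrow> bool" where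
  "sphere_fun g g_t g_w \<longleftrightarrow> continuous_on UNIV g \<and> continuous_on UNIV g_t \<and> continuous_on UNIV g_w
     \<and> (\<forall>\<theta> \<phi>. ((\<lambda>\<theta>. g (\<theta>, \<phi>)) has_real_derivative g_t (\<theta>, \<phi>)) (at \<theta>))
     \<and> (\<forall>\<theta> \<phi>. ((\<lambda>\<phi>. g (\<theta>, \<phi>)) has_real_derivative sin \<theta> * g_w (\<theta>, \<phi>)) (at \<phi>))
     \<and> (\<forall>\<theta>. g (\<theta>, 2 * pi) = g (\<theta>, 0))"

definition ip :: "(real \<times> real \<Rightarrow> real) \<Rightarrow> (real \<times> real \<Rightarrow> real) \<Rightarrow> real" where
  "ip a b = integral sbox (\<lambda>p. sin (fst p) * (a p * b p))"

definition eigen :: "real \<Rightarrow> (real \<times> real \<Rightarrow> real) \<Rightarrow> (real \<times> real \<Rightarrow> real) \<Rightarrow> (real \<times> real \<Rightarrow> real) \<Rightarrow> bool" where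
  "eigen c y y_t y_w \<longleftrightarrow> sphere_fun y y_t y_w \<and>
     (\<forall>g g_t g_w. sphere_fun g g_t g_w \<longrightarrow> ip y_t g_t + ip y_w g_w = c * ip y g)"

lemma ip_commute: "ip a b = ip b a"
  by (simp add: ip_def mult.commute)

lemma ip_nonneg: "ip a a \<ge> 0"
proof -
  have "0 \<le> sin (fst p) * (a p * a p)" if "p \<in> sbox" for p
    using that by (cases p) (simp add: sin_ge_zero)
  then show ?thesis unfolding ip_def
    by (cases "(\<lambda>p. sin (fst p) * (a p * a p)) integrable_on sbox")
       (auto intro!: integral_nonneg simp: not_integrable_integral)
qed

lemma ip_has_integral:
  "continuous_on UNIV a \<Longrightarrow> continuous_on UNIV b \<Longrightarrow>
    ((\<lambda>p. sin (fst p) * (a p * b p)) has_integral ip a b) sbox"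
  unfolding ip_def by (intro integrable_integral continuous_on_imp_integrable_sbox continuous_intros)

lemma ip_add_left:
  "continuous_on UNIV a \<Longrightarrow> continuous_on UNIV b \<Longrightarrow> continuous_on UNIV c \<Longrightarrow>
    ip (\<lambda>p. a p + t * b p) c = ip a c + t * ip b c"
  unfolding ip_def[of "\<lambda>p. a p + t * b p"]
  using has_integral_add[OF ip_has_integral has_integral_mult_right[OF ip_has_integral], of a c b c t]
  by (intro integral_unique) (auto simp: algebra_simps)

lemma ip_sum_left:
  "finite L \<Longrightarrow> (\<And>l. l \<in> L \<Longrightarrow> continuous_on UNIV (b l)) \<Longrightarrow> continuous_on UNIV c \<Longrightarrow>
    ip (\<lambda>p. \<Sum>l\<in>L. b l p) c = (\<Sum>l\<in>L. ip (b l) c)"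
  unfolding ip_def[of "\<lambda>p. \<Sum>l\<in>L. b l p"]
  using has_integral_sum[of L "\<lambda>l p. sin (fst p) * (b l p * c p)" "\<lambda>l. ip (b l) c" sbox] ip_has_integral[of _ c]
  by (intro integral_unique) (auto simp: sum_distrib_left sum_distrib_right)

lemma ip_residual:
  assumes "finite L" "continuous_on UNIV a" "\<And>l. l \<in> L \<Longrightarrow> continuous_on UNIV (b l)"
  shows "ip (\<lambda>p. a p - (\<Sum>l\<in>L. b l p)) (\<lambda>p. a p - (\<Sum>l\<in>L. b l p))
     = ip a a - 2 * (\<Sum>l\<in>L. ip (b l) a) + (\<Sum>l\<in>L. \<Sum>k\<in>L. ip (b l) (b k))"
proof -
  let ?S = "\<lambda>p. \<Sum>l\<in>L. b l p"
  have cS: "continuous_on UNIV ?S" using assms by (intro continuous_intros)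
  let ?r = "\<lambda>p. a p - ?S p"
  have cr: "continuous_on UNIV ?r" using assms cS by (intro continuous_intros)
  have exp: "ip ?r c = ip a c - ip ?S c" if "continuous_on UNIV c" for c
    using ip_add_left[OF assms(2) cS that, of "-1"] by simp
  have "ip ?r ?r = ip a a - 2 * ip ?S a + ip ?S ?S"
    unfolding exp[OF cr] ip_commute[of a ?r] ip_commute[of ?S ?r] exp[OF assms(2)] exp[OF cS] ip_commute[of a ?S]
    by simp
  also have "ip ?S a = (\<Sum>l\<in>L. ip (b l) a)" using assms by (intro ip_sum_left)
  also have "ip ?S ?S = (\<Sum>l\<in>L. \<Sum>k\<in>L. ip (b l) (b k))"
  proof -
    have "ip ?S ?S = (\<Sum>l\<in>L. ip (b l) ?S)" using assms cS by (intro ip_sum_left)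
    also have "\<dots> = (\<Sum>l\<in>L. \<Sum>k\<in>L. ip (b l) (b k))"
    proof (rule sum.cong[OF refl])
      fix l assume "l \<in> L"
      have "ip (b l) ?S = ip ?S (b l)" by (rule ip_commute)
      also have "\<dots> = (\<Sum>k\<in>L. ip (b k) (b l))" using assms \<open>l \<in> L\<close> by (intro ip_sum_left)
      finally show "ip (b l) ?S = (\<Sum>k\<in>L. ip (b l) (b k))" by (simp add: ip_commute)
    qed
    finally show ?thesis .
  qed
  finally show ?thesis .
qed

text \<open>Distinct eigenvalues make the modes orthogonal. L^2 convergence gives Parseval's
  identity for \<open>y\<close>; for the gradient, Bessel's inequality suffices, its mixed terms
  being evaluated by the weak eigenvalue equation tested with \<open>y\<close> itself. The constant
  6 is the eigenvalue of l = 2.\<close>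

lemma sphere_poincare:
  assumes y: "sphere_fun y y_t y_w"
    and e: "\<And>l. l \<ge> 2 \<Longrightarrow> eigen (real l * (real l + 1)) (e l) (e_t l) (e_w l)"
    and conv: "(\<lambda>n. ip (\<lambda>p. y p - (\<Sum>l\<in>{2..n}. e l p)) (\<lambda>p. y p - (\<Sum>l\<in>{2..n}. e l p))) \<longlonglongrightarrow> 0"
  shows "6 * ip y y \<le> ip y_t y_t + ip y_w y_w"
proof -
  define c where "c l = real l * (real l + 1)" for l :: nat
  have es: "sphere_fun (e l) (e_t l) (e_w l)" if "l \<ge> 2" for l using e[OF that] by (simp add: eigen_def)
  have ce: "continuous_on UNIV (e l)" "continuous_on UNIV (e_t l)" "continuous_on UNIV (e_w l)" if "l \<ge> 2" for l
    using es[OF that] by (auto simp: sphere_fun_def)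
  have cy: "continuous_on UNIV y" "continuous_on UNIV y_t" "continuous_on UNIV y_w"
    using y by (auto simp: sphere_fun_def)
  have D: "ip (e_t l) g_t + ip (e_w l) g_w = c l * ip (e l) g" if "l \<ge> 2" "sphere_fun g g_t g_w" for l g g_t g_w
    using e[OF that(1)] that(2) by (simp add: eigen_def c_def)
  have orth: "ip (e l) (e k) = 0" if "l \<ge> 2" "k \<ge> 2" "l \<noteq> k" for l k
  proof -
    have "c l * ip (e l) (e k) = ip (e_t l) (e_t k) + ip (e_w l) (e_w k)"
      using D[OF that(1) es[OF that(2)]] by simp
    also have "\<dots> = ip (e_t k) (e_t l) + ip (e_w k) (e_w l)"
      by (intro arg_cong2[where f="(+)"] ip_commute)
    also have "\<dots> = c k * ip (e k) (e l)"
      by (rule D[OF that(2) es[OF that(1)]])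
    also have "ip (e k) (e l) = ip (e l) (e k)" by (rule ip_commute)
    finally have "c l * ip (e l) (e k) = c k * ip (e l) (e k)" .
    moreover have "c l \<noteq> c k"
    proof -
      have "c l - c k = (real l - real k) * (real l + real k + 1)" by (simp add: c_def algebra_simps)
      then show ?thesis using that by auto
    qed
    ultimately show ?thesis by simp
  qed
  define a where "a l = ip (e l) (e l)" for l
  have a0: "a l \<ge> 0" for l unfolding a_def by (rule ip_nonneg)
  \<comment> \<open>For \<open>n \<ge> l\<close> the product of the residual with \<open>e l\<close> is the constant \<open>d\<close>; expanding the norm of
    residual plus \<open>t * e l\<close> and letting \<open>n\<close> tend to infinity forces \<open>d = 0\<close>.\<close>
  have ey: "ip (e l) y = a l" if l: "l \<ge> 2" for l
  proof -
    define d where "d = ip (e l) y - a l"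
    have "0 \<le> 2 * t * d + t\<^sup>2 * a l" for t
    proof (rule LIMSEQ_le_const)
      let ?r = "\<lambda>n p. y p - (\<Sum>l\<in>{2..n}. e l p)"
      show "(\<lambda>n. ip (?r n) (?r n) + (2 * t * d + t\<^sup>2 * a l)) \<longlonglongrightarrow> 2 * t * d + t\<^sup>2 * a l"
        using tendsto_add[OF conv tendsto_const[of "2 * t * d + t\<^sup>2 * a l"]] by simp
      show "\<exists>N. \<forall>n\<ge>N. 0 \<le> ip (?r n) (?r n) + (2 * t * d + t\<^sup>2 * a l)"
      proof (intro exI allI impI)
        fix n assume n: "l \<le> n"
        have cS: "continuous_on UNIV (\<lambda>p. \<Sum>k\<in>{2..n}. e k p)" by (intro continuous_intros ce) auto
        have cr: "continuous_on UNIV (?r n)" by (intro continuous_intros cy cS)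
        have "ip (?r n) (e l) = ip y (e l) - (\<Sum>k\<in>{2..n}. ip (e k) (e l))"
          using ip_add_left[OF cy(1) cS ce(1)[OF l], of "-1"] ip_sum_left[of "{2..n}" e "e l"] ce l by simp
        also have "(\<Sum>k\<in>{2..n}. ip (e k) (e l)) = (\<Sum>k\<in>{2..n}. if k = l then a l else 0)"
          using orth l by (intro sum.cong) (auto simp: a_def)
        also have "\<dots> = a l" using n l by simp
        finally have rd: "ip (?r n) (e l) = d" by (simp add: d_def ip_commute)
        let ?z = "\<lambda>p. ?r n p + t * e l p"
        have cz: "continuous_on UNIV ?z" by (intro continuous_intros cy cS ce l)
        have "ip ?z ?z = ip (?r n) ?z + t * ip (e l) ?z"
          by (rule ip_add_left[OF cr ce(1)[OF l] cz])
        also have "ip (?r n) ?z = ip (?r n) (?r n) + t * d"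
          unfolding ip_commute[of "?r n" ?z] ip_add_left[OF cr ce(1)[OF l] cr] by (simp add: ip_commute[of "e l"] rd)
        also have "ip (e l) ?z = d + t * a l"
          unfolding ip_commute[of "e l" ?z] ip_add_left[OF cr ce(1)[OF l] ce(1)[OF l]] by (simp add: rd a_def)
        finally show "0 \<le> ip (?r n) (?r n) + (2 * t * d + t\<^sup>2 * a l)"
          using ip_nonneg[of ?z] by (simp add: algebra_simps power2_eq_square)
      qed
    qed
    note q = this
    have "d = 0"
    proof (rule ccontr)
      assume d: "d \<noteq> 0"
      \<comment> \<open>The minimum of the quadratic is at \<open>- d / a l\<close>; adding 1 avoids
        the division by zero when the mode vanishes.\<close>
      define b where "b = a l + 1"
      define t where "t = - d / b"
      have tb: "t * b = - d" using a0[of l] by (simp add: t_def b_def)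
      have "0 \<le> (2 * t * d + t\<^sup>2 * a l) * b\<^sup>2" using q by simp
      also have "\<dots> = 2 * d * (t * b) * b + (t * b)\<^sup>2 * a l" by (simp add: algebra_simps power2_eq_square)
      also have "\<dots> = - (d\<^sup>2 * (a l + 2))" unfolding tb by (simp add: b_def algebra_simps power2_eq_square)
      also have "\<dots> < 0" using d a0[of l] by (simp add: add_nonneg_pos)
      finally show False by simp
    qed
    then show ?thesis by (simp add: d_def)
  qed
  have ip_sum: "ip (\<lambda>p. y p - (\<Sum>l\<in>{2..n}. e l p)) (\<lambda>p. y p - (\<Sum>l\<in>{2..n}. e l p)) = ip y y - (\<Sum>l\<in>{2..n}. a l)" for n
  proof -
    have "(\<Sum>l\<in>{2..n}. \<Sum>k\<in>{2..n}. ip (e l) (e k)) = (\<Sum>l\<in>{2..n}. \<Sum>k\<in>{2..n}. if k = l then a l else 0)"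
      using orth by (intro sum.cong) (auto simp: a_def)
    also have "\<dots> = (\<Sum>l\<in>{2..n}. a l)" by simp
    finally show ?thesis
      using cy ce by (subst ip_residual) (auto simp: ey)
  qed
  have bound: "6 * (\<Sum>l\<in>{2..n}. a l) \<le> ip y_t y_t + ip y_w y_w" for n
  proof -
    let ?T = "\<lambda>p. y_t p - (\<Sum>l\<in>{2..n}. e_t l p)" and ?W = "\<lambda>p. y_w p - (\<Sum>l\<in>{2..n}. e_w l p)"
    \<comment> \<open>Bessel: in the squared norm of the residual gradient, the mixed and the
      quadratic terms are both multiples of the sum of \<open>c l * a l\<close>, with net
      coefficient -1.\<close>
    have "0 \<le> ip ?T ?T + ip ?W ?W" by (intro add_nonneg_nonneg ip_nonneg)
    also have "\<dots> = ip y_t y_t + ip y_w y_w - 2 * (\<Sum>l\<in>{2..n}. ip (e_t l) y_t + ip (e_w l) y_w)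
       + (\<Sum>l\<in>{2..n}. \<Sum>k\<in>{2..n}. ip (e_t l) (e_t k) + ip (e_w l) (e_w k))"
      using cy ce by (subst (1 2) ip_residual) (auto simp: sum.distrib algebra_simps)
    also have "(\<Sum>l\<in>{2..n}. ip (e_t l) y_t + ip (e_w l) y_w) = (\<Sum>l\<in>{2..n}. c l * a l)"
      using D[OF _ y] ey by (intro sum.cong) auto
    also have "(\<Sum>l\<in>{2..n}. \<Sum>k\<in>{2..n}. ip (e_t l) (e_t k) + ip (e_w l) (e_w k))
        = (\<Sum>l\<in>{2..n}. \<Sum>k\<in>{2..n}. if k = l then c l * a l else 0)"
      using D[OF _ es] orth by (intro sum.cong) (auto simp: a_def)
    also have "\<dots> = (\<Sum>l\<in>{2..n}. c l * a l)" by simp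
    finally have "(\<Sum>l\<in>{2..n}. c l * a l) \<le> ip y_t y_t + ip y_w y_w" by simp
    moreover have "(\<Sum>l\<in>{2..n}. 6 * a l) \<le> (\<Sum>l\<in>{2..n}. c l * a l)"
    proof (intro sum_mono mult_right_mono a0)
      fix l :: nat assume "l \<in> {2..n}"
      then have "2 * 3 \<le> real l * (real l + 1)" by (intro mult_mono) auto
      then show "6 \<le> c l" by (simp add: c_def)
    qed
    ultimately show ?thesis by (simp add: sum_distrib_left)
  qed
  have "(\<lambda>n. 6 * (ip y y - (\<Sum>l\<in>{2..n}. a l)) + 6 * (\<Sum>l\<in>{2..n}. a l)) \<longlonglongrightarrow> 6 * ip y y"
    by simp
  moreover have "(\<lambda>n. 6 * (ip y y - (\<Sum>l\<in>{2..n}. a l)) + (ip y_t y_t + ip y_w y_w)) \<longlonglongrightarrow> 6 * 0 + (ip y_t y_t + ip y_w y_w)"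
    using conv unfolding ip_sum by (intro tendsto_intros)
  ultimately show ?thesis
    by (rule LIMSEQ_le[THEN order_trans]) (use bound in auto)
qed

context smooth_exterior
begin

lemma sphere_fun_u: "r \<ge> 2 * M \<Longrightarrow> sphere_fun (u v r) (u_t v r) (u_w v r)"
  unfolding sphere_fun_def
  by (auto intro!: continuous_intros derivatives_t derivatives_p simp: periodic)

lemma laplace_sphere:
  assumes r: "r \<ge> 2 * M" and s: "0 < s $ 1" "s $ 1 < pi"
  shows "laplace_beltrami sphere_metric (\<lambda>s. f (v, r *\<^sub>R sphere_point (s $ 1) (s $ 2))) s * sin (s $ 1)
    = lap v r (s $ 1, s $ 2)"
proof -
  let ?u = "\<lambda>s::real^2. f (v, r *\<^sub>R sphere_point (s $ 1) (s $ 2))"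
  have ue: "?u = (\<lambda>s. u v r (s $ 1, s $ 2))" by (simp add: u_def pos_def sphere_point_radial)
  define N where "N = {p::real^2. 0 < p $ 1 \<and> p $ 1 < pi}"
  have "open {p::real^2. 0 < p $ 1}" "open {p::real^2. p $ 1 < pi}"
    by (intro open_Collect_less continuous_intros)+
  moreover have "N = {p. 0 < p $ 1} \<inter> {p. p $ 1 < pi}" by (auto simp: N_def)
  ultimately have N_open: "open N" by (simp add: open_Int)
  have sN: "s \<in> N" using s by (simp add: N_def)
  note cd = fields_differentiable[OF differentiable_const differentiable_const differentiable_vec_nth differentiable_vec_nth pos_in_U[OF r]]
  have cu: "coord_deriv 1 ?u p = u_t v r (p $ 1, p $ 2)" "coord_deriv 2 ?u p = sin (p $ 1) * u_w v r (p $ 1, p $ 2)" for p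
    unfolding ue
    by (rule coord_deriv_2(1)[where Y="\<lambda>a b. u v r (a, b)", OF cd(1) derivatives_t(1)[OF pos_in_U[OF r]]],
        rule coord_deriv_2(2)[where Y="\<lambda>a b. u v r (a, b)", OF cd(1) derivatives_p(1)[OF pos_in_U[OF r]]])
  have det: "sqrt \<bar>det (sphere_metric p)\<bar> = \<bar>sin (p $ 1)\<bar>" for p
    by (simp add: sphere_metric_def det_2)
  have inv: "matrix_inv (sphere_metric p) = vector [vector [1, 0], vector [0, 1 / (sin (p $ 1))\<^sup>2]]" if "sin (p $ 1) \<noteq> 0" for p
    by (rule matrix_inv_eqI)
       (use that in \<open>simp_all add: matrix_matrix_mult_def sum_2 vec_eq_iff forall_2 mat_def sphere_metric_def\<close>)
  define F where "F \<alpha> p = sqrt \<bar>det (sphere_metric p)\<bar> *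
      (\<Sum>\<beta>\<in>UNIV. matrix_inv (sphere_metric p) $ \<alpha> $ \<beta> * coord_deriv \<beta> ?u p)" for \<alpha> p
  have F: "F 1 p = sin (p $ 1) * u_t v r (p $ 1, p $ 2)" "F 2 p = u_w v r (p $ 1, p $ 2)" if "p \<in> N" for p
  proof -
    have p: "sin (p $ 1) > 0" using that by (simp add: N_def sin_gt_zero)
    show "F 1 p = sin (p $ 1) * u_t v r (p $ 1, p $ 2)" "F 2 p = u_w v r (p $ 1, p $ 2)"
      unfolding F_def det using p by (simp_all add: inv sum_2 cu power2_eq_square)
  qed
  have sin_dif: "(\<lambda>p::real^2. sin (p $ 1)) differentiable at s"
    by (intro differentiable_sin_cos differentiable_vec_nth)
  note dif1 = differentiable_mult[OF sin_dif cd(4)]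
  have "coord_deriv 1 (F 1) s = coord_deriv 1 (\<lambda>p. sin (p $ 1) * u_t v r (p $ 1, p $ 2)) s"
    by (rule coord_deriv_cong[OF N_open sN F(1) dif1])
  also have "\<dots> = cos (s $ 1) * u_t v r (s $ 1, s $ 2) + sin (s $ 1) * u_tt v r (s $ 1, s $ 2)"
    by (rule coord_deriv_2(1)[where Y="\<lambda>c d. sin c * u_t v r (c, d)"], rule dif1)
       (use r in \<open>auto intro!: derivative_eq_intros derivatives_t\<close>)
  finally have 1: "coord_deriv 1 (F 1) s = cos (s $ 1) * u_t v r (s $ 1, s $ 2) + sin (s $ 1) * u_tt v r (s $ 1, s $ 2)" .
  have "coord_deriv 2 (F 2) s = coord_deriv 2 (\<lambda>p. u_w v r (p $ 1, p $ 2)) s"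
    by (rule coord_deriv_cong[OF N_open sN F(2) cd(5)])
  also have "\<dots> = w_p v r (s $ 1, s $ 2)"
    by (rule coord_deriv_2(2)[where Y="\<lambda>c d. u_w v r (c, d)"], rule cd(5), rule derivatives_p(4)[OF pos_in_U[OF r]])
  finally have 2: "coord_deriv 2 (F 2) s = w_p v r (s $ 1, s $ 2)" .
  have s0: "sin (s $ 1) > 0" using s by (simp add: sin_gt_zero)
  have "laplace_beltrami sphere_metric ?u s = (\<Sum>\<alpha>\<in>UNIV. coord_deriv \<alpha> (F \<alpha>) s) / sin (s $ 1)"
    unfolding laplace_beltrami_def F_def[abs_def] det using s0 by simp
  then have s1: "laplace_beltrami sphere_metric ?u s * sin (s $ 1) = (\<Sum>\<alpha>\<in>UNIV. coord_deriv \<alpha> (F \<alpha>) s)"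
    using s0 by simp
  have s2: "(\<Sum>\<alpha>\<in>UNIV. coord_deriv \<alpha> (F \<alpha>) s) = lap v r (s $ 1, s $ 2)"
    by (simp only: sum_2 1 2 lap_def fst_conv snd_conv)
  show ?thesis unfolding s1 by (rule s2)
qed

text \<open>The pointwise equation extends to the poles by continuity; Green's identity then gives
  the weak form.\<close>

lemma eigen_harmonic:
  assumes r: "r \<ge> 2 * M" and Y: "spherical_harmonic l (\<lambda>\<omega>. f (v, r *\<^sub>R \<omega>))"
  shows "eigen (real l * (real l + 1)) (u v r) (u_t v r) (u_w v r)"
proof -
  let ?c = "real l * (real l + 1)"
  have lap_open: "lap v r p + ?c * (sin (fst p) * u v r p) = 0" if p: "0 < fst p" "fst p < pi" for p
  proof -
    let ?s = "(\<chi> i. if i = 1 then fst p else snd p) :: real^2"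
    have "laplace_beltrami sphere_metric (\<lambda>s. f (v, r *\<^sub>R sphere_point (s $ 1) (s $ 2))) ?s
       = - ?c * f (v, r *\<^sub>R sphere_point (?s $ 1) (?s $ 2))"
      using Y p unfolding spherical_harmonic_def by simp
    then have "lap v r (?s $ 1, ?s $ 2) = (- ?c * f (v, r *\<^sub>R sphere_point (?s $ 1) (?s $ 2))) * sin (?s $ 1)"
      using laplace_sphere[OF r, of ?s v] p by simp
    then show ?thesis by (simp add: sphere_point_radial u_def pos_def)
  qed
  have lap_eq: "lap v r p + ?c * (sin (fst p) * u v r p) = 0" (is "?F p = 0") if "p \<in> sbox" for p
  proof (rule eq_0_on_sbox[of ?F])
    show "continuous_on UNIV ?F" unfolding lap_def using r by (intro continuous_intros) auto
    show "?F p = 0" if "0 < fst p" "fst p < pi" for p using that by (rule lap_open)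
  qed (rule that)
  have "ip (u_t v r) g_t + ip (u_w v r) g_w = ?c * ip (u v r) g" if g: "sphere_fun g g_t g_w" for g g_t g_w
  proof -
    have cg: "continuous_on UNIV g" "continuous_on UNIV g_t" "continuous_on UNIV g_w"
      using g by (auto simp: sphere_fun_def)
    have cu: "continuous_on UNIV (u v r)" "continuous_on UNIV (u_t v r)" "continuous_on UNIV (u_w v r)"
      using sphere_fun_u[OF r] by (auto simp: sphere_fun_def)
    have "integral sbox (\<lambda>p. lap v r p * g p)
       = - integral sbox (\<lambda>p. sin (fst p) * (u_t v r p * g_t p + u_w v r p * g_w p))"
      using g by (intro green[OF r]) (auto simp: sphere_fun_def)
    moreover have "integral sbox (\<lambda>p. sin (fst p) * (u_t v r p * g_t p + u_w v r p * g_w p)) = ip (u_t v r) g_t + ip (u_w v r) g_w"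
      using has_integral_add[OF ip_has_integral[OF cu(2) cg(2)] ip_has_integral[OF cu(3) cg(3)]]
      by (intro integral_unique) (simp add: distrib_left)
    moreover have "integral sbox (\<lambda>p. lap v r p * g p) = - ?c * ip (u v r) g"
    proof (rule integral_unique, rule has_integral_eq)
      show "((\<lambda>p. - ?c * (sin (fst p) * (u v r p * g p))) has_integral - ?c * ip (u v r) g) sbox"
        by (intro has_integral_mult_right ip_has_integral cu cg)
      fix p assume "p \<in> sbox"
      then have "lap v r p = - ?c * (sin (fst p) * u v r p)" using lap_eq[of p] by simp
      then show "- ?c * (sin (fst p) * (u v r p * g p)) = lap v r p * g p" by (simp add: mult.assoc)
    qed
    ultimately show ?thesis by simp
  qed
  then show ?thesis unfolding eigen_def using sphere_fun_u[OF r] by blast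
qed

section \<open>From the definitions of solution and energy to the spherical means\<close>

lemma wave_eq_of_solution:
  assumes sol: "\<And>q. q $ 2 \<ge> 2 * M \<and> 0 < q $ 3 \<and> q $ 3 < pi \<Longrightarrow>
        laplace_beltrami (schwarzschild M) (f \<circ> chart_point) q - V (q $ 2) * f (chart_point q) = 0"
    and r: "r \<ge> 2 * M" and p: "0 < fst p" "fst p < pi"
  shows "sin (fst p) * (2 * r\<^sup>2 * u_vr v r p + 2 * r * u_v v r p + (2 * r - 2 * M) * u_r v r p
        + r * (r - 2 * M) * u_rr v r p - r\<^sup>2 * V r * u v r p)
      + (cos (fst p) * u_t v r p + sin (fst p) * u_tt v r p + w_p v r p) = 0"
proof -
  define q where "q = coords v r (fst p) (snd p)"
  have qc: "q $ 1 = v" "q $ 2 = r" "q $ 3 = fst p" "q $ 4 = snd p" by (simp_all add: q_def)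
  have "laplace_beltrami (schwarzschild M) (f \<circ> chart_point) q = V r * u v r p"
    using sol[of q] r p by (simp add: qc chart_point_eq u_def)
  with laplace_chart[of q] r p
  have "V r * u v r p * (r\<^sup>2 * sin (fst p)) =
     sin (fst p) * (2 * r\<^sup>2 * u_vr v r p + 2 * r * u_v v r p + (2 * r - 2 * M) * u_r v r p
        + r * (r - 2 * M) * u_rr v r p)
      + (cos (fst p) * u_t v r p + sin (fst p) * u_tt v r p + w_p v r p)"
    by (simp add: qc)
  then show ?thesis by (simp add: algebra_simps)
qed

end

context wave_exterior
begin

text \<open>The factor sin \<theta> makes both sides vanish at the poles, where the inverse metric
  is unspecified. \<open>X\<close> is g^-1(du, du) + V u^2 without its mixed term 2 u_v u_r; this
  term cancels in the (v, r) component of the tensor, which equals -X / 2, so the null piece sees no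
  \<open>u_v\<close>.\<close>

lemma current_flux_sin:
  assumes r: "r \<ge> 2 * M"
    and X: "X = (1 - 2 * M / r) * (u_r v r (\<theta>, \<phi>))\<^sup>2 + ((u_t v r (\<theta>, \<phi>))\<^sup>2 + (u_w v r (\<theta>, \<phi>))\<^sup>2) / r\<^sup>2 + V r * (u v r (\<theta>, \<phi>))\<^sup>2"
  shows "current_flux (schwarzschild M) (\<lambda>q. V (q $ 2)) (f \<circ> chart_point)
              (N_field M y1 y2 r) (- e_r) (coords v r \<theta> \<phi>) * sin \<theta>
     = sin \<theta> * ((1 / 2 + y2 r) * X + (y1 r - y2 r * (1 - 2 * M / r)) * (u_r v r (\<theta>, \<phi>))\<^sup>2)" (is ?A)
    and "current_flux (schwarzschild M) (\<lambda>q. V (q $ 2)) (f \<circ> chart_point)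
              d_t (c *\<^sub>R d_t) (coords v r \<theta> \<phi>) * sin \<theta>
     = sin \<theta> * (c * ((u_v v r (\<theta>, \<phi>))\<^sup>2 + (1 - 2 * M / r) * (u_v v r (\<theta>, \<phi>) * u_r v r (\<theta>, \<phi>) + X / 2)))" (is ?B)
proof -
  define q where "q = coords v r \<theta> \<phi>"
  have qc: "q $ 1 = v" "q $ 2 = r" "q $ 3 = \<theta>" "q $ 4 = \<phi>" by (simp_all add: q_def)
  have r0: "r > 0" using r_pos[OF r] .
  have qU: "chart_point q \<in> U" using r by (simp add: chart_point_eq qc)
  have fq: "(f \<circ> chart_point) q = u v r (\<theta>, \<phi>)" by (simp add: chart_point_eq qc u_def)
  have "?A \<and> ?B"
  proof (cases "sin \<theta> = 0")
    case False
    have inv: "matrix_inv (schwarzschild M q) = schwarzschild_inv M q"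
      using matrix_inv_schwarzschild[of q M] False r0 by (simp add: qc)
    have tr: "(\<Sum>\<gamma>\<in>UNIV. \<Sum>\<delta>\<in>UNIV. matrix_inv (schwarzschild M q) $ \<gamma> $ \<delta> * coord_deriv \<gamma> (f \<circ> chart_point) q * coord_deriv \<delta> (f \<circ> chart_point) q)
        + V (q $ 2) * ((f \<circ> chart_point) q)\<^sup>2 = 2 * (u_v v r (\<theta>, \<phi>) * u_r v r (\<theta>, \<phi>)) + X"
      unfolding inv fq X using False r0
      by (simp add: sum_4 schwarzschild_inv_def coord_deriv_chart[OF qU] qc mu_def add_divide_distrib)
         (simp add: power2_eq_square)
    have em: "energy_momentum (schwarzschild M) (\<lambda>q. V (q $ 2)) (f \<circ> chart_point) q \<alpha> \<beta>
        = coord_deriv \<alpha> (f \<circ> chart_point) q * coord_deriv \<beta> (f \<circ> chart_point) q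
         - 1/2 * schwarzschild M q $ \<alpha> $ \<beta> * (2 * (u_v v r (\<theta>, \<phi>) * u_r v r (\<theta>, \<phi>)) + X)" for \<alpha> \<beta>
      unfolding energy_momentum_def tr ..
    show ?thesis unfolding q_def[symmetric]
      by (simp add: current_flux_def sum_4 em coord_deriv_chart[OF qU] qc schwarzschild_def mu_def
           N_field_def d_t_def d_v_def d_rstar_def e_v_def e_r_def axis_def)
         (use r0 in \<open>simp add: field_simps power2_eq_square\<close>)
  qed simp
  then show ?A ?B by auto
qed

lemma flux_interior:
  assumes r: "r \<ge> 2 * M"
  shows "sphere_integral (\<lambda>\<theta> \<phi>. current_flux (schwarzschild M) (\<lambda>q. V (q $ 2)) (f \<circ> chart_point)
              (N_field M y1 y2 r) (- e_r) (coords v r \<theta> \<phi>)) * r\<^sup>2 = dens y1 y2 v r"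
proof -
  have r0: "r > 0" using r_pos[OF r] .
  let ?X = "\<lambda>p. (1 - 2 * M / r) * (u_r v r p)\<^sup>2 + ((u_t v r p)\<^sup>2 + (u_w v r p)\<^sup>2) / r\<^sup>2 + V r * (u v r p)\<^sup>2"
  let ?H = "\<lambda>p. sin (fst p) * ((1 / 2 + y2 r) * ?X p + (y1 r - y2 r * (1 - 2 * M / r)) * (u_r v r p)\<^sup>2)"
  have cH: "continuous_on UNIV ?H" using r r0 by (intro continuous_intros) auto
  have "sphere_integral (\<lambda>\<theta> \<phi>. current_flux (schwarzschild M) (\<lambda>q. V (q $ 2)) (f \<circ> chart_point)
              (N_field M y1 y2 r) (- e_r) (coords v r \<theta> \<phi>)) = integral sbox ?H"
  proof (rule sphere_integral_eq)
    show "continuous_on sbox ?H" by (rule continuous_on_subset[OF cH]) simp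
  qed (unfold fst_conv, rule current_flux_sin(1)[OF r refl])
  moreover have "((\<lambda>p. ?H p * r\<^sup>2) has_integral integral sbox ?H * r\<^sup>2) sbox"
    by (intro has_integral_mult_left has_integral_sbox cH)
  moreover have "((\<lambda>p. ((1 - 2 * M / r) / 2 + y1 r) * (sin (fst p) * (r * u_r v r p)\<^sup>2) + (1 / 2 + y2 r) *
       (sin (fst p) * ((u_t v r p)\<^sup>2 + (u_w v r p)\<^sup>2) + r\<^sup>2 * V r * (sin (fst p) * (u v r p)\<^sup>2)))
      has_integral dens y1 y2 v r) sbox"
    unfolding dens_def pot_def rad_def ang_def msq_def using r
    by (intro has_integral_add has_integral_mult_right has_integral_sbox continuous_intros) auto
  moreover have "((1 - 2 * M / r) / 2 + y1 r) * (sin (fst p) * (r * u_r v r p)\<^sup>2) + (1 / 2 + y2 r) *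
       (sin (fst p) * ((u_t v r p)\<^sup>2 + (u_w v r p)\<^sup>2) + r\<^sup>2 * V r * (sin (fst p) * (u v r p)\<^sup>2)) = ?H p * r\<^sup>2" for p
    using r0 by (simp add: field_simps power2_eq_square)
  ultimately show ?thesis by (simp add: has_integral_unique)
qed

text \<open>The unit normal and the induced measure each contribute (1 - \<mu>)^(-1/2); their
  product is the derivative of the tortoise coordinate, the factor in
  \<open>ext_flux\<close>.\<close>

lemma flux_exterior:
  assumes r: "r > 2 * M"
  shows "sphere_integral (\<lambda>\<theta> \<phi>. current_flux (schwarzschild M) (\<lambda>q. V (q $ 2)) (f \<circ> chart_point)
              d_t ((1 / sqrt (1 - mu M r)) *\<^sub>R d_t) (coords (\<tau> + tortoise M r) r \<theta> \<phi>)) * (r\<^sup>2 / sqrt (1 - mu M r)) = ext_flux \<tau> r"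
proof -
  have r': "r \<ge> 2 * M" "r > 0" using r r_pos by auto
  define v where "v = \<tau> + tortoise M r"
  define D where "D = 1 - 2 * M / r"
  have D: "D > 0" using r r' by (simp add: D_def)
  have rD: "r / (r - 2 * M) = 1 / D" "r * (r - 2 * M) = r\<^sup>2 * D"
    using r r' by (simp_all add: D_def field_simps power2_eq_square)
  let ?X = "\<lambda>p. D * (u_r v r p)\<^sup>2 + ((u_t v r p)\<^sup>2 + (u_w v r p)\<^sup>2) / r\<^sup>2 + V r * (u v r p)\<^sup>2"
  let ?H = "\<lambda>p. sin (fst p) * (1 / sqrt D * ((u_v v r p)\<^sup>2 + D * (u_v v r p * u_r v r p + ?X p / 2)))"
  have cH: "continuous_on UNIV ?H" using r' D by (intro continuous_intros) auto
  have "sphere_integral (\<lambda>\<theta> \<phi>. current_flux (schwarzschild M) (\<lambda>q. V (q $ 2)) (f \<circ> chart_point)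
              d_t ((1 / sqrt D) *\<^sub>R d_t) (coords v r \<theta> \<phi>)) = integral sbox ?H"
  proof (rule sphere_integral_eq)
    show "continuous_on sbox ?H" by (rule continuous_on_subset[OF cH]) simp
  qed (unfold fst_conv D_def, rule current_flux_sin(2)[OF r'(1) refl])
  moreover have "((\<lambda>p. ?H p * (r\<^sup>2 / sqrt D)) has_integral integral sbox ?H * (r\<^sup>2 / sqrt D)) sbox"
    by (intro has_integral_mult_left has_integral_sbox cH)
  moreover have "((\<lambda>p. sin (fst p) *
   (r * (r - 2 * M) * (u_r v r p)\<^sup>2 + ((u_t v r p)\<^sup>2 + (u_w v r p)\<^sup>2) + r\<^sup>2 * V r * (u v r p)\<^sup>2) / 2
     + r / (r - 2 * M) * (sin (fst p) * (r\<^sup>2 * (u_v v r p)\<^sup>2 + r * (r - 2 * M) * (u_v v r p * u_r v r p))))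
      has_integral ext_flux \<tau> r) sbox"
    unfolding ext_flux_def flux_def mom_def v_def[symmetric] using r'
    by (intro has_integral_add has_integral_mult_right has_integral_divide has_integral_sbox continuous_intros) auto
  moreover have "sin (fst p) *
   (r * (r - 2 * M) * (u_r v r p)\<^sup>2 + ((u_t v r p)\<^sup>2 + (u_w v r p)\<^sup>2) + r\<^sup>2 * V r * (u v r p)\<^sup>2) / 2
     + r / (r - 2 * M) * (sin (fst p) * (r\<^sup>2 * (u_v v r p)\<^sup>2 + r * (r - 2 * M) * (u_v v r p * u_r v r p)))
     = ?H p * (r\<^sup>2 / sqrt D)" for p
  proof -
    have s: "x * (1 / sqrt D * y) * (r\<^sup>2 / sqrt D) = r\<^sup>2 / D * (x * y)" for x y :: real
      using D by (simp add: divide_simps)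
    show ?thesis unfolding rD s
      using D r' by (simp add: field_simps power2_eq_square)
  qed
  ultimately show ?thesis unfolding mu_def D_def[symmetric] v_def[symmetric] by (simp add: has_integral_unique)
qed

lemma energy_eq_slice_energy:
  assumes R: "R > 2 * M" and y: "\<And>r. r \<ge> R \<Longrightarrow> y1 r = 0 \<and> y2 r = 0"
  shows "energy M R y1 y2 V f \<tau> = slice_energy R y1 y2 \<tau>"
proof -
  have N: "N_field M y1 y2 r = d_t" if "r \<ge> R" for r using y[OF that] by (simp add: N_field_def)
  show ?thesis
    unfolding energy_def slice_energy_def Let_def
    by (intro arg_cong2[where f="(+)"] nn_integral_cong)
       (use R in \<open>auto simp: indicator_def flux_interior N flux_exterior simp del: times_divide_eq_right\<close>)
qed

end

section \<open>Uniform boundedness of the energy\<close>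

lemma bounded_above_on_interval:
  fixes g :: "real \<Rightarrow> real"
  assumes "continuous_on {a..b} g"
  obtains K where "\<And>x. x \<in> {a..b} \<Longrightarrow> g x \<le> K"
proof -
  have "bounded (g ` {a..b})"
    using assms compact_continuous_image compact_imp_bounded by blast
  then obtain K where "\<forall>x\<in>{a..b}. \<bar>g x\<bar> \<le> K"
    unfolding bounded_iff by auto
  then show thesis by (intro that[of K]) (simp add: abs_le_iff)
qed

lemma smooth_near_continuous_on: "smooth_near f S \<Longrightarrow> continuous_on S f"
  unfolding smooth_near_def using Ck_on.simps(1) continuous_on_subset by blast

text \<open>Compactness of [2 M, R]: the required quotients are continuous because their
  denominators are positive. Away from the horizon 1 - 2 M / r is positive; at the horizon, where it
  vanishes, \<open>R - r\<close> and \<open>y1 = 1\<close> take over.\<close>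

lemma N_profiles_bounds:
  assumes M: "M > 0" and R: "R > 2 * M" and N: "N_profiles M R y1 y2"
  obtains A where "A \<ge> 1" "\<And>r. r \<in> {2 * M..<R} \<Longrightarrow> 0 \<le> y1 r \<and> 0 \<le> y2 r \<and> 1 / 2 + y2 r \<le> A
        \<and> (1 - 2 * M / r) / 2 + y1 r \<le> A * ((1 - 2 * M / r) + (R - r)) \<and> R - r \<le> A * ((1 - 2 * M / r) / 2 + y1 r)"
proof -
  have c1: "continuous_on {2 * M..R} y1" and c2: "continuous_on {2 * M..R} y2"
    using N smooth_near_continuous_on continuous_on_subset unfolding N_profiles_def
    by (metis atLeastatMost_subset_iff order_refl Icc_subset_Ici_iff)+
  have y0: "0 \<le> y1 r \<and> 0 \<le> y2 r" if "r \<in> {2 * M..R}" for r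
  proof -
    consider "r = 2 * M" | "2 * M < r \<and> r < R" | "r = R" using \<open>r \<in> _\<close> by force
    then show ?thesis using N unfolding N_profiles_def by cases force+
  qed
  let ?D = "\<lambda>r. 1 - 2 * M / r"
  have D: "?D r \<ge> 0" "r > 2 * M \<Longrightarrow> ?D r > 0" "r \<noteq> 0" if "r \<in> {2 * M..R}" for r
    using that M by (auto simp: field_simps)
  have a: "?D r + (R - r) > 0" if "r \<in> {2 * M..R}" for r
    using D[OF that] that R by (cases "r = 2 * M") (auto intro: add_pos_nonneg)
  have b: "?D r / 2 + y1 r > 0" if "r \<in> {2 * M..R}" for r
  proof (cases "r = 2 * M")
    case True
    then show ?thesis using N M by (simp add: N_profiles_def)
  next
    case False
    then show ?thesis using D[OF that] y0[OF that] that by (auto intro: add_pos_nonneg)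
  qed
  have cD: "continuous_on {2 * M..R} ?D" using D(3) by (intro continuous_intros) auto
  have "continuous_on {2 * M..R} (\<lambda>r. 1 / 2 + y2 r)" by (intro continuous_intros c2)
  from bounded_above_on_interval[OF this]
  obtain K1 where K1: "\<And>r. r \<in> {2 * M..R} \<Longrightarrow> 1 / 2 + y2 r \<le> K1" by blast
  have "continuous_on {2 * M..R} (\<lambda>r. (?D r / 2 + y1 r) / (?D r + (R - r)))"
    using a by (intro continuous_intros cD c1) fastforce+
  from bounded_above_on_interval[OF this]
  obtain K2 where K2: "\<And>r. r \<in> {2 * M..R} \<Longrightarrow> (?D r / 2 + y1 r) / (?D r + (R - r)) \<le> K2" by blast
  have "continuous_on {2 * M..R} (\<lambda>r. (R - r) / (?D r / 2 + y1 r))"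
    using b by (intro continuous_intros cD c1) fastforce+
  from bounded_above_on_interval[OF this]
  obtain K3 where K3: "\<And>r. r \<in> {2 * M..R} \<Longrightarrow> (R - r) / (?D r / 2 + y1 r) \<le> K3" by blast
  define A where "A = max 1 (max K1 (max K2 K3))"
  show thesis
  proof (rule that[of A])
    show "A \<ge> 1" by (simp add: A_def)
    fix r assume "r \<in> {2 * M..<R}"
    then have r: "r \<in> {2 * M..R}" by simp
    have "1 / 2 + y2 r \<le> A" using K1[OF r] by (simp add: A_def)
    moreover have "(?D r / 2 + y1 r) / (?D r + (R - r)) \<le> A" using K2[OF r] unfolding A_def by linarith
    then have "?D r / 2 + y1 r \<le> A * (?D r + (R - r))" using a[OF r] pos_divide_le_eq by blast
    moreover have "(R - r) / (?D r / 2 + y1 r) \<le> A" using K3[OF r] unfolding A_def by linarith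
    then have "R - r \<le> A * (?D r / 2 + y1 r)" using b[OF r] pos_divide_le_eq by blast
    ultimately show "0 \<le> y1 r \<and> 0 \<le> y2 r \<and> 1 / 2 + y2 r \<le> A
        \<and> ?D r / 2 + y1 r \<le> A * (?D r + (R - r)) \<and> R - r \<le> A * (?D r / 2 + y1 r)"
      using y0[OF r] by blast
  qed
qed

lemma smooth_exterior_exists:
  assumes "M > 0" "smooth_near f (exterior M)"
  obtains U gr Hs where "smooth_exterior M f U gr Hs"
  using smooth_nearE[OF assms(2)] assms(1) unfolding smooth_exterior_def by metis

context smooth_exterior
begin

lemma wave_exteriorI:
  assumes "continuous_on {2 * M..} V" "\<And>r. r \<ge> 2 * M \<Longrightarrow> V r \<le> 0" "\<And>r. r \<ge> 2 * M \<Longrightarrow> - 4 \<le> r\<^sup>2 * V r"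
    and sol: "wave_solution M V f"
    and poincare: "\<And>v r. r \<ge> 2 * M \<Longrightarrow> 6 * ip (u v r) (u v r) \<le> ip (u_t v r) (u_t v r) + ip (u_w v r) (u_w v r)"
  shows "wave_exterior M f U gr Hs V"
proof unfold_locales
  fix v r :: real assume r: "r \<ge> 2 * M"
  have cu: "continuous_on UNIV (u_t v r)" "continuous_on UNIV (u_w v r)"
    using sphere_fun_u[OF r] by (auto simp: sphere_fun_def)
  have "integral sbox (\<lambda>p. sin (fst p) * ((u_t v r p)\<^sup>2 + (u_w v r p)\<^sup>2)) = ip (u_t v r) (u_t v r) + ip (u_w v r) (u_w v r)"
    using has_integral_add[OF ip_has_integral[OF cu(1) cu(1)] ip_has_integral[OF cu(2) cu(2)]]
    by (intro integral_unique) (simp add: distrib_left power2_eq_square)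
  moreover have "integral sbox (\<lambda>p. sin (fst p) * (u v r p)\<^sup>2) = ip (u v r) (u v r)"
    by (simp add: ip_def power2_eq_square)
  ultimately show "6 * integral sbox (\<lambda>p. sin (fst p) * (u v r p)\<^sup>2)
        \<le> integral sbox (\<lambda>p. sin (fst p) * ((u_t v r p)\<^sup>2 + (u_w v r p)\<^sup>2))"
    using poincare[OF r] by simp
next
  fix v r :: real and p :: "real \<times> real"
  assume "r \<ge> 2 * M" "0 < fst p" "fst p < pi"
  then show "sin (fst p) * (2 * r\<^sup>2 * u_vr v r p + 2 * r * u_v v r p + (2 * r - 2 * M) * u_r v r p
        + r * (r - 2 * M) * u_rr v r p - r\<^sup>2 * V r * u v r p)
      + (cos (fst p) * u_t v r p + sin (fst p) * u_tt v r p + w_p v r p) = 0"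
    using sol by (intro wave_eq_of_solution) (auto simp: wave_solution_def)
qed (use assms in auto)

text \<open>Each mode gets its gradient from its own instance of the locale; the L^2 convergence on
  the sphere is what links the modes to \<open>f\<close>.\<close>

lemma poincare_modes:
  assumes modes: "modes_ge2 M f f_m" and r: "r \<ge> 2 * M"
  shows "6 * ip (u v r) (u v r) \<le> ip (u_t v r) (u_t v r) + ip (u_w v r) (u_w v r)"
proof -
  let ?e = "\<lambda>l p. f_m l (v, r *\<^sub>R radial p)"
  have "\<exists>e_t e_w. eigen (real l * (real l + 1)) (?e l) e_t e_w" if l: "l \<ge> 2" for l
  proof -
    have "smooth_near (f_m l) (exterior M)" and Y: "spherical_harmonic l (\<lambda>\<omega>. f_m l (v, r *\<^sub>R \<omega>))"
      using modes l r unfolding modes_ge2_def by auto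
    then obtain U' gr' Hs' where "smooth_exterior M (f_m l) U' gr' Hs'"
      using smooth_exterior_exists[OF M_pos] by blast
    then interpret m: smooth_exterior M "f_m l" U' gr' Hs' .
    have "m.u v r = ?e l" by (simp add: m.u_def m.pos_def fun_eq_iff)
    then show ?thesis using m.eigen_harmonic[OF r Y] by auto
  qed
  then obtain e_t e_w where e: "\<And>l. l \<ge> 2 \<Longrightarrow> eigen (real l * (real l + 1)) (?e l) (e_t l) (e_w l)"
    by metis
  have ce: "continuous_on UNIV (?e l)" if "l \<ge> 2" for l
    using e[OF that] by (simp add: eigen_def sphere_fun_def)
  have cu: "continuous_on UNIV (u v r)"
    using sphere_fun_u[OF r] by (simp add: sphere_fun_def)
  have eq: "sphere_integral (\<lambda>\<theta> \<phi>. (f (v, r *\<^sub>R sphere_point \<theta> \<phi>) - (\<Sum>l\<in>{2..n}. f_m l (v, r *\<^sub>R sphere_point \<theta> \<phi>)))\<^sup>2)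
     = ip (\<lambda>p. u v r p - (\<Sum>l\<in>{2..n}. ?e l p)) (\<lambda>p. u v r p - (\<Sum>l\<in>{2..n}. ?e l p))" for n
    unfolding ip_def
  proof (rule sphere_integral_eq)
    have "continuous_on UNIV (\<lambda>p. sin (fst p) * ((u v r p - (\<Sum>l\<in>{2..n}. ?e l p)) * (u v r p - (\<Sum>l\<in>{2..n}. ?e l p))))"
      by (intro continuous_intros cu ce) auto
    then show "continuous_on sbox (\<lambda>p. sin (fst p) * ((u v r p - (\<Sum>l\<in>{2..n}. ?e l p)) * (u v r p - (\<Sum>l\<in>{2..n}. ?e l p))))"
      by (rule continuous_on_subset) simp
  qed (simp add: sphere_point_radial u_def pos_def power2_eq_square)
  have "(\<lambda>n. sphere_integral (\<lambda>\<theta> \<phi>. (f (v, r *\<^sub>R sphere_point \<theta> \<phi>) - (\<Sum>l\<in>{2..n}. f_m l (v, r *\<^sub>R sphere_point \<theta> \<phi>)))\<^sup>2))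
      \<longlonglongrightarrow> 0"
    using modes r unfolding modes_ge2_def by blast
  then have "(\<lambda>n. ip (\<lambda>p. u v r p - (\<Sum>l\<in>{2..n}. ?e l p)) (\<lambda>p. u v r p - (\<Sum>l\<in>{2..n}. ?e l p))) \<longlonglongrightarrow> 0"
    unfolding eq .
  from sphere_poincare[OF sphere_fun_u[OF r] e this] show ?thesis .
qed

lemma poincare_harmonic:
  assumes Y: "spherical_harmonic l (\<lambda>\<omega>. f (v, r *\<^sub>R \<omega>))" and l: "l \<ge> 2" and r: "r \<ge> 2 * M"
  shows "6 * ip (u v r) (u v r) \<le> ip (u_t v r) (u_t v r) + ip (u_w v r) (u_w v r)"
proof -
  have "2 * 3 \<le> real l * (real l + 1)" using l by (intro mult_mono) auto
  then have "6 * ip (u v r) (u v r) \<le> real l * (real l + 1) * ip (u v r) (u v r)"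
    by (intro mult_right_mono ip_nonneg) simp
  also have "\<dots> = ip (u_t v r) (u_t v r) + ip (u_w v r) (u_w v r)"
    using eigen_harmonic[OF r Y] sphere_fun_u[OF r, of v] unfolding eigen_def by metis
  finally show ?thesis .
qed

end

section \<open>The two potentials\<close>

lemma V_RW_bounds:
  assumes "M > 0"
  shows "continuous_on {2 * M..} (V_RW M)" "r \<ge> 2 * M \<Longrightarrow> V_RW M r \<le> 0" "r \<ge> 2 * M \<Longrightarrow> - 4 \<le> r\<^sup>2 * V_RW M r"
proof -
  show "continuous_on {2 * M..} (V_RW M)"
    unfolding V_RW_def[abs_def] using assms by (intro continuous_intros) auto
  assume r: "r \<ge> 2 * M"
  then show "V_RW M r \<le> 0" using assms by (simp add: V_RW_def)
  have "r\<^sup>2 * V_RW M r = - (8 * M / r)" using r assms by (simp add: V_RW_def field_simps power2_eq_square power3_eq_cube)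
  moreover have "8 * M / r \<le> 4" using r assms by (simp add: pos_divide_le_eq)
  ultimately show "- 4 \<le> r\<^sup>2 * V_RW M r" by simp
qed

text \<open>With \<open>s = k * r\<close> the lower bound becomes a polynomial inequality. Since
  \<open>s >= 2 * M * k\<close>, the difference of its sides splits into products of nonnegative
  factors, for every l at once.\<close>

lemma V_Z_bounds:
  assumes M: "M > 0" and l: "l \<ge> 2"
  shows "continuous_on {2 * M..} (V_Z M l)" "r \<ge> 2 * M \<Longrightarrow> V_Z M l r \<le> 0" "r \<ge> 2 * M \<Longrightarrow> - 4 \<le> r\<^sup>2 * V_Z M l r"
proof -
  define k where "k = (real l - 1) * (real l + 2) / 2"
  have k: "k > 0" using l by (simp add: k_def)
  have V: "V_Z M l r = - 8 * M / r^3 * (((2 * k + 3) * (2 * k * r + 3 * M) * r) / (4 * (k * r + 3 * M)\<^sup>2))" for r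
    by (simp add: V_Z_def k_def Let_def)
  have p: "k * r + 3 * M > 0" "r > 0" if "r \<ge> 2 * M" for r
    using that M k by (auto intro!: add_pos_pos mult_pos_pos)
  show "continuous_on {2 * M..} (V_Z M l)"
    unfolding V[abs_def] using p by (intro continuous_intros) (fastforce simp: less_imp_neq)+
  assume r: "r \<ge> 2 * M"
  show "V_Z M l r \<le> 0" unfolding V using p[OF r] k M
    by (intro mult_nonpos_nonneg divide_nonpos_nonneg divide_nonneg_nonneg) auto
  define s where "s = k * r"
  have s: "s \<ge> 2 * M * k" "s > 0" using r k p[OF r] by (auto simp: s_def mult.commute)
  have "r\<^sup>2 * V_Z M l r = - (2 * M * (2 * k + 3) * (2 * s + 3 * M) / (s + 3 * M)\<^sup>2)"
    unfolding V s_def using p[OF r] by (simp add: power2_eq_square power3_eq_cube mult.assoc)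
  moreover have "2 * M * (2 * k + 3) * (2 * s + 3 * M) / (s + 3 * M)\<^sup>2 \<le> 4"
  proof -
    have "2 * M * (2 * k + 3) * (2 * s + 3 * M) \<le> 4 * (s + 3 * M)\<^sup>2"
  proof -
    have "4 * (s + 3 * M)\<^sup>2 - 2 * M * (2 * k + 3) * (2 * s + 3 * M)
        = 4 * s * (s - 2 * M * k) + 6 * M * (s - 2 * M * k) + 6 * M * s + 18 * (M * M)"
      by (simp add: algebra_simps power2_eq_square)
    moreover have "0 \<le> 4 * s * (s - 2 * M * k) + 6 * M * (s - 2 * M * k) + 6 * M * s + 18 * (M * M)"
      using s M k by (intro add_nonneg_nonneg mult_nonneg_nonneg) auto
    ultimately show ?thesis by simp
  qed
    moreover have "(s + 3 * M)\<^sup>2 > 0" using s M by simp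
    ultimately show ?thesis using pos_divide_le_eq by blast
  qed
  ultimately show "- 4 \<le> r\<^sup>2 * V_Z M l r" by simp
qed

lemma infsum_le_cmult_ennreal:
  fixes f g :: "'a \<Rightarrow> ennreal"
  assumes "\<And>x. x \<in> A \<Longrightarrow> g x \<le> c * f x"
  shows "infsum g A \<le> c * infsum f A"
proof -
  have "sum g F \<le> c * infsum f A" if "finite F" "F \<subseteq> A" for F
  proof -
    have "sum g F \<le> c * sum f F" unfolding sum_distrib_left using assms that by (intro sum_mono) auto
    also have "\<dots> \<le> c * infsum f A"
      using that by (intro mult_left_mono) (auto simp: nonneg_infsum_complete intro!: SUP_upper)
    finally show ?thesis .
  qed
  then show ?thesis by (subst nonneg_infsum_complete) (auto intro!: SUP_least)
qed

theorem theorem1p2: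
  fixes M r_NH :: real and y1 y2 :: "real \<Rightarrow> real"
  assumes "M > 0" and "r_NH > 2 * M" and "N_profiles M r_NH y1 y2"
  shows "\<exists>c::real. c > 0 \<and>
    (\<forall>\<psi> \<tau>\<^sub>0 \<tau>. RW_solution M \<psi> \<and> \<tau>\<^sub>0 < \<tau> \<longrightarrow>
       energy_RW M r_NH y1 y2 \<psi> \<tau> \<le> ennreal c * energy_RW M r_NH y1 y2 \<psi> \<tau>\<^sub>0) \<and>
    (\<forall>\<psi> \<psi>\<^sub>m \<tau>\<^sub>0 \<tau>. Zerilli_solution M \<psi> \<psi>\<^sub>m \<and> \<tau>\<^sub>0 < \<tau> \<longrightarrow>
       energy_Z M r_NH y1 y2 \<psi>\<^sub>m \<tau> \<le> ennreal c * energy_Z M r_NH y1 y2 \<psi>\<^sub>m \<tau>\<^sub>0)"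
proof -
  let ?R = r_NH
  obtain A where A: "A \<ge> 1" and y: "\<And>r. r \<in> {2 * M..<?R} \<Longrightarrow> 0 \<le> y1 r \<and> 0 \<le> y2 r \<and> 1 / 2 + y2 r \<le> A
        \<and> (1 - 2 * M / r) / 2 + y1 r \<le> A * ((1 - 2 * M / r) + (?R - r)) \<and> ?R - r \<le> A * ((1 - 2 * M / r) / 2 + y1 r)"
    using N_profiles_bounds[OF assms] by blast
  have y0: "y1 r = 0 \<and> y2 r = 0" if "r \<ge> ?R" for r
    using assms(3) that by (simp add: N_profiles_def)
  \<comment> \<open>\<open>c\<close> is built from \<open>M\<close>, \<open>r_NH\<close> and the
    bound \<open>A\<close> of the profiles only, so it serves both equations and all modes.\<close>
  define c where "c = A * (4 + 2 * ?R) * (1 + (2 * A + 2 * ?R) + (3 + 12 * ?R / M) * (2 * ?R\<^sup>2 / M)) + 1"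
  have "c > 0"
    unfolding c_def using A assms(1,2) by (intro add_nonneg_pos mult_nonneg_nonneg add_nonneg_nonneg divide_nonneg_nonneg) auto
  have energy: "energy M ?R y1 y2 V f \<tau> \<le> ennreal c * energy M ?R y1 y2 V f \<tau>\<^sub>0"
    if "wave_exterior M f U gr Hs V" "\<tau>\<^sub>0 < \<tau>" for V f U gr Hs \<tau> \<tau>\<^sub>0
  proof -
    interpret wave_exterior M f U gr Hs V by (rule that(1))
    show ?thesis
      using slice_energy_bound[OF assms(2) A less_imp_le[OF that(2)] y]
      by (simp add: energy_eq_slice_energy[OF assms(2) y0] c_def)
  qed
  have RW: "energy_RW M ?R y1 y2 \<psi> \<tau> \<le> ennreal c * energy_RW M ?R y1 y2 \<psi> \<tau>\<^sub>0"
    if sol: "RW_solution M \<psi>" and \<tau>: "\<tau>\<^sub>0 < \<tau>" for \<psi> \<tau> \<tau>\<^sub>0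
  proof -
    obtain \<psi>\<^sub>m where w: "wave_solution M (V_RW M) \<psi>" and m: "modes_ge2 M \<psi> \<psi>\<^sub>m"
      using sol by (auto simp: RW_solution_def)
    obtain U gr Hs where "smooth_exterior M \<psi> U gr Hs"
      using smooth_exterior_exists[OF assms(1)] w unfolding wave_solution_def by blast
    then interpret smooth_exterior M \<psi> U gr Hs .
    have "wave_exterior M \<psi> U gr Hs (V_RW M)"
      using V_RW_bounds[OF assms(1)] w poincare_modes[OF m] by (intro wave_exteriorI)
    then show ?thesis unfolding energy_RW_def by (rule energy[OF _ \<tau>])
  qed
  have Z: "energy_Z M ?R y1 y2 \<psi>\<^sub>m \<tau> \<le> ennreal c * energy_Z M ?R y1 y2 \<psi>\<^sub>m \<tau>\<^sub>0"
    if sol: "Zerilli_solution M \<psi> \<psi>\<^sub>m" and \<tau>: "\<tau>\<^sub>0 < \<tau>" for \<psi> \<psi>\<^sub>m \<tau> \<tau>\<^sub>0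
    unfolding energy_Z_def
  \<comment> \<open>One constant for all l lets the estimate pass to the infinite sum.\<close>
  proof (rule infsum_le_cmult_ennreal)
    fix l :: nat assume "l \<in> {2..}"
    then have l: "l \<ge> 2" by simp
    have w: "wave_solution M (V_Z M l) (\<psi>\<^sub>m l)"
      and Y: "\<And>v r. r \<ge> 2 * M \<Longrightarrow> spherical_harmonic l (\<lambda>\<omega>. \<psi>\<^sub>m l (v, r *\<^sub>R \<omega>))"
      using sol l by (auto simp: Zerilli_solution_def modes_ge2_def)
    obtain U gr Hs where "smooth_exterior M (\<psi>\<^sub>m l) U gr Hs"
      using smooth_exterior_exists[OF assms(1)] w unfolding wave_solution_def by blast
    then interpret smooth_exterior M "\<psi>\<^sub>m l" U gr Hs .
    have "wave_exterior M (\<psi>\<^sub>m l) U gr Hs (V_Z M l)"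
      using V_Z_bounds[OF assms(1) l] w poincare_harmonic[OF Y l] by (intro wave_exteriorI)
    then show "energy M ?R y1 y2 (V_Z M l) (\<psi>\<^sub>m l) \<tau> \<le> ennreal c * energy M ?R y1 y2 (V_Z M l) (\<psi>\<^sub>m l) \<tau>\<^sub>0"
      by (rule energy[OF _ \<tau>])
  qed
  show ?thesis using \<open>c > 0\<close> RW Z by blast
qed

end
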